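(* Let $\mathbb{K}$ be an algebraically closed field. Assume that for every positive integer $N$ and every $v\in\mathsf{Mat}^{\mathrm{sym}}_{N\times N}$ one has $I^{\mathrm{sym}}_v=I(\mathsf{MSV}^{\mathrm{sym}}_v)$ and $J^{\mathrm{sym}}_v=\operatorname{init}(I(\mathsf{MSV}^{\mathrm{sym}}_v))$. Let $n$ be a positive integer and let $w\in\mathcal{I}_\infty^{(n)}$. Then the stable limit $\lim_{m\to\infty}\mathfrak{G}^{\mathsf{O}}_{1^m\times w}$ converges, in the sense of formal power series, to a symmetric element of $\mathbb{K}\llbracket x_1,x_2,x_3,\dots\rrbracket$ (i.e. one invariant under all permutations of the $x$-variables).
   Context: $[k]=\{1,\dots,k\}$. $\mathsf{Mat}^{\mathrm{sym}}_{N\times N}$ is the affine variety of symmetric $N\times N$ matrices over $\mathbb{K}$; $M_{[i][j]}$ is the upper left $i\times j$ submatrix of $M$. Its coordinate ring is $\mathbb{K}[u_{ij}:1\le j\le i\le N]$ with $u_{ij}(M)=M_{ij}$, ordered by the reverse lexicographic term order: monomials of smaller degree are smaller; for distinct monomials $\prod u_{ij}^{a_{ij}}$ and $\prod u_{ij}^{b_{ij}}$ of the same degree, the first is smaller if and only if $a_{ij}>b_{ij}$ for the lexicographically largest $(i,j)$ with $a_{ij}\neq b_{ij}$. For an ideal $I$, $\operatorname{init}(I)$ is the span of the leading monomials of the nonzero elements of $I$. For a set $V$, $I(V)$ is its vanishing ideal. For $v\in\mathsf{Mat}^{\mathrm{sym}}_{N\times N}$ let $\mathsf{MSV}^{\mathrm{sym}}_v=\{M\in\mathsf{Mat}^{\mathrm{sym}}_{N\times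 N}:\operatorname{rank}M_{[i][j]}\le\operatorname{rank}v_{[i][j]}\ \forall i,j\in[N]\}$. Let $\mathcal{U}^{\mathrm{sym}}$ be the symmetric matrix of variables with $\mathcal{U}^{\mathrm{sym}}_{ij}=\mathcal{U}^{\mathrm{sym}}_{ji}=u_{ij}$ for $i\ge j$. Let $I^{\mathrm{sym}}_v$ (respectively $J^{\mathrm{sym}}_v$) be the ideal generated by all $\det(\mathcal{U}^{\mathrm{sym}}_{RC})$ (respectively $\operatorname{adiag}(\mathcal{U}^{\mathrm{sym}}_{RC})$) with $i,j\in[N]$, $R\subseteq[i]$, $C\subseteq[j]$, $|R|=|C|=1+\operatorname{rank}v_{[i][j]}$, where $\mathcal{U}_{RC}$ is the submatrix in rows $R$ and columns $C$ and $\operatorname{adiag}(M)=M_{1,k}M_{2,k-1}\cdots M_{k,1}$ for a $k\times k$ matrix $M$. $S_\infty$ is the group of permutations of $\{1,2,3,\dots\}$ fixing all but finitely many points, and $\mathcal{I}_\infty^{(n)}$ is the set of $w\in S_\infty$ with $w=w^{-1}$ such that $\{i\geq 1:w(i)>w(i+1)\}\subseteq[n]$. Each $w\in\mathcal{I}_\infty^{(n)}$ is identified with the symmetric $n\times n$ partial permutation matrix with $1$ in position $(i,j)\in[n]\times[n]$ if $w(i)=j$ and $0$ otherwise; this defines $\mathsf{MSV}^{\mathrm{sym}}_w$. The permutation $1^m\times w$ fixes each $i\in[m]$ and maps $i+m\mapsto w(i)+m$ for $i\ge1$; if $w\in\mathcal{I}_\infty^{(n)}$ then $1^m\times w\in\mathcal{I}_\infty^{(m+n)}$.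 Let $T_N$ be the torus of invertible diagonal $N\times N$ matrices, acting on $V=\mathsf{Mat}^{\mathrm{sym}}_{N\times N}$ by $t:M\mapsto tMt$. Let $a_i(t)=t_{ii}$; the variable $u_{ij}$ is a weight vector in $\mathbb{K}[V]$ of weight $a_ia_j$. For a finitely generated $\mathbb{K}[V]$-module $M$ with compatible $T_N$-action (equivalently, a compatible $\mathbb{Z}^N$-grading), let $\mathsf{char}(M)=\sum_\chi\dim(M_\chi)\chi$, the sum over weights, as a formal series in $a_1,\dots,a_N$, and let $\mathcal{K}(M)=\mathsf{char}(M)/\mathsf{char}(\mathbb{K}[V])$ be its $K$-polynomial. For $w\in\mathcal{I}_\infty^{(N)}$, $\mathfrak{G}^{\mathsf{O}}_w:=[\mathsf{MSV}^{\mathrm{sym}}_w]_{T_N}=\mathcal{K}(\mathbb{K}[V]/I(\mathsf{MSV}^{\mathrm{sym}}_w))$, a polynomial in $a_1,\dots,a_N$ with integer coefficients, viewed in $\mathbb{K}[a_1,\dots,a_N]$. Setting $x_i=1-a_i$, it is viewed as an element of $\mathbb{K}[x_1,\dots,x_N]$. In the limit, $\mathfrak{G}^{\mathsf{O}}_{1^m\times w}\in\mathbb{K}[x_1,\dots,x_{m+n}]$ is formed using $1^m\times w\in\mathcal{I}_\infty^{(m+n)}$. Convergence in the sense of formal power series means that for each fixed monomial in the $x$-variables the sequence of its coefficients is eventually constant. *)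

theory Defs
  imports
    "HOL-Library.Poly_Mapping"
    "HOL-Computational_Algebra.Polynomial"
    "HOL-Algebra.QuotRing"
    "Jordan_Normal_Form.DL_Rank"
    "Jordan_Normal_Form.DL_Submatrix"
begin

text \<open>
  All indices are 0-based, as in \<^typ>\<open>'a mat\<close>: row, column, point or variable number \<open>i\<close> in the
  usual 1-based notation is \<open>i - 1\<close> here.  In particular \<open>S\<^sub>\<infinity>\<close> acts on \<open>{0, 1, 2, \<dots>}\<close>
  and the variables \<open>x\<^sub>1, x\<^sub>2, \<dots>\<close> are indexed by the whole type \<^typ>\<open>nat\<close>.
  Sizes of submatrices (the \<open>i, j\<close> of an upper left \<open>i \<times> j\<close> block) are not shifted.
\<close>

subsection \<open>Polynomials in several variables\<close>

type_synonym 'v monomial = "'v \<Rightarrow>\<^sub>0 nat"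
type_synonym ('v, 'a) mpol = "'v monomial \<Rightarrow>\<^sub>0 'a"

definition monom_pol :: "'v monomial \<Rightarrow> ('v, 'a::comm_ring_1) mpol" where
  "monom_pol m = Poly_Mapping.single m 1"

definition var_pol :: "'v \<Rightarrow> ('v, 'a::comm_ring_1) mpol" where
  "var_pol v = monom_pol (Poly_Mapping.single v 1)"

definition const_pol :: "'a::comm_ring_1 \<Rightarrow> ('v, 'a) mpol" where
  "const_pol c = Poly_Mapping.single 0 c"

definition eval_mpol ::
  "('b::comm_ring_1 \<Rightarrow> 'r::comm_ring_1) \<Rightarrow> ('v \<Rightarrow> 'r) \<Rightarrow> ('v, 'b) mpol \<Rightarrow> 'r" where
  "eval_mpol \<phi> g p =
     (\<Sum>m\<in>Poly_Mapping.keys p. \<phi> (Poly_Mapping.lookup p m) *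
        (\<Prod>v\<in>Poly_Mapping.keys m. g v ^ Poly_Mapping.lookup m v))"

subsection \<open>The coordinate ring of the symmetric matrices\<close>

definition sym_mat :: "nat \<Rightarrow> 'a::field mat set" where
  "sym_mat N = {M \<in> carrier_mat N N. M\<^sup>T = M}"

definition sym_vars :: "nat \<Rightarrow> (nat \<times> nat) set" where
  "sym_vars N = {(i, j). j \<le> i \<and> i < N}"

text \<open>The record serves both as a ring and as a vector space over the scalars.\<close>

definition coord_alg :: "nat \<Rightarrow> ('a::field, (nat \<times> nat, 'a) mpol) module" where
  "coord_alg N =
     \<lparr>carrier = {p. \<forall>m\<in>Poly_Mapping.keys p. Poly_Mapping.keys m \<subseteq> sym_vars N},
      monoid.mult = (*), one = 1, zero = 0, add = (+), smult = (\<lambda>c p. const_pol c * p)\<rparr>"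

definition vanishing_ideal :: "nat \<Rightarrow> 'a::field mat set \<Rightarrow> (nat \<times> nat, 'a) mpol set" where
  "vanishing_ideal N V =
     {p \<in> carrier (coord_alg N). \<forall>M\<in>V. eval_mpol (\<lambda>c. c) (\<lambda>(i, j). M $$ (i, j)) p = 0}"

definition sym_var_mat :: "nat \<Rightarrow> (nat \<times> nat, 'a::field) mpol mat" where
  "sym_var_mat N = mat N N (\<lambda>(i, j). var_pol (max i j, min i j))"

subsection \<open>The reverse lexicographic order and initial ideals\<close>

definition mon_degree :: "'v monomial \<Rightarrow> nat" where
  "mon_degree m = (\<Sum>v\<in>Poly_Mapping.keys m. Poly_Mapping.lookup m v)"

definition revlex_less :: "(nat \<times> nat) monomial \<Rightarrow> (nat \<times> nat) monomial \<Rightarrow> bool" where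
  "revlex_less a b \<longleftrightarrow>
     mon_degree a < mon_degree b \<or>
     mon_degree a = mon_degree b \<and>
     (\<exists>i j. Poly_Mapping.lookup a (i, j) > Poly_Mapping.lookup b (i, j) \<and>
        (\<forall>k l. i < k \<or> i = k \<and> j < l \<longrightarrow>
           Poly_Mapping.lookup a (k, l) = Poly_Mapping.lookup b (k, l)))"

definition is_leading_monomial ::
  "(nat \<times> nat, 'a::field) mpol \<Rightarrow> (nat \<times> nat) monomial \<Rightarrow> bool" where
  "is_leading_monomial p m \<longleftrightarrow>
     m \<in> Poly_Mapping.keys p \<and> (\<forall>m'\<in>Poly_Mapping.keys p. m' \<noteq> m \<longrightarrow> revlex_less m' m)"

definition init_ideal ::
  "nat \<Rightarrow> (nat \<times> nat, 'a::field) mpol set \<Rightarrow> (nat \<times> nat, 'a) mpol set" where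
  "init_ideal N I =
     LinearCombinations.module.span class_ring (coord_alg N)
       {monom_pol m | m. \<exists>p\<in>I. p \<noteq> 0 \<and> is_leading_monomial p m}"

subsection \<open>Symmetric matrix Schubert varieties and the two determinantal ideals\<close>

definition block_rank :: "'a::field mat \<Rightarrow> nat \<Rightarrow> nat \<Rightarrow> nat" where
  "block_rank M i j = vec_space.rank i (submatrix M {..<i} {..<j})"

definition MSV_sym :: "nat \<Rightarrow> 'a::field mat \<Rightarrow> 'a mat set" where
  "MSV_sym N v =
     {M \<in> sym_mat N. \<forall>i\<in>{1..N}. \<forall>j\<in>{1..N}. block_rank M i j \<le> block_rank v i j}"

definition adiag :: "'r::comm_ring_1 mat \<Rightarrow> 'r" where
  "adiag M = (\<Prod>r<dim_row M. M $$ (r, dim_row M - 1 - r))"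

definition minor_positions :: "nat \<Rightarrow> 'a::field mat \<Rightarrow> (nat set \<times> nat set) set" where
  "minor_positions N v =
     {(R, C). \<exists>i\<in>{1..N}. \<exists>j\<in>{1..N}. R \<subseteq> {..<i} \<and> C \<subseteq> {..<j} \<and>
        card R = 1 + block_rank v i j \<and> card C = 1 + block_rank v i j}"

definition I_sym :: "nat \<Rightarrow> 'a::field mat \<Rightarrow> (nat \<times> nat, 'a) mpol set" where
  "I_sym N v =
     Idl\<^bsub>coord_alg N\<^esub> ((\<lambda>(R, C). det (submatrix (sym_var_mat N) R C)) ` minor_positions N v)"

definition J_sym :: "nat \<Rightarrow> 'a::field mat \<Rightarrow> (nat \<times> nat, 'a) mpol set" where
  "J_sym N v =
     Idl\<^bsub>coord_alg N\<^esub> ((\<lambda>(R, C). adiag (submatrix (sym_var_mat N) R C)) ` minor_positions N v)"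

subsection \<open>Involutions\<close>

definition S_inf :: "(nat \<Rightarrow> nat) set" where
  "S_inf = {w. bij w \<and> finite {i. w i \<noteq> i}}"

definition I_inf :: "nat \<Rightarrow> (nat \<Rightarrow> nat) set" where
  "I_inf n = {w \<in> S_inf. w = inv_into UNIV w \<and> {i. w i > w (i + 1)} \<subseteq> {..<n}}"

definition partial_perm_mat :: "nat \<Rightarrow> (nat \<Rightarrow> nat) \<Rightarrow> 'a::field mat" where
  "partial_perm_mat n w = mat n n (\<lambda>(i, j). if w i = j then 1 else 0)"

definition shift_perm :: "nat \<Rightarrow> (nat \<Rightarrow> nat) \<Rightarrow> nat \<Rightarrow> nat" where
  "shift_perm m w i = (if i < m then i else w (i - m) + m)"

subsection \<open>Characters and \<open>K\<close>-polynomials\<close>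

text \<open>
  A formal power series is its coefficient function.  Only nonnegative weights occur in
  the coordinate ring and its quotients, so a weight is a monomial in the \<open>a\<^sub>i\<close>;
  the variable \<open>u\<^sub>i\<^sub>j\<close> has weight \<open>a\<^sub>i a\<^sub>j\<close> (which is \<open>a\<^sub>i\<^sup>2\<close> for \<open>i = j\<close>).
\<close>

type_synonym 'c series = "nat monomial \<Rightarrow> 'c"

definition series_mult :: "'c::comm_ring_1 series \<Rightarrow> 'c series \<Rightarrow> 'c series" where
  "series_mult f g = (\<lambda>\<chi>. \<Sum>(\<alpha>, \<beta>) | \<alpha> + \<beta> = \<chi>. f \<alpha> * g \<beta>)"

definition mon_weight :: "(nat \<times> nat) monomial \<Rightarrow> nat monomial" where
  "mon_weight m =
     (\<Sum>(i, j)\<in>Poly_Mapping.keys m.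
        Poly_Mapping.single i (Poly_Mapping.lookup m (i, j)) +
        Poly_Mapping.single j (Poly_Mapping.lookup m (i, j)))"

definition coord_weight_space ::
  "nat \<Rightarrow> nat monomial \<Rightarrow> (nat \<times> nat, 'a::field) mpol set" where
  "coord_weight_space N \<chi> =
     {p \<in> carrier (coord_alg N). \<forall>m\<in>Poly_Mapping.keys p. mon_weight m = \<chi>}"

text \<open>The character of a vector space \<open>M\<close> with weight spaces \<open>W \<chi>\<close>.\<close>

definition graded_char :: "('a::field, 'm) module \<Rightarrow> (nat monomial \<Rightarrow> 'm set) \<Rightarrow> int series" where
  "graded_char M W = (\<lambda>\<chi>. int (vectorspace.dim class_ring (M\<lparr>carrier := W \<chi>\<rparr>)))"

text \<open>
  \<open>char(M) / char(K[V])\<close>.  The divisor has constant coefficient 1, so at most one \<open>P\<close> qualifies.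
\<close>

definition K_polynomial ::
  "nat \<Rightarrow> ('a::field, 'm) module \<Rightarrow> (nat monomial \<Rightarrow> 'm set) \<Rightarrow> (nat, int) mpol" where
  "K_polynomial N M W =
     (THE P. series_mult (Poly_Mapping.lookup P)
               (graded_char (coord_alg N :: ('a, (nat \<times> nat, 'a) mpol) module) (coord_weight_space N))
             = graded_char M W)"

text \<open>The scalar \<open>c\<close> times the coset \<open>I + p\<close> is \<open>I + c p\<close> (also for \<open>c = 0\<close>).\<close>

definition quot_alg ::
  "nat \<Rightarrow> (nat \<times> nat, 'a::field) mpol set \<Rightarrow> ('a, (nat \<times> nat, 'a) mpol set) module" where
  "quot_alg N I =
     \<lparr>carrier = carrier (coord_alg N Quot I), monoid.mult = monoid.mult (coord_alg N Quot I),
      one = \<one>\<^bsub>coord_alg N Quot I\<^esub>, zero = \<zero>\<^bsub>coord_alg N Quot I\<^esub>,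
      add = add (coord_alg N Quot I),
      smult = (\<lambda>c X. I <+>\<^bsub>coord_alg N\<^esub> ((\<lambda>p. c \<odot>\<^bsub>coord_alg N\<^esub> p) ` X))\<rparr>"

definition quot_weight_space ::
  "nat \<Rightarrow> (nat \<times> nat, 'a::field) mpol set \<Rightarrow> nat monomial \<Rightarrow> (nat \<times> nat, 'a) mpol set set" where
  "quot_weight_space N I \<chi> = (\<lambda>p. I +>\<^bsub>coord_alg N\<^esub> p) ` coord_weight_space N \<chi>"

definition K_class :: "nat \<Rightarrow> 'a::field mat set \<Rightarrow> (nat, int) mpol" where
  "K_class N V =
     K_polynomial N (quot_alg N (vanishing_ideal N V)) (quot_weight_space N (vanishing_ideal N V))"

text \<open>
  The class of the variety of \<open>w\<close>, first as a polynomial in the \<open>a\<^sub>i\<close> with integer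
  coefficients, then with coefficients in the field and \<open>a\<^sub>i = 1 - x\<^sub>i\<close> substituted.
\<close>

definition GO_a :: "'a::field itself \<Rightarrow> nat \<Rightarrow> (nat \<Rightarrow> nat) \<Rightarrow> (nat, int) mpol" where
  "GO_a _ N w = K_class N (MSV_sym N (partial_perm_mat N w :: 'a mat))"

definition GO :: "nat \<Rightarrow> (nat \<Rightarrow> nat) \<Rightarrow> (nat, 'a::field) mpol" where
  "GO N w = eval_mpol of_int (\<lambda>i. 1 - var_pol i) (GO_a TYPE('a) N w)"

subsection \<open>Limits and symmetry of formal power series\<close>

definition converges_to :: "(nat \<Rightarrow> (nat, 'a::field) mpol) \<Rightarrow> 'a series \<Rightarrow> bool" where
  "converges_to F f \<longleftrightarrow> (\<forall>\<mu>. \<forall>\<^sub>F m in sequentially. Poly_Mapping.lookup (F m) \<mu> = f \<mu>)"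

definition symmetric_series :: "'a series \<Rightarrow> bool" where
  "symmetric_series f \<longleftrightarrow> (\<forall>\<pi>. bij \<pi> \<longrightarrow> (\<forall>\<mu>. f (Poly_Mapping.map_key \<pi> \<mu>) = f \<mu>))"

end

theory Submission
  imports Defs
begin

text \<open>
  A determinantal ideal is homogeneous for the torus weights, so the character of its quotient counts
  the monomials that are not leading monomials, that is, the monomials divisible by no antidiagonal
  generator.  Inclusion--exclusion over sets \<open>S\<close> of generators turns this count into the formula
  \<open>\<Sum>\<^sub>S (-1)\<^bsup>|S|\<^esup> a\<^bsup>wt (lcm S)\<^esup>\<close> for the \<open>K\<close>-polynomial.

  To read off a coefficient in \<open>x\<^sub>0, \<dots>, x\<^bsub>d-1\<^esub>\<close> one may set \<open>a\<^sub>i = 1\<close> for \<open>i \<ge> d\<close>; then only the variables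
  \<open>u\<^sub>i\<^sub>j\<close> with \<open>j < d\<close> matter.  The alternating sum depends only on the set of the generators restricted to
  these variables, since the sum over the sets with a given image collapses to a sign.  For \<open>m \<ge> 2 d\<close>
  an antidiagonal meets these variables only in its first and last \<open>d\<close> entries, and inserting or
  deleting an entry in its middle identifies the restricted generators for \<open>m\<close> with those for \<open>m + 1\<close>
  up to the shift \<open>i \<mapsto> i + 1\<close>.  Hence the coefficients are constant for \<open>m \<ge> 2 d\<close>.

  The variety for \<open>1\<^sup>m \<times> w\<close> has no rank conditions on blocks with at most \<open>m\<close> rows or columns, so it is
  invariant under conjugation by permutations of the first \<open>m\<close> indices.  Its class is therefore
  symmetric in the first \<open>m\<close> variables, and the limit is symmetric.
\<close>

subsection \<open>Polynomials with bounded support\<close>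

text \<open>Two descriptions of one K-polynomial are combined. The formula over sets of
  antidiagonals shows stability, but it comes from a term order that ranks the indices, so it hides
  the symmetry. The vanishing ideal shows the symmetry, but not how the class varies with
  \<open>m\<close>. The link is that \<open>K_polynomial\<close> is determined by the character of
  the quotient, and each weight space can be measured with any set of monomials that is a basis
  modulo the ideal. The formula over all sets of generators is that of Taylor's resolution. It holds
  for every finite set of monomial generators, minimal or not; this matters because different
  antidiagonals may become equal after restriction, and the restricted generators for
  \<open>m\<close> and \<open>m + 1\<close> are matched only as sets. The bound 2 d has this origin:
  an antidiagonal for \<open>m\<close> has length k > m, so for m \<ge> 2 d its first and last d
  entries are disjoint and at least one entry lies between them, the one that can be removed. The
  larger indices at the two ends are at least k - d and move along with \<open>m\<close>, which is
  why rows will be counted from m - d.\<close>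

abbreviation lookup :: "('v \<Rightarrow>\<^sub>0 'c::zero) \<Rightarrow> 'v \<Rightarrow> 'c" where
  "lookup \<equiv> Poly_Mapping.lookup"

abbreviation keys :: "('v \<Rightarrow>\<^sub>0 'c::zero) \<Rightarrow> 'v set" where
  "keys \<equiv> Poly_Mapping.keys"

abbreviation single :: "'v \<Rightarrow> 'c::zero \<Rightarrow> 'v \<Rightarrow>\<^sub>0 'c" where
  "single \<equiv> Poly_Mapping.single"

lemma lookup_sum_singles:
  assumes "finite A"
  shows "lookup (\<Sum>m\<in>A. single m (c m)) k = (if k \<in> A then c k else 0)"
  using assms by (simp add: lookup_sum lookup_single when_def)

lemma sum_singles_keys: "(\<Sum>m\<in>keys p. single m (lookup p m)) = p"
  by (rule poly_mapping_eqI) (simp add: lookup_sum_singles in_keys_iff)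

lemma keys_sum_subset:
  assumes "\<And>a. a \<in> A \<Longrightarrow> keys (f a) \<subseteq> S"
  shows "keys (sum f A) \<subseteq> S"
  using keys_sum[of f A] assms by blast

lemma lookup_const_pol_mult [simp]: "lookup (const_pol c * p) m = c * lookup p m"
proof -
  have "const_pol c * p = (\<Sum>k\<in>keys p. const_pol c * single k (lookup p k))"
    by (subst (1) sum_singles_keys[symmetric]) (simp add: sum_distrib_left)
  also have "\<dots> = (\<Sum>k\<in>keys p. single k (c * lookup p k))"
    by (simp add: const_pol_def mult_single)
  finally show ?thesis
    by (simp add: lookup_sum_singles in_keys_iff)
qed

lemma const_pol_mult: "const_pol (a * b) = const_pol a * const_pol b"
  by (simp add: const_pol_def mult_single)

lemma const_pol_add: "const_pol (a + b) = const_pol a + const_pol b"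
  by (simp add: const_pol_def single_add)

lemma const_pol_1 [simp]: "const_pol 1 = 1"
  by (simp add: const_pol_def)

lemma keys_const_pol_mult: "keys (const_pol c * p) \<subseteq> keys p"
  by (auto simp: in_keys_iff)

lemma lookup_single_mult:
  fixes p :: "('v, 'c::comm_ring_1) mpol"
  shows "lookup (single a c * p) (a + m) = c * lookup p m"
proof -
  have "single a c * p = (\<Sum>k\<in>keys p. single (a + k) (c * lookup p k))"
    by (subst (1) sum_singles_keys[of p, symmetric]) (simp add: sum_distrib_left mult_single)
  also have "lookup \<dots> (a + m) = c * lookup p m"
    by (simp add: lookup_sum lookup_single when_def in_keys_iff)
  finally show ?thesis .
qed

lemma lookup_single_mult_zero:
  fixes p :: "('v, 'c::comm_ring_1) mpol"
  assumes "\<And>k. m \<noteq> a + k"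
  shows "lookup (single a c * p) m = 0"
proof -
  have "single a c * p = (\<Sum>k\<in>keys p. single (a + k) (c * lookup p k))"
    by (subst (1) sum_singles_keys[of p, symmetric]) (simp add: sum_distrib_left mult_single)
  also have "lookup \<dots> m = 0"
    by (simp add: lookup_sum lookup_single when_def assms[symmetric])
  finally show ?thesis .
qed

lemma keys_add_monomial: "keys (a + b) = keys a \<union> keys (b :: 'v monomial)"
  by (auto simp: in_keys_iff lookup_add)

definition mons :: "nat \<Rightarrow> (nat \<times> nat) monomial set" where
  "mons N = {m. keys m \<subseteq> sym_vars N}"

lemma mons_add [simp]: "a + b \<in> mons N \<longleftrightarrow> a \<in> mons N \<and> b \<in> mons N"
  by (auto simp: mons_def keys_add_monomial)

lemma mons_0 [simp]: "0 \<in> mons N"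
  by (simp add: mons_def)

lemma coord_alg_simps [simp]:
  "carrier (coord_alg N) = {p. keys p \<subseteq> mons N}"
  "monoid.mult (coord_alg N) = (*)"
  "one (coord_alg N) = 1"
  "zero (coord_alg N) = 0"
  "add (coord_alg N) = (+)"
  "module.smult (coord_alg N) = (\<lambda>c p. const_pol c * p)"
  by (auto simp: coord_alg_def mons_def)

lemma keys_mult_mons:
  assumes "keys p \<subseteq> mons N" "keys q \<subseteq> mons N"
  shows "keys (p * q) \<subseteq> mons N"
  using keys_mult[of p q] assms by fastforce

lemma keys_add_subset:
  assumes "keys p \<subseteq> S" "keys q \<subseteq> S"
  shows "keys (p + q) \<subseteq> S"
  using keys_add[of p q] assms by blast

lemma keys_diff_subset:
  assumes "keys p \<subseteq> S" "keys q \<subseteq> S"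
  shows "keys (p - q) \<subseteq> S"
  using keys_diff[of p q] assms by blast

lemma cring_coord_alg: "cring (coord_alg N :: ('a::field, _) module)"
proof (rule cringI)
  show "abelian_group (coord_alg N :: ('a, _) module)"
  proof (rule abelian_groupI)
    fix x :: "(nat \<times> nat, 'a) mpol"
    assume "x \<in> carrier (coord_alg N)"
    then show "\<exists>y\<in>carrier (coord_alg N). y \<oplus>\<^bsub>coord_alg N\<^esub> x = \<zero>\<^bsub>coord_alg N\<^esub>"
      by (intro bexI[of _ "- x"]) (auto simp: in_keys_iff)
  qed (auto simp: keys_add_subset algebra_simps)
  show "comm_monoid (coord_alg N :: ('a, _) module)"
    by (rule comm_monoidI) (auto simp: keys_mult_mons algebra_simps)
qed (auto simp: algebra_simps)

lemma ring_coord_alg: "ring (coord_alg N :: ('a::field, _) module)"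
  by (intro cring.axioms(1) cring_coord_alg)

lemma a_minus_coord_alg:
  assumes "keys p \<subseteq> mons N" "keys (q :: (nat \<times> nat, 'a::field) mpol) \<subseteq> mons N"
  shows "p \<ominus>\<^bsub>coord_alg N\<^esub> q = p - q"
proof -
  interpret ring "coord_alg N :: ('a, _) module" by (rule ring_coord_alg)
  have "\<ominus>\<^bsub>coord_alg N\<^esub> q = - q"
    by (rule minus_equality) (use assms in \<open>auto simp: in_keys_iff\<close>)
  then show ?thesis by (simp add: a_minus_def)
qed

text \<open>The whole algebra (\<open>S = mons N\<close>), its weight spaces and the spans of
  standard monomials all have this form, so one treatment covers them.\<close>

abbreviation supported_space ::
  "nat \<Rightarrow> (nat \<times> nat) monomial set \<Rightarrow> ('a::field, (nat \<times> nat, 'a) mpol) module" where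
  "supported_space N S \<equiv> (coord_alg N)\<lparr>carrier := {p. keys p \<subseteq> S}\<rparr>"

lemma vectorspace_supported: "vectorspace class_ring (supported_space N S :: ('a::field, _) module)"
proof (rule vs_criteria)
  show "field (class_ring :: 'a ring)" by (rule class_field)
  show "\<forall>v\<in>carrier (supported_space N S). \<exists>u\<in>carrier (supported_space N S).
      v \<oplus>\<^bsub>supported_space N S\<^esub> u = \<zero>\<^bsub>(supported_space N S :: ('a, _) module)\<^esub>"
  proof
    fix v :: "(nat \<times> nat, 'a) mpol"
    assume "v \<in> carrier (supported_space N S)"
    then show "\<exists>u\<in>carrier (supported_space N S). v \<oplus>\<^bsub>supported_space N S\<^esub> u = \<zero>\<^bsub>supported_space N S\<^esub>"
      by (intro bexI[of _ "- v"]) (auto simp: in_keys_iff)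
  qed
qed (auto simp: keys_add_subset add_ac keys_const_pol_mult[THEN subset_trans] lookup_add distrib_left distrib_right mult.assoc
       intro!: poly_mapping_eqI)

lemma finsum_supported:
  fixes f :: "'b \<Rightarrow> (nat \<times> nat, 'a::field) mpol"
  assumes "\<And>a. a \<in> A \<Longrightarrow> keys (f a) \<subseteq> S"
  shows "finsum (supported_space N S) f A = sum f A"
proof -
  interpret vectorspace class_ring "supported_space N S :: ('a, _) module"
    by (rule vectorspace_supported)
  show ?thesis
  proof (cases "finite A")
    case True
    then show ?thesis using assms
      by (induction A rule: finite_induct) (auto simp: finsum_insert)
  next
    case False
    then show ?thesis by (simp add: finsum_infinite)
  qed
qed

lemma basis_supported:
  assumes "finite S"
  shows "vectorspace.basis class_ring (supported_space N S :: ('a::field, _) module) (monom_pol ` S)"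
proof -
  let ?V = "supported_space N S :: ('a, _) module"
  interpret vectorspace class_ring ?V by (rule vectorspace_supported)
  have sub: "monom_pol ` S \<subseteq> carrier ?V" by (auto simp: monom_pol_def)
  have inj: "inj_on (monom_pol :: _ \<Rightarrow> (nat \<times> nat, 'a) mpol) S"
    by (rule inj_onI) (metis monom_pol_def lookup_single_eq lookup_single_not_eq zero_neq_one)
  have lc: "module.lincomb a (monom_pol ` S) = (\<Sum>m\<in>S. single m (a (monom_pol m)))" for a
  proof -
    have "module.lincomb a (monom_pol ` S) = (\<Sum>v\<in>monom_pol ` S. const_pol (a v) * v)"
      unfolding lincomb_def
      by (simp, rule finsum_supported) (auto simp: monom_pol_def in_keys_iff lookup_single when_def split: if_splits)
    also have "\<dots> = (\<Sum>m\<in>S. single m (a (monom_pol m)))"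
      by (subst sum.reindex[OF inj]) (simp add: const_pol_def monom_pol_def mult_single)
    finally show ?thesis .
  qed
  have "module.lin_indpt (monom_pol ` S)"
  proof (rule finite_lin_indpt2)
    fix a assume "module.lincomb a (monom_pol ` S) = \<zero>\<^bsub>?V\<^esub>"
    then have "lookup (\<Sum>m\<in>S. single m (a (monom_pol m))) k = 0" for k
      by (simp add: lc)
    then have "a (monom_pol k) = 0" if "k \<in> S" for k
      using that lookup_sum_singles[OF assms, of "\<lambda>m. a (monom_pol m)" k] by simp
    then show "\<forall>v\<in>monom_pol ` S. a v = \<zero>\<^bsub>class_ring\<^esub>"
      by auto
  qed (use assms sub in auto)
  moreover have "module.gen_set (monom_pol ` S)"
  proof (intro equalityI subsetI)
    fix p assume p: "p \<in> carrier ?V"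
    \<comment> \<open>A linear combination takes its coefficients as a function of the vectors, so
      the monomial has to be recovered from the vector.\<close>
    define a :: "(nat \<times> nat, 'a) mpol \<Rightarrow> 'a"
      where "a = (\<lambda>v. lookup p (the_inv_into S monom_pol v))"
    have "module.lincomb a (monom_pol ` S) = (\<Sum>m\<in>S. single m (lookup p m))"
      unfolding lc a_def by (intro sum.cong) (auto simp: the_inv_into_f_f[OF inj])
    also have "\<dots> = p"
      using p by (intro poly_mapping_eqI) (auto simp: lookup_sum_singles assms in_keys_iff)
    finally show "p \<in> module.span (monom_pol ` S)"
      unfolding finite_span[OF finite_imageI[OF assms] sub] by (auto intro: exI[of _ a])
  qed (use span_closed[OF sub] in blast)
  ultimately show ?thesis using sub by (simp add: basis_def)
qed

lemma fin_dim_supported: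
  assumes "finite S"
  shows "vectorspace.fin_dim class_ring (supported_space N S :: ('a::field, _) module)"
proof -
  let ?V = "supported_space N S :: ('a, _) module"
  interpret vectorspace class_ring ?V by (rule vectorspace_supported)
  show ?thesis using basis_supported[OF assms, of N, where ?'a = 'a] assms
    unfolding fin_dim_def basis_def by (intro exI[of _ "monom_pol ` S"]) simp
qed

lemma dim_supported:
  assumes "finite S"
  shows "vectorspace.dim class_ring (supported_space N S :: ('a::field, _) module) = card S"
proof -
  let ?V = "supported_space N S :: ('a, _) module"
  interpret vectorspace class_ring ?V by (rule vectorspace_supported)
  have inj: "inj_on (monom_pol :: _ \<Rightarrow> (nat \<times> nat, 'a) mpol) S"
    by (rule inj_onI) (metis monom_pol_def lookup_single_eq lookup_single_not_eq zero_neq_one)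
  show ?thesis
    using dim_basis[OF _ basis_supported[OF assms, of N, where ?'a = 'a]] assms card_image[OF inj] by simp
qed

subsection \<open>Standard monomials and graded characters\<close>

lemma mon_weight_alt:
  assumes "finite A" "keys m \<subseteq> A"
  shows "mon_weight m = (\<Sum>(a, b)\<in>A. single a (lookup m (a, b)) + single b (lookup m (a, b)))"
  unfolding mon_weight_def using assms
  by (intro sum.mono_neutral_left) (auto simp: in_keys_iff)

lemma mon_weight_0 [simp]: "mon_weight 0 = 0"
  by (simp add: mon_weight_def)

lemma mon_weight_add [simp]: "mon_weight (m + m') = mon_weight m + mon_weight m'"
  by (simp add: mon_weight_alt[of "keys m \<union> keys m'"] keys_add_monomial lookup_add single_add
      sum.distrib case_prod_unfold add_ac)

lemma mon_weight_sum: "mon_weight (\<Sum>a\<in>A. f a) = (\<Sum>a\<in>A. mon_weight (f a))"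
  by (induction A rule: infinite_finite_induct) auto

lemma mon_weight_single [simp]: "mon_weight (single (a, b) c) = single a c + single b c"
  by (simp add: mon_weight_alt[of "{(a, b)}"])

lemma lookup_mon_weight:
  assumes "finite A" "keys m \<subseteq> A"
  shows "lookup (mon_weight m) i =
    (\<Sum>(a, b)\<in>A. (lookup m (a, b) when a = i) + (lookup m (a, b) when b = i))"
  by (simp add: mon_weight_alt[OF assms] lookup_sum lookup_add lookup_single case_prod_unfold)

text \<open>Bounds all exponents by the weight: hence only finitely many monomials share a weight,
  and only the monomial 1 has weight 0.\<close>

lemma lookup_le_mon_weight: "lookup m (a, b) \<le> lookup (mon_weight m) a"
proof (cases "(a, b) \<in> keys m")
  case True
  have "lookup m (a, b) \<le> (case (a, b) of (x, y) \<Rightarrow> (lookup m (x, y) when x = a) + (lookup m (x, y) when y = a))"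
    by simp
  also have "\<dots> \<le> lookup (mon_weight m) a"
    unfolding lookup_mon_weight[OF finite_keys order_refl]
    by (rule member_le_sum[OF True]) auto
  finally show ?thesis .
qed (simp add: in_keys_iff)

lemma mon_weight_eq_0_iff [simp]: "mon_weight m = 0 \<longleftrightarrow> m = 0"
proof
  assume "mon_weight m = 0"
  then have "lookup m v = 0" for v
    using lookup_le_mon_weight[of m "fst v" "snd v"] by simp
  then show "m = 0" by (intro poly_mapping_eqI) simp
qed simp

definition mons_of_weight :: "nat \<Rightarrow> nat monomial \<Rightarrow> (nat \<times> nat) monomial set" where
  "mons_of_weight N \<chi> = {m \<in> mons N. mon_weight m = \<chi>}"

lemma finite_sym_vars [simp]: "finite (sym_vars N)"
  by (rule finite_subset[of _ "{..<N} \<times> {..<N}"]) (auto simp: sym_vars_def)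

lemma finite_mons_of_weight [simp]: "finite (mons_of_weight N \<chi>)"
proof -
  let ?F = "{f. \<forall>v. (v \<in> sym_vars N \<longrightarrow> f v \<in> {..Max (lookup \<chi> ` {..<N})}) \<and> (v \<notin> sym_vars N \<longrightarrow> f v = (0::nat))}"
  have "lookup ` mons_of_weight N \<chi> \<subseteq> ?F"
  proof clarify
    fix m a b assume m: "m \<in> mons_of_weight N \<chi>"
    have "lookup m (a, b) \<le> Max (lookup \<chi> ` {..<N})" if "(a, b) \<in> sym_vars N"
    proof -
      have "lookup m (a, b) \<le> lookup \<chi> a"
        using m lookup_le_mon_weight[of m a b] by (simp add: mons_of_weight_def)
      also have "\<dots> \<le> Max (lookup \<chi> ` {..<N})"
        using that by (intro Max_ge) (auto simp: sym_vars_def)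
      finally show ?thesis .
    qed
    then show "((a, b) \<in> sym_vars N \<longrightarrow> lookup m (a, b) \<in> {..Max (lookup \<chi> ` {..<N})}) \<and>
        ((a, b) \<notin> sym_vars N \<longrightarrow> lookup m (a, b) = 0)"
      using m by (auto simp: mons_of_weight_def mons_def in_keys_iff)
  qed
  moreover have "finite ?F" by (rule finite_set_of_finite_funs) auto
  ultimately have "finite (lookup ` mons_of_weight N \<chi>)" by (rule finite_subset)
  then show ?thesis by (rule finite_imageD) (simp add: inj_on_def)
qed

lemma coord_weight_space_alt: "coord_weight_space N \<chi> = {p. keys p \<subseteq> mons_of_weight N \<chi>}"
  by (auto simp: coord_weight_space_def mons_of_weight_def)

lemma graded_char_coord:
  "graded_char (coord_alg N :: ('a::field, _) module) (coord_weight_space N) \<chi> =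
     int (card (mons_of_weight N \<chi>))"
  by (simp add: graded_char_def coord_weight_space_alt dim_supported)

definition weight_part :: "nat monomial \<Rightarrow> (nat \<times> nat, 'a::zero) mpol \<Rightarrow> (nat \<times> nat, 'a) mpol" where
  "weight_part \<chi> p = Abs_poly_mapping (\<lambda>m. lookup p m when mon_weight m = \<chi>)"

lemma lookup_weight_part [simp]: "lookup (weight_part \<chi> p) m = (lookup p m when mon_weight m = \<chi>)"
proof -
  have "finite {m. (lookup p m when mon_weight m = \<chi>) \<noteq> 0}"
    by (rule finite_subset[of _ "keys p"]) (auto simp: in_keys_iff)
  then show ?thesis by (simp add: weight_part_def)
qed

lemma keys_weight_part: "keys (weight_part \<chi> p) = {m \<in> keys p. mon_weight m = \<chi>}"
  by (auto simp: in_keys_iff)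

text \<open>Homogeneity in the form in which it is used: components of ideal elements may be taken
  without leaving the ideal.\<close>

definition weight_graded :: "(nat \<times> nat, 'a::zero) mpol set \<Rightarrow> bool" where
  "weight_graded I \<longleftrightarrow> (\<forall>p\<in>I. \<forall>\<chi>. weight_part \<chi> p \<in> I)"

section \<open>The reverse lexicographic order and leading monomials\<close>

lemma revlex_less_irrefl [simp]: "\<not> revlex_less a a"
  by (auto simp: revlex_less_def)

lemma revlex_lessI:
  assumes "mon_degree a = mon_degree b" "lookup b (i, j) < lookup a (i, j)"
    "\<And>k l. i < k \<or> i = k \<and> j < l \<Longrightarrow> lookup a (k, l) = lookup b (k, l)"
  shows "revlex_less a b"
  using assms unfolding revlex_less_def by blast

lemma revlex_less_trans:
  assumes "revlex_less a b" "revlex_less b c"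
  shows "revlex_less a c"
proof (cases "mon_degree a < mon_degree c")
  case False
  from assms False have deg: "mon_degree a = mon_degree b" "mon_degree b = mon_degree c"
    by (auto simp: revlex_less_def)
  obtain i j where 1: "lookup b (i, j) < lookup a (i, j)"
      "\<And>k l. i < k \<or> i = k \<and> j < l \<Longrightarrow> lookup a (k, l) = lookup b (k, l)"
    using assms(1) deg by (auto simp: revlex_less_def)
  obtain i' j' where 2: "lookup c (i', j') < lookup b (i', j')"
      "\<And>k l. i' < k \<or> i' = k \<and> j' < l \<Longrightarrow> lookup b (k, l) = lookup c (k, l)"
    using assms(2) deg by (auto simp: revlex_less_def)
  consider "i < i' \<or> i = i' \<and> j < j'" | "i' < i \<or> i = i' \<and> j' < j" | "i = i'" "j = j'"
    by linarith
  then show ?thesis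
  proof cases
    case c: 1
    show ?thesis
      by (rule revlex_lessI[of _ _ i' j']) (use deg 1(2) 2 c in auto)
  next
    case c: 2
    show ?thesis
      by (rule revlex_lessI[of _ _ i j]) (use deg 1 2(2) c in auto)
  next
    case c: 3
    show ?thesis
      by (rule revlex_lessI[of _ _ i j]) (use deg 1 2 c in auto)
  qed
qed (auto simp: revlex_less_def)

lemma revlex_less_total:
  assumes "a \<noteq> b"
  shows "revlex_less a b \<or> revlex_less b a"
proof -
  define D where "D = {v. lookup a v \<noteq> lookup b v}"
  have fin: "finite D"
    by (rule finite_subset[of _ "keys a \<union> keys b"]) (auto simp: D_def in_keys_iff)
  have ne: "D \<noteq> {}" using assms poly_mapping_eqI[of a b] by (auto simp: D_def)
  \<comment> \<open>The lexicographically largest position of difference: the last row that contains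
    one, then the last column in that row.\<close>
  define i where "i = Max (fst ` D)"
  define j where "j = Max {j. (i, j) \<in> D}"
  have finj: "finite {j. (i, j) \<in> D}"
    by (rule finite_subset[of _ "snd ` D"]) (use fin in force)+
  have "i \<in> fst ` D" unfolding i_def by (rule Max_in) (use fin ne in auto)
  then have nej: "{j. (i, j) \<in> D} \<noteq> {}" by auto
  have ij: "(i, j) \<in> D" using Max_in[OF finj nej] by (simp add: j_def)
  have max: "lookup a (k, l) = lookup b (k, l)" if "i < k \<or> i = k \<and> j < l" for k l
  proof (rule ccontr)
    assume "lookup a (k, l) \<noteq> lookup b (k, l)"
    then have kl: "(k, l) \<in> D" by (simp add: D_def)
    then have "k \<le> i" unfolding i_def using fin by (intro Max_ge) force+
    with that have "k = i" "j < l" by auto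
    with kl show False using Max_ge[OF finj, of l] by (auto simp: j_def)
  qed
  have "lookup a (i, j) < lookup b (i, j) \<or> lookup b (i, j) < lookup a (i, j)"
    using ij by (auto simp: D_def)
  then show ?thesis using max by (force simp: revlex_less_def)
qed

lemma ex_leading_monomial:
  assumes "p \<noteq> 0"
  shows "\<exists>m. is_leading_monomial p m"
proof -
  have "\<exists>m\<in>A. \<forall>m'\<in>A. m' \<noteq> m \<longrightarrow> revlex_less m' m" if "finite A" "A \<noteq> {}" for A
    using that
  proof (induction A rule: finite_ne_induct)
    case (insert x A)
    then obtain m where m: "m \<in> A" "\<And>m'. m' \<in> A \<Longrightarrow> m' \<noteq> m \<Longrightarrow> revlex_less m' m" by blast
    with insert.hyps have "revlex_less x m \<or> revlex_less m x"
      using revlex_less_total[of x m] by auto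
    then show ?case
    proof
      assume "revlex_less m x"
      then show ?thesis using m by (intro bexI[of _ x]) (auto intro: revlex_less_trans)
    qed (use m in \<open>auto intro: bexI[of _ m]\<close>)
  qed auto
  from this[of "keys p"] assms show ?thesis
    by (auto simp: is_leading_monomial_def)
qed

definition leading_monomials :: "(nat \<times> nat, 'a::field) mpol set \<Rightarrow> (nat \<times> nat) monomial set" where
  "leading_monomials I = {m. \<exists>p\<in>I. p \<noteq> 0 \<and> is_leading_monomial p m}"

definition standard_monomials ::
  "nat \<Rightarrow> (nat \<times> nat, 'a::field) mpol set \<Rightarrow> nat monomial \<Rightarrow> (nat \<times> nat) monomial set" where
  "standard_monomials N I \<chi> = mons_of_weight N \<chi> - leading_monomials I"

lemma standard_monomials_subset: "standard_monomials N I \<chi> \<subseteq> mons_of_weight N \<chi>"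
  by (auto simp: standard_monomials_def)

section \<open>Weight spaces of the quotient by an ideal\<close>

context
  fixes N :: nat and I :: "(nat \<times> nat, 'a::field) mpol set"
  assumes I: "ideal I (coord_alg N)"
begin

interpretation ideal I "coord_alg N" by (rule I)

lemma ideal_carrier: "p \<in> I \<Longrightarrow> keys p \<subseteq> mons N"
  using Icarr[of p] by simp

lemma ideal_add: "p \<in> I \<Longrightarrow> q \<in> I \<Longrightarrow> p + q \<in> I"
  using additive_subgroup.a_closed[OF is_additive_subgroup, of p q] by simp

lemma ideal_mult: "p \<in> I \<Longrightarrow> keys q \<subseteq> mons N \<Longrightarrow> q * p \<in> I"
  using I_l_closed[of p q] by simp

lemma ideal_smult: "p \<in> I \<Longrightarrow> const_pol c * p \<in> I"
  by (rule ideal_mult) (auto simp: const_pol_def in_keys_iff lookup_single when_def split: if_splits)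

lemma ideal_0: "0 \<in> I"
  using additive_subgroup.zero_closed[OF is_additive_subgroup] by simp

lemma ideal_sum: "(\<And>a. a \<in> A \<Longrightarrow> f a \<in> I) \<Longrightarrow> sum f A \<in> I"
  by (induction A rule: infinite_finite_induct) (auto simp: ideal_0 ideal_add)

lemma coset_eq_iff:
  assumes "keys p \<subseteq> mons N" "keys q \<subseteq> mons N"
  shows "I +>\<^bsub>coord_alg N\<^esub> p = I +>\<^bsub>coord_alg N\<^esub> q \<longleftrightarrow> p - q \<in> I"
  using quotient_eq_iff_same_a_r_cos[OF I, of p q] a_minus_coord_alg[OF assms] assms by simp

lemma coset_add:
  assumes "keys p \<subseteq> mons N" "keys q \<subseteq> mons N"
  shows "(I +>\<^bsub>coord_alg N\<^esub> p) <+>\<^bsub>coord_alg N\<^esub> (I +>\<^bsub>coord_alg N\<^esub> q) = I +>\<^bsub>coord_alg N\<^esub> (p + q)"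
  using a_rcos_sum[of p q] assms by simp

lemma coset_smult:
  "I <+>\<^bsub>coord_alg N\<^esub> ((\<lambda>p. const_pol c * p) ` (I +>\<^bsub>coord_alg N\<^esub> p)) =
     I +>\<^bsub>coord_alg N\<^esub> (const_pol c * p)"
proof (intro equalityI subsetI)
  fix x assume "x \<in> I <+>\<^bsub>coord_alg N\<^esub> ((\<lambda>p. const_pol c * p) ` (I +>\<^bsub>coord_alg N\<^esub> p))"
  then obtain i j where "i \<in> I" "j \<in> I" "x = i + const_pol c * (j + p)"
    by (auto simp: set_add_def' a_r_coset_def')
  then show "x \<in> I +>\<^bsub>coord_alg N\<^esub> (const_pol c * p)"
    by (auto simp: a_r_coset_def' distrib_left add.assoc[symmetric] intro!: bexI[of _ "i + const_pol c * j"]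
        ideal_add ideal_smult)
next
  fix x assume "x \<in> I +>\<^bsub>coord_alg N\<^esub> (const_pol c * p)"
  then obtain i where "i \<in> I" "x = i + const_pol c * (0 + p)"
    by (auto simp: a_r_coset_def')
  then show "x \<in> I <+>\<^bsub>coord_alg N\<^esub> ((\<lambda>p. const_pol c * p) ` (I +>\<^bsub>coord_alg N\<^esub> p))"
    using ideal_0 unfolding set_add_def' a_r_coset_def' by force
qed

abbreviation quot_weight_vs where
  "quot_weight_vs \<chi> \<equiv> (quot_alg N I)\<lparr>carrier := quot_weight_space N I \<chi>\<rparr>"

lemma quot_alg_simps:
  "add (quot_alg N I) = set_add (coord_alg N)"
  "zero (quot_alg N I) = I +>\<^bsub>coord_alg N\<^esub> 0"
  "module.smult (quot_alg N I) = (\<lambda>c X. I <+>\<^bsub>coord_alg N\<^esub> ((\<lambda>p. const_pol c * p) ` X))"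
  by (auto simp: quot_alg_def FactRing_def a_r_coset_def')

lemma vectorspace_quot: "vectorspace class_ring (quot_weight_vs \<chi>)"
proof -
  have rep: "\<exists>p. keys p \<subseteq> mons_of_weight N \<chi> \<and> keys p \<subseteq> mons N \<and> v = I +>\<^bsub>coord_alg N\<^esub> p"
    if "v \<in> quot_weight_space N I \<chi>" for v
    using that by (auto simp: quot_weight_space_def coord_weight_space_alt mons_of_weight_def)
  have mem: "I +>\<^bsub>coord_alg N\<^esub> p \<in> quot_weight_space N I \<chi>" if "keys p \<subseteq> mons_of_weight N \<chi>" for p
    using that by (auto simp: quot_weight_space_def coord_weight_space_alt)
  have keysc: "keys (const_pol c * p) \<subseteq> S" if "keys p \<subseteq> S" for c p and S
    using that keys_const_pol_mult[of c p] by blast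
  have fold_mult: "const_pol a * (const_pol b * p) = const_pol (a * b) * p" for a b and p :: "(nat \<times> nat, 'a) mpol"
    by (simp add: const_pol_mult mult.assoc)
  have fold_add: "const_pol a * p + const_pol b * p = const_pol (a + b) * p" for a b and p :: "(nat \<times> nat, 'a) mpol"
    by (simp add: const_pol_add distrib_right)
  note simps = quot_alg_simps coset_add coset_smult mem keysc keys_add_subset
  show ?thesis
  proof (rule vs_criteria)
    show "field (class_ring :: 'a ring)" by (rule class_field)
    show "\<zero>\<^bsub>quot_weight_vs \<chi>\<^esub> \<in> carrier (quot_weight_vs \<chi>)"
      by (simp add: simps)
    show "\<forall>v w. v \<in> carrier (quot_weight_vs \<chi>) \<and> w \<in> carrier (quot_weight_vs \<chi>) \<longrightarrow>
        v \<oplus>\<^bsub>quot_weight_vs \<chi>\<^esub> w \<in> carrier (quot_weight_vs \<chi>)"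
      by (auto dest!: rep simp: simps)
    show "\<forall>v\<in>carrier (quot_weight_vs \<chi>). \<exists>u\<in>carrier (quot_weight_vs \<chi>).
        v \<oplus>\<^bsub>quot_weight_vs \<chi>\<^esub> u = \<zero>\<^bsub>quot_weight_vs \<chi>\<^esub>"
    proof
      fix v assume "v \<in> carrier (quot_weight_vs \<chi>)"
      then obtain p where p: "keys p \<subseteq> mons_of_weight N \<chi>" "keys p \<subseteq> mons N" "v = I +>\<^bsub>coord_alg N\<^esub> p"
        using rep by auto
      then show "\<exists>u\<in>carrier (quot_weight_vs \<chi>).
        v \<oplus>\<^bsub>quot_weight_vs \<chi>\<^esub> u = \<zero>\<^bsub>quot_weight_vs \<chi>\<^esub>"
        by (intro bexI[of _ "I +>\<^bsub>coord_alg N\<^esub> (- p)"]) (auto simp: simps)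
    qed
  qed (auto dest!: rep simp: simps add_ac distrib_left coset_smult[of 1, simplified] fold_mult fold_add)
qed

text \<open>The coset map from the span of \<open>S\<close> is a linear bijection. The set
  \<open>S\<close> is left open because the result is needed twice: for standard monomials, and for
  their images under a permutation, which need not be standard.\<close>

lemma dim_quot_weight_space:
  assumes "S \<subseteq> mons_of_weight N \<chi>"
    and indep: "\<And>p. p \<in> I \<Longrightarrow> keys p \<subseteq> S \<Longrightarrow> p = 0"
    and gen: "\<And>p. keys p \<subseteq> mons_of_weight N \<chi> \<Longrightarrow> \<exists>q. keys q \<subseteq> S \<and> p - q \<in> I"
  shows "vectorspace.dim class_ring (quot_weight_vs \<chi>) = card S"
proof -
  let ?W = "quot_weight_vs \<chi>" and ?V = "supported_space N S :: ('a, _) module"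
  let ?T = "\<lambda>p. I +>\<^bsub>coord_alg N\<^esub> p"
  interpret V: vectorspace class_ring ?V by (rule vectorspace_supported)
  interpret W: vectorspace class_ring ?W by (rule vectorspace_quot)
  have fin: "finite S" by (rule finite_subset[OF assms(1)]) simp
  have mons: "mons_of_weight N \<chi> \<subseteq> mons N" by (auto simp: mons_of_weight_def)
  have "?T \<in> LinearCombinations.module_hom class_ring ?V ?W"
    using assms(1) mons
    by (auto simp: LinearCombinations.module_hom_def quot_alg_simps coset_add coset_smult quot_weight_space_def
        coord_weight_space_alt)
  then interpret linear_map class_ring ?V ?W ?T
    by unfold_locales
  have inj: "inj_on ?T (carrier ?V)"
  proof (rule inj_onI)
    fix p q assume pq: "p \<in> carrier ?V" "q \<in> carrier ?V" "?T p = ?T q"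
    then have "p - q \<in> I" using assms(1) mons coset_eq_iff[of p q] by auto
    moreover have "keys (p - q) \<subseteq> S" using pq by (simp add: keys_diff_subset)
    ultimately show "p = q" using indep[of "p - q"] by simp
  qed
  have surj: "?T ` carrier ?V = carrier ?W"
  proof
    show "carrier ?W \<subseteq> ?T ` carrier ?V"
    proof
      fix v assume "v \<in> carrier ?W"
      then obtain p where p: "keys p \<subseteq> mons_of_weight N \<chi>" "v = ?T p"
        by (auto simp: quot_weight_space_def coord_weight_space_alt)
      then obtain q where q: "keys q \<subseteq> S" "p - q \<in> I" using gen by blast
      then have "?T p = ?T q" using p assms(1) mons coset_eq_iff[of p q] by auto
      with p q show "v \<in> ?T ` carrier ?V" by auto
    qed
  qed (use assms(1) in \<open>auto simp: quot_weight_space_def coord_weight_space_alt\<close>)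
  show ?thesis
    using dim_eq[OF fin_dim_supported[OF fin] inj surj, symmetric] dim_supported[OF fin] by (rule trans)
qed

text \<open>Otherwise the leading monomial of \<open>p\<close> would be both standard and a leading
  monomial of \<open>I\<close>.\<close>

lemma standard_monomials_independent:
  assumes "p \<in> I" "keys p \<subseteq> standard_monomials N I \<chi>"
  shows "p = 0"
proof (rule ccontr)
  assume "p \<noteq> 0"
  then obtain m where m: "is_leading_monomial p m" using ex_leading_monomial by blast
  then have "m \<in> leading_monomials I" using assms(1) \<open>p \<noteq> 0\<close> by (auto simp: leading_monomials_def)
  moreover have "m \<in> keys p" using m by (simp add: is_leading_monomial_def)
  ultimately show False using assms(2) by (auto simp: standard_monomials_def)
qed

text \<open>Division with respect to \<open>I\<close>. No well-ordering of all monomials is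
  required: reducing only by homogeneous elements stays inside the finite set of monomials of weight
  \<chi>, and the number of those below the current monomial drops.\<close>

lemma monomial_normal_form:
  assumes gr: "weight_graded I"
  shows "m \<in> mons_of_weight N \<chi> \<Longrightarrow>
    \<exists>q. keys q \<subseteq> standard_monomials N I \<chi> \<and> monom_pol m - q \<in> I"
proof (induction "card {m' \<in> mons_of_weight N \<chi>. revlex_less m' m}" arbitrary: m rule: less_induct)
  case less
  show ?case
  proof (cases "m \<in> leading_monomials I")
    case False
    then show ?thesis using less.prems ideal_0
      by (intro exI[of _ "monom_pol m"]) (auto simp: monom_pol_def standard_monomials_def)
  next
    case True
    then obtain p where p: "p \<in> I" "is_leading_monomial p m" by (auto simp: leading_monomials_def)
    \<comment> \<open>The component of the weight of \<open>m\<close> lies in \<open>I\<close> by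
      homogeneity and keeps \<open>m\<close> as its leading monomial.\<close>
    define r where "r = weight_part \<chi> p"
    define c where "c = lookup r m"
    have "r \<in> I" using gr p(1) by (auto simp: weight_graded_def r_def)
    have wt: "mon_weight m = \<chi>" using less.prems by (simp add: mons_of_weight_def)
    have c: "c \<noteq> 0" using p wt by (auto simp: c_def r_def is_leading_monomial_def in_keys_iff)
    have low: "m' \<in> mons_of_weight N \<chi> \<and> revlex_less m' m" if "m' \<in> keys r - {m}" for m'
      using that p ideal_carrier[OF p(1)]
      by (auto simp: r_def keys_weight_part is_leading_monomial_def mons_of_weight_def)
    have "\<exists>q. keys q \<subseteq> standard_monomials N I \<chi> \<and> monom_pol m' - q \<in> I" if "m' \<in> keys r - {m}" for m'
    proof (rule less.hyps)
      show "card {m'' \<in> mons_of_weight N \<chi>. revlex_less m'' m'} < card {m' \<in> mons_of_weight N \<chi>. revlex_less m' m}"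
      proof (rule psubset_card_mono)
        have "m' \<in> {m' \<in> mons_of_weight N \<chi>. revlex_less m' m}"
          "m' \<notin> {m'' \<in> mons_of_weight N \<chi>. revlex_less m'' m'}"
          using low[OF that] by auto
        moreover have "{m'' \<in> mons_of_weight N \<chi>. revlex_less m'' m'} \<subseteq> {m' \<in> mons_of_weight N \<chi>. revlex_less m' m}"
          using low[OF that] revlex_less_trans by blast
        ultimately show "{m'' \<in> mons_of_weight N \<chi>. revlex_less m'' m'} \<subset> {m' \<in> mons_of_weight N \<chi>. revlex_less m' m}"
          by blast
      qed simp
    qed (use low[OF that] in simp)
    then obtain q where q: "\<And>m'. m' \<in> keys r - {m} \<Longrightarrow> keys (q m') \<subseteq> standard_monomials N I \<chi>"
        "\<And>m'. m' \<in> keys r - {m} \<Longrightarrow> monom_pol m' - q m' \<in> I" by metis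
    \<comment> \<open>Solving \<open>r\<close> for \<open>m\<close> modulo \<open>I\<close>
      expresses \<open>m\<close> through the smaller monomials of \<open>r\<close>; each of these is
      then replaced by its normal form.\<close>
    define Q where "Q = (\<Sum>m'\<in>keys r - {m}. const_pol (- lookup r m' / c) * q m')"
    have "keys Q \<subseteq> standard_monomials N I \<chi>"
      unfolding Q_def by (intro keys_sum_subset order_trans[OF keys_const_pol_mult] q(1))
    moreover have "monom_pol m - Q \<in> I"
    proof -
      have "r = single m c + (\<Sum>m'\<in>keys r - {m}. single m' (lookup r m'))"
        using sum.remove[of "keys r" m "\<lambda>m'. single m' (lookup r m')"] c
        by (simp add: sum_singles_keys c_def in_keys_iff)
      then have "const_pol (1 / c) * r =
          const_pol (1 / c) * (single m c + (\<Sum>m'\<in>keys r - {m}. single m' (lookup r m')))"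
        by (rule arg_cong)
      also have "\<dots> = monom_pol m + (\<Sum>m'\<in>keys r - {m}. const_pol (lookup r m' / c) * monom_pol m')"
        using c by (simp add: distrib_left sum_distrib_left const_pol_def monom_pol_def mult_single)
      finally have "monom_pol m - Q = const_pol (1 / c) * r +
          (\<Sum>m'\<in>keys r - {m}. const_pol (- lookup r m' / c) * (monom_pol m' - q m'))"
        by (simp add: Q_def right_diff_distrib sum_subtractf const_pol_def single_uminus sum_negf)
      moreover have "const_pol (1 / c) * r +
          (\<Sum>m'\<in>keys r - {m}. const_pol (- lookup r m' / c) * (monom_pol m' - q m')) \<in> I"
        by (intro ideal_add ideal_smult ideal_sum \<open>r \<in> I\<close> q(2))
      ultimately show ?thesis by (simp only:)
    qed
    ultimately show ?thesis by (intro exI[of _ Q] conjI)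
  qed
qed

lemma polynomial_normal_form:
  assumes gr: "weight_graded I" and p: "keys p \<subseteq> mons_of_weight N \<chi>"
  shows "\<exists>Q. keys Q \<subseteq> standard_monomials N I \<chi> \<and> p - Q \<in> I"
proof -
  have "\<exists>q. keys q \<subseteq> standard_monomials N I \<chi> \<and> monom_pol m - q \<in> I" if "m \<in> keys p" for m
    using monomial_normal_form[OF gr] p that by blast
  then obtain q where q: "\<And>m. m \<in> keys p \<Longrightarrow> keys (q m) \<subseteq> standard_monomials N I \<chi>"
      "\<And>m. m \<in> keys p \<Longrightarrow> monom_pol m - q m \<in> I" by metis
  have "p - (\<Sum>m\<in>keys p. const_pol (lookup p m) * q m) =
      (\<Sum>m\<in>keys p. single m (lookup p m)) - (\<Sum>m\<in>keys p. const_pol (lookup p m) * q m)"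
    by (simp only: sum_singles_keys)
  also have "\<dots> = (\<Sum>m\<in>keys p. const_pol (lookup p m) * (monom_pol m - q m))"
    by (simp add: right_diff_distrib sum_subtractf const_pol_def monom_pol_def mult_single)
  finally have "p - (\<Sum>m\<in>keys p. const_pol (lookup p m) * q m) = \<dots>" .
  moreover have "(\<Sum>m\<in>keys p. const_pol (lookup p m) * (monom_pol m - q m)) \<in> I"
    by (intro ideal_sum ideal_smult q(2))
  moreover have "keys (\<Sum>m\<in>keys p. const_pol (lookup p m) * q m) \<subseteq> standard_monomials N I \<chi>"
    by (intro keys_sum_subset order_trans[OF keys_const_pol_mult] q(1))
  ultimately show ?thesis
    by (intro exI[of _ "\<Sum>m\<in>keys p. const_pol (lookup p m) * q m"] conjI) (simp_all only:)
qed

text \<open>Macaulay's basis theorem, weight by weight.\<close>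

theorem graded_char_quot:
  assumes gr: "weight_graded I"
  shows "graded_char (quot_alg N I) (quot_weight_space N I) \<chi> = int (card (standard_monomials N I \<chi>))"
proof -
  have "vectorspace.dim class_ring (quot_weight_vs \<chi>) = card (standard_monomials N I \<chi>)"
    by (rule dim_quot_weight_space)
      (fact standard_monomials_subset standard_monomials_independent polynomial_normal_form[OF gr])+
  then show ?thesis by (simp add: graded_char_def)
qed

end

subsection \<open>Monomial ideals and their K-polynomials\<close>

definition mdvd :: "'v monomial \<Rightarrow> 'v monomial \<Rightarrow> bool" where
  "mdvd a b \<longleftrightarrow> (\<forall>v. lookup a v \<le> lookup b v)"

lemma mdvd_iff: "mdvd a b \<longleftrightarrow> (\<exists>k. b = a + k)"
proof
  assume "mdvd a b"
  then have "b = a + (b - a)"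
    by (intro poly_mapping_eqI) (simp add: mdvd_def lookup_add lookup_minus)
  then show "\<exists>k. b = a + k" ..
qed (auto simp: mdvd_def lookup_add)

lemma mdvd_trans_add: "mdvd g m \<Longrightarrow> mdvd g (k + m)"
  by (auto simp: mdvd_def lookup_add intro: le_trans[OF _ le_add2])

lemma supported_mons: "supported_space N (mons N) = coord_alg N"
  by (auto simp: coord_alg_def mons_def)

lemma monom_pol_in_span_iff:
  fixes L :: "(nat \<times> nat) monomial set"
  assumes "L \<subseteq> mons N"
  shows "monom_pol m \<in> LinearCombinations.module.span class_ring
      (coord_alg N :: ('a::field, _) module) (monom_pol ` L) \<longleftrightarrow> m \<in> L"
proof -
  interpret vectorspace class_ring "coord_alg N :: ('a, _) module"
    using vectorspace_supported[of "mons N" N] by (simp only: supported_mons)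
  let ?L = "monom_pol ` L :: (nat \<times> nat, 'a) mpol set"
  have sub: "?L \<subseteq> carrier (coord_alg N)" using assms by (auto simp: monom_pol_def)
  have "submodule class_ring {p. keys p \<subseteq> L} (coord_alg N :: ('a, _) module)"
  proof (rule submodule.intro)
    show "Module.module class_ring (coord_alg N :: ('a, _) module)"
      by (rule vectorspace.axioms(1)[OF vectorspace_axioms])
    show "c \<odot>\<^bsub>coord_alg N\<^esub> v \<in> {p. keys p \<subseteq> L}" if "v \<in> {p. keys p \<subseteq> L}"
      for c and v :: "(nat \<times> nat, 'a) mpol"
      using that keys_const_pol_mult[of c v] by auto
  qed (use assms in \<open>auto simp: keys_add_subset\<close>)
  then have "module.span ?L \<subseteq> {p. keys p \<subseteq> L}"
    by (intro span_is_subset) (auto simp: monom_pol_def)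
  moreover have "monom_pol m \<in> module.span ?L" if "m \<in> L"
    using that by (intro span_mem[OF sub]) auto
  ultimately show ?thesis by (auto simp: monom_pol_def)
qed

text \<open>The initial ideal is given only as a span. Since polynomials supported on a set of
  monomials are closed under linear combinations, no further monomial enters the span, and the set
  of leading monomials can be read back from it.\<close>

lemma monom_pol_in_init_ideal_iff:
  fixes I :: "(nat \<times> nat, 'a::field) mpol set"
  assumes "ideal I (coord_alg N)"
  shows "monom_pol m \<in> init_ideal N I \<longleftrightarrow> m \<in> leading_monomials I"
proof -
  have sub: "leading_monomials I \<subseteq> mons N"
    using ideal_carrier[OF assms] by (auto simp: leading_monomials_def is_leading_monomial_def)
  have eq: "{monom_pol m |m. \<exists>p\<in>I. p \<noteq> 0 \<and> is_leading_monomial p m} = monom_pol ` leading_monomials I"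
    by (auto simp: leading_monomials_def)
  show ?thesis
    unfolding init_ideal_def eq by (rule monom_pol_in_span_iff[OF sub])
qed

text \<open>For sets described by conditions on monomials, multiplication by a single term is what
  can be checked directly. Additivity extends this to polynomial factors, and the factor -1 gives
  negatives.\<close>

lemma idealI_coord_alg:
  fixes A :: "(nat \<times> nat, 'a::field) mpol set"
  assumes "\<And>p. p \<in> A \<Longrightarrow> keys p \<subseteq> mons N" "0 \<in> A"
    "\<And>p q. p \<in> A \<Longrightarrow> q \<in> A \<Longrightarrow> p + q \<in> A"
    "\<And>p m c. p \<in> A \<Longrightarrow> m \<in> mons N \<Longrightarrow> single m c * p \<in> A"
  shows "ideal A (coord_alg N)"
proof -
  interpret R: cring "coord_alg N :: ('a, _) module" by (rule cring_coord_alg)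
  have mult: "q * p \<in> A" if "p \<in> A" "keys q \<subseteq> mons N" for p q
  proof -
    have "(\<Sum>m\<in>K. single m (lookup q m)) * p \<in> A" if "finite K" "K \<subseteq> mons N" for K
      using that by (induction K rule: finite_induct) (auto simp: assms \<open>p \<in> A\<close> distrib_right)
    from this[of "keys q"] that show ?thesis by (simp add: sum_singles_keys)
  qed
  have neg: "- p \<in> A" if "p \<in> A" for p
    using mult[OF that, of "- 1"] by (simp add: keys_one)
  show ?thesis
  proof (rule idealI)
    show "ring (coord_alg N :: ('a, _) module)" by (rule ring_coord_alg)
    show "subgroup A (add_monoid (coord_alg N :: ('a, _) module))"
    proof (rule R.add.subgroupI)
      fix a assume a: "a \<in> A"
      have "\<ominus>\<^bsub>coord_alg N\<^esub> a = - a"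
        by (rule R.minus_equality) (use assms(1)[OF a] assms(1)[OF neg[OF a]] in auto)
      then show "\<ominus>\<^bsub>coord_alg N\<^esub> a \<in> A" using neg[OF a] by simp
    qed (use assms in auto)
    show "x \<otimes>\<^bsub>coord_alg N\<^esub> a \<in> A" if "a \<in> A" "x \<in> carrier (coord_alg N)" for a x
      using mult[OF that(1), of x] that(2) by simp
    show "a \<otimes>\<^bsub>coord_alg N\<^esub> x \<in> A" if "a \<in> A" "x \<in> carrier (coord_alg N)" for a x
      using mult[OF that(1), of x] that(2) by (simp add: mult.commute)
  qed
qed

lemma monomial_ideal_keys:
  fixes G :: "(nat \<times> nat) monomial set"
  assumes "G \<subseteq> mons N"
    and "p \<in> genideal (coord_alg N :: ('a::field, _) module) (monom_pol ` G)" "m \<in> keys p"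
  shows "\<exists>g\<in>G. mdvd g m"
proof -
  interpret R: cring "coord_alg N :: ('a, _) module" by (rule cring_coord_alg)
  \<comment> \<open>By minimality of the generated ideal it suffices that these polynomials form an
    ideal containing the generators.\<close>
  let ?A = "{p :: (nat \<times> nat, 'a) mpol. keys p \<subseteq> mons N \<and> (\<forall>m\<in>keys p. \<exists>g\<in>G. mdvd g m)}"
  have "ideal ?A (coord_alg N)"
  proof (rule idealI_coord_alg, goal_cases)
    case (3 p q)
    then show ?case using keys_add[of p q] by blast
  next
    case (4 p k c)
    have "m \<in> mons N \<and> (\<exists>g\<in>G. mdvd g m)" if "m \<in> keys (single k c * p)" for m
    proof -
      have "\<exists>l. m = k + l"
        using that lookup_single_mult_zero[of m k c p] unfolding in_keys_iff by blast
      then obtain l where l: "m = k + l" ..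
      then have "l \<in> keys p" using that by (auto simp: in_keys_iff lookup_single_mult)
      then obtain g where "g \<in> G" "mdvd g l" "l \<in> mons N" using 4(1) by auto
      then show ?thesis using 4(2) l mdvd_trans_add[of g l k] by auto
    qed
    then show ?case by auto
  qed auto
  moreover have "monom_pol ` G \<subseteq> ?A"
    using assms(1) by (auto simp: monom_pol_def mdvd_def)
  ultimately have "genideal (coord_alg N) (monom_pol ` G) \<subseteq> ?A"
    by (rule R.genideal_minimal)
  then show ?thesis using assms(2,3) by auto
qed

lemma monom_pol_in_monomial_ideal_iff:
  fixes G :: "(nat \<times> nat) monomial set"
  assumes "G \<subseteq> mons N" "m \<in> mons N"
  shows "monom_pol m \<in> genideal (coord_alg N :: ('a::field, _) module) (monom_pol ` G) \<longleftrightarrow>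
    (\<exists>g\<in>G. mdvd g m)"
proof -
  let ?J = "genideal (coord_alg N :: ('a, _) module) (monom_pol ` G)"
  interpret R: cring "coord_alg N :: ('a, _) module" by (rule cring_coord_alg)
  have sub: "monom_pol ` G \<subseteq> carrier (coord_alg N :: ('a, _) module)"
    using assms(1) by (auto simp: monom_pol_def)
  have "\<exists>g\<in>G. mdvd g m" if "monom_pol m \<in> ?J"
    using that by (rule monomial_ideal_keys[OF assms(1)]) (simp add: monom_pol_def)
  moreover have "monom_pol m \<in> ?J" if "g \<in> G" "mdvd g m" for g
  proof -
    obtain k where k: "m = g + k" using \<open>mdvd g m\<close> by (auto simp: mdvd_iff)
    have "monom_pol k * monom_pol g \<in> ?J"
    proof (rule ideal_mult[OF R.genideal_ideal[OF sub]])
      show "monom_pol g \<in> ?J" using R.genideal_self[OF sub] \<open>g \<in> G\<close> by auto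
    qed (use assms k in \<open>auto simp: monom_pol_def\<close>)
    then show ?thesis by (simp add: monom_pol_def mult_single k add.commute)
  qed
  ultimately show ?thesis by blast
qed

text \<open>The inserted 0 makes the least common multiple of the empty set equal to 1, as the term
  of the empty set in inclusion-exclusion requires.\<close>

definition mlcm :: "'v monomial set \<Rightarrow> 'v monomial" where
  "mlcm S = Abs_poly_mapping (\<lambda>v. Max (insert 0 ((\<lambda>g. lookup g v) ` S)))"

lemma lookup_mlcm:
  assumes "finite S"
  shows "lookup (mlcm S) v = Max (insert 0 ((\<lambda>g. lookup g v) ` S))"
proof -
  have "finite {v. Max (insert 0 ((\<lambda>g. lookup g v) ` S)) \<noteq> 0}"
  proof (rule finite_subset)
    show "{v. Max (insert 0 ((\<lambda>g. lookup g v) ` S)) \<noteq> 0} \<subseteq> (\<Union>g\<in>S. keys g)"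
    proof (rule subsetI, rule ccontr)
      fix v assume v: "v \<in> {v. Max (insert 0 ((\<lambda>g. lookup g v) ` S)) \<noteq> 0}" "v \<notin> (\<Union>g\<in>S. keys g)"
      have "Max (insert 0 ((\<lambda>g. lookup g v) ` S)) \<le> 0"
        using assms v(2) by (subst Max_le_iff) (auto simp: in_keys_iff)
      with v(1) show False by simp
    qed
  qed (use assms in auto)
  then show ?thesis by (simp add: mlcm_def)
qed

lemma mdvd_mlcm_iff:
  assumes "finite S"
  shows "mdvd (mlcm S) m \<longleftrightarrow> (\<forall>g\<in>S. mdvd g m)"
  using assms by (auto simp: mdvd_def lookup_mlcm)

lemma mlcm_in_mons:
  assumes "finite S" "S \<subseteq> mons N"
  shows "mlcm S \<in> mons N"
proof -
  have "v \<in> sym_vars N" if v: "lookup (mlcm S) v \<noteq> 0" for v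
  proof (rule ccontr)
    assume "v \<notin> sym_vars N"
    then have "lookup g v = 0" if "g \<in> S" for g
    proof -
      have "keys g \<subseteq> sym_vars N" using assms(2) that by (auto simp: mons_def)
      then show ?thesis using \<open>v \<notin> sym_vars N\<close> by (meson in_keys_iff subsetD)
    qed
    then have "lookup (mlcm S) v \<le> 0"
      unfolding lookup_mlcm[OF assms(1)] using assms(1) by (subst Max_le_iff) auto
    with v show False by simp
  qed
  then show ?thesis by (auto simp: mons_def in_keys_iff)
qed

section \<open>Products of formal power series in the weights\<close>

lemma mon_degree_alt:
  assumes "finite A" "keys m \<subseteq> A"
  shows "mon_degree m = (\<Sum>v\<in>A. lookup m v)"
  unfolding mon_degree_def using assms
  by (intro sum.mono_neutral_left) (auto simp: in_keys_iff)

lemma mon_degree_add: "mon_degree (a + b) = mon_degree a + mon_degree b"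
  by (simp add: mon_degree_alt[of "keys a \<union> keys b"] keys_add_monomial lookup_add sum.distrib)

lemma mon_degree_eq_0_iff: "mon_degree m = 0 \<longleftrightarrow> m = 0"
  by (auto simp: mon_degree_def in_keys_iff intro!: poly_mapping_eqI)

lemma finite_mdvd: "finite {a. mdvd a (b :: 'v monomial)}"
proof -
  let ?F = "{f. \<forall>v. (v \<in> keys b \<longrightarrow> f v \<in> {..mon_degree b}) \<and> (v \<notin> keys b \<longrightarrow> f v = (0::nat))}"
  have "lookup ` {a. mdvd a b} \<subseteq> ?F"
  proof clarify
    fix a v assume a: "mdvd a b"
    have "lookup a v \<le> mon_degree b" if "v \<in> keys b"
      using a member_le_sum[OF that, of "lookup b"] unfolding mdvd_def mon_degree_def
      by (meson finite_keys le_trans zero_le)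
    then show "(v \<in> keys b \<longrightarrow> lookup a v \<in> {..mon_degree b}) \<and> (v \<notin> keys b \<longrightarrow> lookup a v = 0)"
      using a by (auto simp: mdvd_def in_keys_iff) (metis le_zero_eq)
  qed
  moreover have "finite ?F" by (rule finite_set_of_finite_funs) auto
  ultimately have "finite (lookup ` {a. mdvd a b})" by (rule finite_subset)
  then show ?thesis by (rule finite_imageD) (simp add: inj_on_def)
qed

text \<open>Ensures that the sum in \<open>series_mult\<close> is a genuine one, not the default
  value 0 of a sum over an infinite set.\<close>

lemma finite_decompositions: "finite {(\<alpha>, \<beta>). \<alpha> + \<beta> = (\<chi> :: 'v monomial)}"
proof (rule finite_subset)
  show "{(\<alpha>, \<beta>). \<alpha> + \<beta> = \<chi>} \<subseteq> {a. mdvd a \<chi>} \<times> {a. mdvd a \<chi>}"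
    by (auto simp: mdvd_def lookup_add)
qed (intro finite_cartesian_product finite_mdvd)

text \<open>The coefficient of the product at \<chi> is \<open>P \<chi>\<close> plus terms that
  involve \<open>P\<close> only in smaller degree. This is the uniqueness behind the quotient of
  characters in \<open>K_polynomial\<close>.\<close>

lemma series_mult_right_cancel:
  fixes P Q H :: "'c::comm_ring_1 series"
  assumes "H 0 = 1" "series_mult P H = series_mult Q H"
  shows "P = Q"
proof
  fix \<chi>
  show "P \<chi> = Q \<chi>"
  proof (induction "mon_degree \<chi>" arbitrary: \<chi> rule: less_induct)
    case less
    let ?D = "{(\<alpha>, \<beta>). \<alpha> + \<beta> = \<chi>}"
    have split: "series_mult R H \<chi> = R \<chi> + (\<Sum>(\<alpha>, \<beta>)\<in>?D - {(\<chi>, 0)}. R \<alpha> * H \<beta>)" for R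
      unfolding series_mult_def
      by (subst sum.remove[OF finite_decompositions, of "(\<chi>, 0)"]) (simp_all add: assms(1))
    have "(\<Sum>(\<alpha>, \<beta>)\<in>?D - {(\<chi>, 0)}. P \<alpha> * H \<beta>) = (\<Sum>(\<alpha>, \<beta>)\<in>?D - {(\<chi>, 0)}. Q \<alpha> * H \<beta>)"
    proof (intro sum.cong refl)
      fix x assume "x \<in> ?D - {(\<chi>, 0)}"
      moreover obtain \<alpha> \<beta> where "x = (\<alpha>, \<beta>)" by (cases x)
      ultimately have ab: "x = (\<alpha>, \<beta>)" "\<beta> \<noteq> 0" "\<chi> = \<alpha> + \<beta>" by auto
      then have "mon_degree \<alpha> < mon_degree \<chi>"
        using ab mon_degree_eq_0_iff[of \<beta>] by (simp add: mon_degree_add)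
      then show "(case x of (\<alpha>, \<beta>) \<Rightarrow> P \<alpha> * H \<beta>) = (case x of (\<alpha>, \<beta>) \<Rightarrow> Q \<alpha> * H \<beta>)"
        using ab by (simp add: less)
    qed
    then show ?case using split[of P] split[of Q] assms(2) by simp
  qed
qed

text \<open>The inner sum has at most one summand; written as a sum it also covers the case that
  \<open>\<omega> S\<close> does not divide \<chi>.\<close>

lemma series_mult_sum_singles:
  fixes H :: "'c::comm_ring_1 series"
  shows "series_mult (lookup (\<Sum>S\<in>F. single (\<omega> S) (c S))) H \<chi> =
    (\<Sum>S\<in>F. c S * (\<Sum>\<beta> | \<omega> S + \<beta> = \<chi>. H \<beta>))"
proof -
  have "(\<Sum>(\<alpha>, \<beta>) | \<alpha> + \<beta> = \<chi>. lookup (single (\<omega> S) (c S)) \<alpha> * H \<beta>) =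
      c S * (\<Sum>\<beta> | \<omega> S + \<beta> = \<chi>. H \<beta>)" for S
  proof -
    have "(\<Sum>(\<alpha>, \<beta>) | \<alpha> + \<beta> = \<chi>. lookup (single (\<omega> S) (c S)) \<alpha> * H \<beta>) =
        (\<Sum>(\<alpha>, \<beta>)\<in>Pair (\<omega> S) ` {\<beta>. \<omega> S + \<beta> = \<chi>}. lookup (single (\<omega> S) (c S)) \<alpha> * H \<beta>)"
      by (rule sum.mono_neutral_right[OF finite_decompositions]) (auto simp: lookup_single when_def)
    also have "\<dots> = (\<Sum>\<beta> | \<omega> S + \<beta> = \<chi>. c S * H \<beta>)"
      by (subst sum.reindex) (auto simp: inj_on_def)
    finally show ?thesis by (simp add: sum_distrib_left)
  qed
  then show ?thesis
    unfolding series_mult_def lookup_sum sum_distrib_right case_prod_unfold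
    by (subst sum.swap) simp
qed

lemma card_multiples_of_weight:
  assumes "l \<in> mons N"
  shows "(\<Sum>\<beta> | mon_weight l + \<beta> = \<chi>. int (card (mons_of_weight N \<beta>))) =
    int (card {m \<in> mons_of_weight N \<chi>. mdvd l m})"
proof (cases "\<exists>\<beta>. mon_weight l + \<beta> = \<chi>")
  case True
  then obtain \<beta> where b: "mon_weight l + \<beta> = \<chi>" by blast
  then have eq: "{\<beta>. mon_weight l + \<beta> = \<chi>} = {\<beta>}" by auto
  have "bij_betw (\<lambda>m. l + m) (mons_of_weight N \<beta>) {m \<in> mons_of_weight N \<chi>. mdvd l m}"
    using assms b by (auto simp: bij_betw_def inj_on_def mons_of_weight_def mdvd_iff)
  from bij_betw_same_card[OF this] show ?thesis by (simp add: eq)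
next
  case False
  then have "{m \<in> mons_of_weight N \<chi>. mdvd l m} = {}" "{\<beta>. mon_weight l + \<beta> = \<chi>} = {}"
    by (auto simp: mons_of_weight_def mdvd_iff)
  then show ?thesis by simp
qed

section \<open>Inclusion-exclusion as a signed sum over subsets\<close>

definition alt_sum :: "'b set \<Rightarrow> ('b set \<Rightarrow> 'c::comm_ring_1) \<Rightarrow> 'c" where
  "alt_sum G F = (\<Sum>S\<in>Pow G. (- 1) ^ card S * F S)"

lemma alt_sum_empty [simp]: "alt_sum {} F = F {}"
  by (simp add: alt_sum_def)

lemma alt_sum_insert:
  assumes "finite G" "g \<notin> G"
  shows "alt_sum (insert g G) F = alt_sum G F - alt_sum G (\<lambda>S. F (insert g S))"
proof -
  have inj: "inj_on (insert g) (Pow G)"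
    using assms(2) by (intro inj_onI) (metis Diff_insert_absorb PowD subsetD)
  have "alt_sum (insert g G) F = (\<Sum>S\<in>Pow G. (- 1) ^ card S * F S) +
      (\<Sum>S\<in>insert g ` Pow G. (- 1) ^ card S * F S)"
    unfolding alt_sum_def Pow_insert
    by (rule sum.union_disjoint) (use assms in auto)
  also have "(\<Sum>S\<in>insert g ` Pow G. (- 1) ^ card S * F S) = (\<Sum>S\<in>Pow G. - ((- 1) ^ card S * F (insert g S)))"
  proof (subst sum.reindex[OF inj], rule sum.cong)
    fix S assume "S \<in> Pow G"
    then have "card (insert g S) = Suc (card S)"
      using assms by (intro card_insert_disjoint) (auto intro: finite_subset)
    then show "((\<lambda>S. (- 1) ^ card S * F S) \<circ> insert g) S = - ((- 1) ^ card S * F (insert g S))"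
      by simp
  qed simp
  finally show ?thesis by (simp add: alt_sum_def sum_negf)
qed

lemma alt_sum_cong: "(\<And>S. S \<subseteq> G \<Longrightarrow> F S = F' S) \<Longrightarrow> alt_sum G F = alt_sum G F'"
  by (simp add: alt_sum_def)

lemma alt_sum_const:
  assumes "finite G"
  shows "alt_sum G (\<lambda>_. c) = (if G = {} then c else 0)"
proof (cases "G = {}")
  case False
  then obtain g G' where "G = insert g G'" "g \<notin> G'" by (meson all_not_in_conv mk_disjoint_insert)
  then show ?thesis using assms by (simp add: alt_sum_insert)
qed simp

text \<open>A set without \<open>g\<close> and the same set with \<open>g\<close> added contribute
  equal values with opposite signs.\<close>

lemma alt_sum_absorb:
  assumes "finite G" "g \<in> G"
  shows "alt_sum G (\<lambda>S. F (insert g S)) = 0"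
proof -
  have "alt_sum (insert g (G - {g})) (\<lambda>S. F (insert g S)) = 0"
    using assms by (subst alt_sum_insert) auto
  then show ?thesis using assms(2) by (simp add: insert_absorb)
qed

text \<open>The map \<open>h\<close> may identify elements. This lets the restricted generators
  replace the generators themselves, although restriction loses information.\<close>

lemma alt_sum_image:
  assumes "finite G"
  shows "alt_sum G (\<lambda>S. F (h ` S)) = alt_sum (h ` G) F"
  using assms
proof (induction G arbitrary: F rule: finite_induct)
  case (insert g G)
  have "alt_sum (insert g G) (\<lambda>S. F (h ` S)) = alt_sum (h ` G) F - alt_sum (h ` G) (\<lambda>T. F (insert (h g) T))"
    using insert.hyps insert.IH[of F] insert.IH[of "\<lambda>T. F (insert (h g) T)"]
    by (simp add: alt_sum_insert)
  also have "\<dots> = alt_sum (insert (h g) (h ` G)) F"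
  \<comment> \<open>If the value \<open>h g\<close> is already attained, the subtracted sum vanishes
    by \<open>alt_sum_absorb\<close>, and the set of values does not grow either; so fibres never
    have to be counted.\<close>
  proof (cases "h g \<in> h ` G")
    case True
    then show ?thesis using insert.hyps by (simp add: alt_sum_absorb insert_absorb)
  next
    case False
    then show ?thesis using insert.hyps by (simp add: alt_sum_insert)
  qed
  finally show ?case by simp
qed simp

lemma alt_sum_sum: "alt_sum G (\<lambda>S. \<Sum>a\<in>A. F a S) = (\<Sum>a\<in>A. alt_sum G (F a))"
  unfolding alt_sum_def sum_distrib_left by (rule sum.swap)

lemma alt_sum_restrict:
  assumes "finite G"
  shows "alt_sum G (\<lambda>S. if S \<subseteq> D then F S else 0) = alt_sum (G \<inter> D) F"
proof -
  have "(\<Sum>S\<in>Pow G. (- 1) ^ card S * (if S \<subseteq> D then F S else 0)) =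
      (\<Sum>S\<in>Pow (G \<inter> D). (- 1) ^ card S * (if S \<subseteq> D then F S else 0))"
    using assms by (intro sum.mono_neutral_right) auto
  also have "\<dots> = (\<Sum>S\<in>Pow (G \<inter> D). (- 1) ^ card S * F S)"
    by (rule sum.cong) auto
  finally show ?thesis by (simp add: alt_sum_def)
qed

text \<open>Counted monomial by monomial: the sets \<open>S\<close> whose least common multiple
  divides \<open>m\<close> are the sets of generators dividing \<open>m\<close>, and their signs add
  up to 1 if there is no such generator and to 0 otherwise.\<close>

lemma alt_sum_card_multiples:
  assumes "finite G" "finite M"
  shows "alt_sum G (\<lambda>S. int (card {m \<in> M. mdvd (mlcm S) m})) = int (card {m \<in> M. \<not> (\<exists>g\<in>G. mdvd g m)})"
proof -
  have "alt_sum G (\<lambda>S. int (card {m \<in> M. mdvd (mlcm S) m})) =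
      alt_sum G (\<lambda>S. \<Sum>m\<in>M. if S \<subseteq> {g. mdvd g m} then 1 else 0)"
  proof (rule alt_sum_cong)
    fix S assume "S \<subseteq> G"
    then have "finite S" using assms(1) finite_subset by blast
    then have "{m \<in> M. mdvd (mlcm S) m} = M \<inter> {m. S \<subseteq> {g. mdvd g m}}"
      by (auto simp: mdvd_mlcm_iff)
    then show "int (card {m \<in> M. mdvd (mlcm S) m}) = (\<Sum>m\<in>M. if S \<subseteq> {g. mdvd g m} then 1 else 0)"
      using assms(2) by (simp add: sum.If_cases)
  qed
  also have "\<dots> = (\<Sum>m\<in>M. alt_sum (G \<inter> {g. mdvd g m}) (\<lambda>_. 1))"
    by (simp only: alt_sum_sum alt_sum_restrict[OF assms(1)])
  also have "\<dots> = (\<Sum>m\<in>M. if G \<inter> {g. mdvd g m} = {} then 1 else 0)"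
    using assms(1) by (simp add: alt_sum_const)
  also have "\<dots> = int (card {m \<in> M. \<not> (\<exists>g\<in>G. mdvd g m)})"
  proof -
    have "M \<inter> {m. G \<inter> {g. mdvd g m} = {}} = {m \<in> M. \<not> (\<exists>g\<in>G. mdvd g m)}" by auto
    then show ?thesis using assms(2) by (simp add: sum.If_cases)
  qed
  finally show ?thesis .
qed

text \<open>The alternating sum of the weights in Taylor's resolution of the quotient by the
  monomial ideal of \<open>G\<close>.\<close>

definition taylor_poly :: "(nat \<times> nat) monomial set \<Rightarrow> (nat, int) mpol" where
  "taylor_poly G = (\<Sum>S\<in>Pow G. single (mon_weight (mlcm S)) ((- 1) ^ card S))"

text \<open>Only the monomial 1 has weight 0, so the divisor has constant coefficient 1 and can be
  cancelled; the description in \<open>K_polynomial\<close> is therefore unique.\<close>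

lemma K_polynomial_eqI:
  fixes M :: "('a::field, 'm) module"
  assumes "series_mult (lookup P) (\<lambda>\<chi>. int (card (mons_of_weight N \<chi>))) = graded_char M W"
  shows "K_polynomial N M W = P"
proof -
  have H: "graded_char (coord_alg N :: ('a, _) module) (coord_weight_space N) =
      (\<lambda>\<chi>. int (card (mons_of_weight N \<chi>)))"
    by (rule ext) (rule graded_char_coord)
  have "mons_of_weight N 0 = {0}" by (auto simp: mons_of_weight_def)
  then have H0: "int (card (mons_of_weight N 0)) = 1" by simp
  show ?thesis
    unfolding K_polynomial_def H
  proof (rule the_equality)
    fix Q assume "series_mult (lookup Q) (\<lambda>\<chi>. int (card (mons_of_weight N \<chi>))) = graded_char M W"
    then have "lookup Q = lookup P"
      using series_mult_right_cancel[of "\<lambda>\<chi>. int (card (mons_of_weight N \<chi>))"] H0 assms by metis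
    then show "Q = P" by simp
  qed (rule assms)
qed

context
  fixes M :: "('a::field, 'm) module" and W N and G :: "(nat \<times> nat) monomial set"
  assumes G: "finite G" "G \<subseteq> mons N"
    and char: "\<And>\<chi>. graded_char M W \<chi> = int (card {m \<in> mons_of_weight N \<chi>. \<not> (\<exists>g\<in>G. mdvd g m)})"
begin

text \<open>Kept separate from the value of \<open>K_polynomial\<close>, since the symmetry argument
  works with this defining equation itself.\<close>

lemma series_mult_taylor_poly:
  "series_mult (lookup (taylor_poly G)) (\<lambda>\<chi>. int (card (mons_of_weight N \<chi>))) = graded_char M W"
proof
  fix \<chi>
  have "series_mult (lookup (taylor_poly G)) (\<lambda>\<chi>. int (card (mons_of_weight N \<chi>))) \<chi> =
      alt_sum G (\<lambda>S. \<Sum>\<beta> | mon_weight (mlcm S) + \<beta> = \<chi>. int (card (mons_of_weight N \<beta>)))"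
    by (simp add: taylor_poly_def series_mult_sum_singles alt_sum_def)
  also have "\<dots> = alt_sum G (\<lambda>S. int (card {m \<in> mons_of_weight N \<chi>. mdvd (mlcm S) m}))"
    using G by (intro alt_sum_cong card_multiples_of_weight mlcm_in_mons) (auto intro: finite_subset)
  also have "\<dots> = graded_char M W \<chi>"
    by (simp add: G char alt_sum_card_multiples)
  finally show "series_mult (lookup (taylor_poly G)) (\<lambda>\<chi>. int (card (mons_of_weight N \<chi>))) \<chi> =
      graded_char M W \<chi>" .
qed

theorem K_polynomial_taylor: "K_polynomial N M W = taylor_poly G"
  by (rule K_polynomial_eqI[OF series_mult_taylor_poly])

end

subsection \<open>Ranks of partial permutation matrices\<close>

lemma pick_lessThan:
  assumes "a < i"
  shows "pick {..<i} a = a"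
proof -
  have "{x \<in> {..<i}. x < a} = {..<a}" using assms by auto
  with pick_card_in_set[of a "{..<i}"] assms show ?thesis by simp
qed

lemma submatrix_lessThan:
  assumes "A \<in> carrier_mat N N" "i \<le> N" "j \<le> N"
  shows "submatrix A {..<i} {..<j} = mat i j (\<lambda>(a, b). A $$ (a, b))"
proof -
  have "{x. x < N \<and> x \<in> {..<k}} = {..<k}" if "k \<le> N" for k
    using that by auto
  then show ?thesis
    using assms by (intro eq_matI) (auto simp: submatrix_def pick_lessThan)
qed

context vec_space
begin

text \<open>In this form a permutation of the coordinates merely reorders the equations.\<close>

lemma lin_indpt_iff_coords:
  assumes "finite U" "U \<subseteq> carrier_vec n"
  shows "lin_indpt U \<longleftrightarrow> (\<forall>a. (\<forall>i<n. (\<Sum>x\<in>U. a x * x $ i) = 0) \<longrightarrow> (\<forall>x\<in>U. a x = 0))"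
proof -
  have zero: "lincomb a U = 0\<^sub>v n \<longleftrightarrow> (\<forall>i<n. (\<Sum>x\<in>U. a x * x $ i) = 0)" for a
    using lincomb_index[OF _ assms(2), of _ a] lincomb_dim[OF assms, of a]
    by (auto intro!: eq_vecI)
  show ?thesis
  proof
    assume "lin_indpt U"
    show "\<forall>a. (\<forall>i<n. (\<Sum>x\<in>U. a x * x $ i) = 0) \<longrightarrow> (\<forall>x\<in>U. a x = 0)"
    proof (intro allI impI ballI, rule ccontr)
      fix a x assume a: "\<forall>i<n. (\<Sum>x\<in>U. a x * x $ i) = 0" "x \<in> U" "a x \<noteq> 0"
      have "lin_dep U"
        by (rule lin_dep_crit[where v = x and a = a, OF assms(1) subset_refl]) (use a zero in auto)
      with \<open>lin_indpt U\<close> show False by contradiction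
    qed
  next
    assume *: "\<forall>a. (\<forall>i<n. (\<Sum>x\<in>U. a x * x $ i) = 0) \<longrightarrow> (\<forall>x\<in>U. a x = 0)"
    show "lin_indpt U"
    proof (rule finite_lin_indpt2)
      fix a assume "lincomb a U = 0\<^sub>v n"
      then show "\<forall>x\<in>U. a x = 0" using * zero by blast
    qed (use assms in auto)
  qed
qed

text \<open>Permuting coordinates carries a maximal independent set of columns to an independent set
  of columns of the same size. Applied to the inverse permutation, the inequality gives
  equality.\<close>

lemma rank_permute_rows_ge:
  assumes A: "A \<in> carrier_mat n nc" and \<sigma>: "\<sigma> permutes {..<n}"
  shows "rank A \<le> rank (mat n nc (\<lambda>(a, b). A $$ (\<sigma> a, b)))"
proof -
  let ?B = "mat n nc (\<lambda>(a, b). A $$ (\<sigma> a, b))"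
  let ?T = "\<lambda>x :: 'a vec. vec n (\<lambda>i. x $ \<sigma> i)"
  have lt: "\<sigma> i < n \<longleftrightarrow> i < n" for i using permutes_in_image[OF \<sigma>, of i] by simp
  obtain S where S: "maximal S (\<lambda>T. T \<subseteq> set (cols A) \<and> lin_indpt T)"
    using maximal_exists[of "(\<lambda>T. T \<subseteq> set (cols A) \<and> lin_indpt T)" "card (set (cols A))" "{}"]
    by (meson List.finite_set card_mono empty_iff empty_subsetI finite_lin_indpt2 rev_finite_subset)
  then have S1: "S \<subseteq> set (cols A)" "lin_indpt S" by (auto simp: maximal_def)
  have cols: "set (cols A) \<subseteq> carrier_vec n" using A cols_dim by blast
  have fin: "finite S" using S1 finite_subset by blast
  have Sc: "S \<subseteq> carrier_vec n" using S1 cols by blast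
  have inj: "inj_on ?T (carrier_vec n)"
  proof (rule inj_onI)
    fix x y :: "'a vec" assume xy: "x \<in> carrier_vec n" "y \<in> carrier_vec n" "?T x = ?T y"
    show "x = y"
    proof (rule eq_vecI)
      fix i assume "i < dim_vec y"
      then have i: "inv_into UNIV \<sigma> i < n" using xy permutes_in_image[OF permutes_inv[OF \<sigma>], of i] by simp
      have "?T x $ inv_into UNIV \<sigma> i = ?T y $ inv_into UNIV \<sigma> i" using xy(3) by simp
      then show "x $ i = y $ i" using i permutes_inverses(1)[OF \<sigma>] by simp
    qed (use xy in auto)
  qed
  then have injS: "inj_on ?T S" using Sc inj_on_subset by blast
  have sub: "?T ` S \<subseteq> set (cols ?B)"
  proof
    fix y assume "y \<in> ?T ` S"
    then obtain b where b: "b < nc" "y = ?T (col A b)"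
      using S1(1) A by (auto simp: cols_def)
    then have "y = col ?B b" using A lt by (intro eq_vecI) (auto)
    then show "y \<in> set (cols ?B)" using b by (auto simp: cols_def)
  qed
  have "lin_indpt (?T ` S)"
  proof (subst lin_indpt_iff_coords)
    show "\<forall>a. (\<forall>i<n. (\<Sum>x\<in>?T ` S. a x * x $ i) = 0) \<longrightarrow> (\<forall>x\<in>?T ` S. a x = 0)"
    proof (intro allI impI)
      fix a assume a: "\<forall>i<n. (\<Sum>x\<in>?T ` S. a x * x $ i) = 0"
      have "(\<Sum>x\<in>S. a (?T x) * x $ i) = 0" if "i < n" for i
      proof -
        have i: "inv_into UNIV \<sigma> i < n" using that permutes_in_image[OF permutes_inv[OF \<sigma>], of i] by simp
        have "(\<Sum>x\<in>S. a (?T x) * x $ i) = (\<Sum>x\<in>?T ` S. a x * x $ inv_into UNIV \<sigma> i)"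
          by (subst sum.reindex[OF injS]) (simp add: i permutes_inverses(1)[OF \<sigma>])
        then show ?thesis using a i by simp
      qed
      then have "\<forall>x\<in>S. a (?T x) = 0"
        using S1(2)[unfolded lin_indpt_iff_coords[OF fin Sc], rule_format, of "\<lambda>x. a (?T x)"] by blast
      then show "\<forall>x\<in>?T ` S. a x = 0" by simp
    qed
  qed (use fin in auto)
  then have "card (?T ` S) \<le> rank ?B"
    by (intro rank_ge_card_indpt[OF _ sub]) auto
  then show ?thesis using rank_card_indpt[OF A S] card_image[OF injS] by simp
qed

lemma rank_permute_rows:
  assumes A: "A \<in> carrier_mat n nc" and \<sigma>: "\<sigma> permutes {..<n}"
  shows "rank (mat n nc (\<lambda>(a, b). A $$ (\<sigma> a, b))) = rank A"
proof (rule antisym)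
  let ?B = "mat n nc (\<lambda>(a, b). A $$ (\<sigma> a, b))"
  have lt: "inv_into UNIV \<sigma> i < n \<longleftrightarrow> i < n" for i using permutes_in_image[OF permutes_inv[OF \<sigma>], of i] by simp
  have "rank ?B \<le> rank (mat n nc (\<lambda>(a, b). ?B $$ (inv_into UNIV \<sigma> a, b)))"
    by (rule rank_permute_rows_ge) (auto intro: permutes_inv[OF \<sigma>])
  also have "mat n nc (\<lambda>(a, b). ?B $$ (inv_into UNIV \<sigma> a, b)) = A"
    using A lt by (intro eq_matI) (auto simp: permutes_inverses(1)[OF \<sigma>])
  finally show "rank ?B \<le> rank A" .
qed (rule rank_permute_rows_ge[OF assms])

text \<open>The rank is defined through the set of columns, which does not change.\<close>

lemma rank_permute_cols:
  assumes A: "A \<in> carrier_mat n nc" and \<pi>: "\<pi> permutes {..<nc}"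
  shows "rank (mat n nc (\<lambda>(a, b). A $$ (a, \<pi> b))) = rank A"
proof -
  let ?B = "mat n nc (\<lambda>(a, b). A $$ (a, \<pi> b))"
  have "set (cols ?B) = col ?B ` {..<nc}" by (auto simp: cols_def)
  also have "\<dots> = (\<lambda>b. col A (\<pi> b)) ` {..<nc}"
    using A permutes_in_image[OF \<pi>] by (intro image_cong refl eq_vecI) auto
  also have "\<dots> = col A ` \<pi> ` {..<nc}" by (simp add: image_image)
  also have "\<dots> = set (cols A)" using A by (auto simp: permutes_image[OF \<pi>] cols_def)
  finally show ?thesis by (simp add: rank_def)
qed

lemma rank_le_nr:
  assumes "A \<in> carrier_mat n nc"
  shows "rank A \<le> n"
proof -
  obtain S where S: "maximal S (\<lambda>T. T \<subseteq> set (cols A) \<and> lin_indpt T)"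
    using maximal_exists[of "(\<lambda>T. T \<subseteq> set (cols A) \<and> lin_indpt T)" "card (set (cols A))" "{}"]
    by (meson List.finite_set card_mono empty_iff empty_subsetI finite_lin_indpt2 rev_finite_subset)
  then have S1: "S \<subseteq> set (cols A)" "lin_indpt S" by (auto simp: maximal_def)
  then have "S \<subseteq> carrier_vec n" using assms cols_dim by blast
  then have "card S \<le> dim" using li_le_dim(2)[of S] S1 fin_dim by simp
  then show ?thesis using rank_card_indpt[OF assms S] by (simp add: dim_is_n)
qed

text \<open>The nonzero columns are distinct unit vectors. They form a maximal independent set of
  columns because any other column is zero.\<close>

lemma rank_partial_permutation:
  assumes w: "\<And>x. w (w x) = x"
  shows "rank (mat n nc (\<lambda>(a, b). if w a = b then 1 else 0)) = card {b. b < nc \<and> w b < n}"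
proof -
  let ?A = "mat n nc (\<lambda>(a, b). if w a = b then 1 else 0) :: 'a mat"
  let ?B = "{b. b < nc \<and> w b < n}"
  let ?S = "(\<lambda>b. unit_vec n (w b)) ` ?B :: 'a vec set"
  have col: "col ?A b = (if w b < n then unit_vec n (w b) else 0\<^sub>v n)" if "b < nc" for b
  proof -
    have "w i = b \<longleftrightarrow> i = w b" for i using w by metis
    then show ?thesis using that by (intro eq_vecI) auto
  qed
  have S: "?S \<subseteq> set (cols ?A)"
  proof
    fix x assume "x \<in> ?S"
    then obtain b where "b < nc" "x = col ?A b" using col by auto
    then show "x \<in> set (cols ?A)" by (auto simp: cols_def)
  qed
  have "?S \<subseteq> set (unit_vecs n)" by (auto simp: unit_vecs_def)
  moreover have "lin_indpt (set (unit_vecs n))"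
    using unit_vecs_basis by (simp add: basis_def)
  ultimately have indpt: "lin_indpt ?S"
    using subset_li_is_li[of "set (unit_vecs n)" ?S] by simp
  have "maximal ?S (\<lambda>T. T \<subseteq> set (cols ?A) \<and> lin_indpt T)"
    unfolding maximal_def
  proof (intro conjI allI impI S indpt)
    fix T assume T: "?S \<subseteq> T \<and> T \<subseteq> set (cols ?A) \<and> lin_indpt T"
    have "T \<subseteq> carrier_vec n" using T cols_dim[of ?A] by auto
    then have z: "0\<^sub>v n \<notin> T" using T vs_zero_lin_dep[of T] by auto
    have "T \<subseteq> ?S"
    proof
      fix x assume "x \<in> T"
      then obtain b where "b < nc" "x = col ?A b" using T by (auto simp: cols_def)
      with z \<open>x \<in> T\<close> show "x \<in> ?S" using col[of b] by (auto split: if_splits)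
    qed
    with T show "T = ?S" by blast
  qed
  then have "rank ?A = card ?S" by (intro rank_card_indpt[of _ nc]) auto
  also have "\<dots> = card ?B"
  proof (rule card_image, rule inj_onI)
    fix x y assume xy: "x \<in> ?B" "y \<in> ?B" "unit_vec n (w x) = (unit_vec n (w y) :: 'a vec)"
    then have "w x = w y"
      by (metis (mono_tags, lifting) index_unit_vec(1) mem_Collect_eq zero_neq_one)
    then show "x = y" by (metis w)
  qed
  finally show ?thesis .
qed

end

section \<open>Rank conditions and minors for the shifted involution\<close>

definition perm_rank :: "(nat \<Rightarrow> nat) \<Rightarrow> nat \<Rightarrow> nat \<Rightarrow> nat" where
  "perm_rank w i j = card {b. b < j \<and> w b < i}"

text \<open>As \<open>w\<close> is an involution, the entry 1 of column \<open>b\<close> stands in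
  row \<open>w b\<close>, so \<open>perm_rank\<close> counts the ones inside the block.\<close>

lemma block_rank_partial_perm_mat:
  assumes "\<And>x. w (w x) = x" "i \<le> N" "j \<le> N"
  shows "block_rank (partial_perm_mat N w :: 'a::field mat) i j = perm_rank w i j"
proof -
  interpret vec_space "TYPE('a)" i .
  have "submatrix (partial_perm_mat N w) {..<i} {..<j} =
      (mat i j (\<lambda>(a, b). if w a = b then 1 else 0) :: 'a mat)"
    using assms(2,3) by (subst submatrix_lessThan[of _ N]) (auto simp: partial_perm_mat_def intro!: eq_matI)
  then show ?thesis
    by (simp add: block_rank_def rank_partial_permutation[OF assms(1)] perm_rank_def)
qed

lemma block_rank_le:
  assumes "A \<in> carrier_mat N N" "i \<le> N" "j \<le> N"
  shows "block_rank A i j \<le> min i j"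
proof -
  interpret vec_space "TYPE('a)" i .
  have "submatrix A {..<i} {..<j} \<in> carrier_mat i j"
    using assms by (simp add: submatrix_lessThan)
  then show ?thesis
    unfolding block_rank_def using rank_le_nr rank_le_nc by simp
qed

text \<open>The block contains all rows and columns that \<sigma> moves, so conjugation only
  permutes the rows and columns of the block.\<close>

lemma block_rank_conjugate:
  fixes A :: "'a::field mat"
  assumes A: "A \<in> carrier_mat N N" and \<sigma>: "\<sigma> permutes {..<m}" and "m \<le> i" "i \<le> N" "m \<le> j" "j \<le> N"
  shows "block_rank (mat N N (\<lambda>(a, b). A $$ (\<sigma> a, \<sigma> b))) i j = block_rank A i j"
proof -
  interpret vec_space "TYPE('a)" i .
  let ?B = "submatrix A {..<i} {..<j}"
  have \<sigma>ij: "\<sigma> permutes {..<i}" "\<sigma> permutes {..<j}"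
    using assms by (auto intro: permutes_subset[OF \<sigma>])
  have lt: "\<sigma> a < i \<longleftrightarrow> a < i" "\<sigma> a < j \<longleftrightarrow> a < j" for a
    using permutes_in_image[OF \<sigma>ij(1), of a] permutes_in_image[OF \<sigma>ij(2), of a] by auto
  have B: "?B = mat i j (\<lambda>(a, b). A $$ (a, b))"
    using assms by (simp add: submatrix_lessThan)
  have "submatrix (mat N N (\<lambda>(a, b). A $$ (\<sigma> a, \<sigma> b))) {..<i} {..<j} =
      mat i j (\<lambda>(a, b). mat i j (\<lambda>(a, b). ?B $$ (\<sigma> a, b)) $$ (a, \<sigma> b))"
    unfolding B submatrix_lessThan[OF mat_carrier \<open>i \<le> N\<close> \<open>j \<le> N\<close>]
    using \<open>i \<le> N\<close> \<open>j \<le> N\<close> by (intro eq_matI) (simp_all add: lt)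
  also have "rank \<dots> = rank (mat i j (\<lambda>(a, b). ?B $$ (\<sigma> a, b)))"
    by (rule rank_permute_cols[OF _ \<sigma>ij(2)]) simp
  also have "\<dots> = rank ?B"
    by (rule rank_permute_rows[OF _ \<sigma>ij(1)]) (simp add: B)
  finally show ?thesis by (simp add: block_rank_def)
qed

lemma shift_perm_involution:
  assumes "\<And>x. w (w x) = x"
  shows "shift_perm m w (shift_perm m w x) = x"
  using assms by (auto simp: shift_perm_def)

text \<open>Such a block has the largest rank its size allows. Its rank condition therefore holds
  for every matrix, and it has no minors of size one more than this rank.\<close>

lemma perm_rank_shift_small:
  assumes "i \<le> m \<or> j \<le> m"
  shows "perm_rank (shift_perm m w) i j = min i j"
proof -
  have "{b. b < j \<and> shift_perm m w b < i} = {..<min i j}"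
    using assms by (auto simp: shift_perm_def)
  then show ?thesis by (simp add: perm_rank_def)
qed

lemma perm_rank_shift:
  "perm_rank (shift_perm m w) (m + i) (m + j) = m + perm_rank w i j"
proof -
  have "{b. b < m + j \<and> shift_perm m w b < m + i} = {..<m} \<union> (\<lambda>b. m + b) ` {b. b < j \<and> w b < i}"
  proof (intro equalityI subsetI)
    fix b assume b: "b \<in> {b. b < m + j \<and> shift_perm m w b < m + i}"
    show "b \<in> {..<m} \<union> (\<lambda>b. m + b) ` {b. b < j \<and> w b < i}"
    proof (cases "b < m")
      case False
      then have "b = m + (b - m)" "b - m < j" "w (b - m) < i"
        using b by (auto simp: shift_perm_def)
      then show ?thesis by blast
    qed simp
  qed (auto simp: shift_perm_def)
  moreover have "card ({..<m} \<union> (\<lambda>b. m + b) ` {b. b < j \<and> w b < i}) = m + card {b. b < j \<and> w b < i}"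
    by (subst card_Un_disjoint) (auto simp: card_image)
  ultimately show ?thesis by (simp add: perm_rank_def)
qed

text \<open>The blocks are indexed by their excess over \<open>m\<close>, a range independent of
  \<open>m\<close>; this makes the generators for \<open>m\<close> and \<open>m + 1\<close>
  comparable.\<close>

definition shifted_positions :: "nat \<Rightarrow> nat \<Rightarrow> (nat \<Rightarrow> nat) \<Rightarrow> (nat set \<times> nat set) set" where
  "shifted_positions m n w = {(R, C). \<exists>i\<in>{1..n}. \<exists>j\<in>{1..n}. R \<subseteq> {..<m + i} \<and> C \<subseteq> {..<m + j} \<and>
     card R = 1 + m + perm_rank w i j \<and> card C = 1 + m + perm_rank w i j}"

lemma shifted_positionsI:
  assumes "i \<in> {1..n}" "j \<in> {1..n}" "R \<subseteq> {..<m + i}" "C \<subseteq> {..<m + j}"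
    "card R = 1 + m + perm_rank w i j" "card C = 1 + m + perm_rank w i j"
  shows "(R, C) \<in> shifted_positions m n w"
  using assms unfolding shifted_positions_def by blast

lemma minor_positionsI:
  assumes "R \<subseteq> {..<i}" "C \<subseteq> {..<j}" "i \<in> {1..N}" "j \<in> {1..N}"
    "card R = 1 + block_rank v i j" "card C = 1 + block_rank v i j"
  shows "(R, C) \<in> minor_positions N v"
  using assms unfolding minor_positions_def by blast

lemma minor_positions_shift:
  assumes w: "\<And>x. w (w x) = x"
  shows "minor_positions (m + n) (partial_perm_mat (m + n) (shift_perm m w) :: 'a::field mat) =
    shifted_positions m n w"
proof (intro equalityI subsetI)
  let ?r = "block_rank (partial_perm_mat (m + n) (shift_perm m w) :: 'a mat)"
  have r: "?r i j = perm_rank (shift_perm m w) i j" if "i \<le> m + n" "j \<le> m + n" for i j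
    using that by (intro block_rank_partial_perm_mat shift_perm_involution w)
  fix x assume "x \<in> minor_positions (m + n) (partial_perm_mat (m + n) (shift_perm m w) :: 'a mat)"
  then obtain R C i j where x: "x = (R, C)" "i \<in> {1..m + n}" "j \<in> {1..m + n}" "R \<subseteq> {..<i}" "C \<subseteq> {..<j}"
      "card R = 1 + ?r i j" "card C = 1 + ?r i j"
    by (auto simp: minor_positions_def)
  have le: "card R \<le> i" "card C \<le> j"
    using card_mono[OF _ x(4)] card_mono[OF _ x(5)] by auto
  \<comment> \<open>In a smaller block the minor would need min i j + 1 rows and columns.\<close>
  have "m < i \<and> m < j"
  proof (rule ccontr)
    assume "\<not> (m < i \<and> m < j)"
    then have "?r i j = min i j" using r[of i j] x perm_rank_shift_small[of i m j w] by auto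
    with le x show False by auto
  qed
  moreover define i' j' where "i' = i - m" "j' = j - m"
  ultimately have ij: "i = m + i'" "j = m + j'" "i' \<in> {1..n}" "j' \<in> {1..n}" using x by auto
  then have "?r i j = m + perm_rank w i' j'" using r[of i j] x by (simp add: perm_rank_shift)
  then show "x \<in> shifted_positions m n w"
    using x ij by (simp add: shifted_positionsI[of i' n j'])
next
  let ?r = "block_rank (partial_perm_mat (m + n) (shift_perm m w) :: 'a mat)"
  fix x assume "x \<in> shifted_positions m n w"
  then obtain R C i j where x: "x = (R, C)" "i \<in> {1..n}" "j \<in> {1..n}" "R \<subseteq> {..<m + i}" "C \<subseteq> {..<m + j}"
      "card R = 1 + m + perm_rank w i j" "card C = 1 + m + perm_rank w i j"
    by (auto simp: shifted_positions_def)
  have "?r (m + i) (m + j) = m + perm_rank w i j"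
    using x(2,3) block_rank_partial_perm_mat[OF shift_perm_involution[of w m, OF w], of "m + i" "m + n" "m + j"]
    by (simp add: perm_rank_shift)
  then show "x \<in> minor_positions (m + n) (partial_perm_mat (m + n) (shift_perm m w) :: 'a mat)"
    using x by (simp add: minor_positionsI[of R "m + i" C "m + j"])
qed

lemma partial_perm_mat_sym:
  assumes "\<And>x. w (w x) = x"
  shows "partial_perm_mat N w \<in> sym_mat N"
  using assms by (auto simp: sym_mat_def partial_perm_mat_def intro!: eq_matI)

subsection \<open>Determinantal and antidiagonal ideals\<close>

text \<open>The positions (a, b) and (b, a) carry the same variable and may both lie on the
  antidiagonal, so the monomial need not be squarefree.\<close>

definition adiag_mon :: "nat set \<Rightarrow> nat set \<Rightarrow> (nat \<times> nat) monomial" where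
  "adiag_mon R C = (\<Sum>s<card R. single
     (max (pick R s) (pick C (card R - 1 - s)), min (pick R s) (pick C (card R - 1 - s))) 1)"

definition adiag_gens :: "nat \<Rightarrow> 'a::field mat \<Rightarrow> (nat \<times> nat) monomial set" where
  "adiag_gens N v = (\<lambda>(R, C). adiag_mon R C) ` minor_positions N v"

lemma monom_pol_0 [simp]: "monom_pol 0 = 1"
  by (simp add: monom_pol_def)

lemma monom_pol_add: "monom_pol (a + b) = monom_pol a * monom_pol b"
  by (simp add: monom_pol_def mult_single)

lemma monom_pol_sum: "monom_pol (\<Sum>a\<in>A. f a) = (\<Prod>a\<in>A. monom_pol (f a))"
  by (induction A rule: infinite_finite_induct) (simp_all add: monom_pol_add)

lemma pick_less:
  assumes "R \<subseteq> {..<N}" "s < card R"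
  shows "pick R s < N"
  using pick_in_set_le[OF assms(2)] assms(1) by auto

lemma submatrix_sym_var_mat:
  assumes "R \<subseteq> {..<N}" "C \<subseteq> {..<N}"
  shows "submatrix (sym_var_mat N) R C = mat (card R) (card C)
    (\<lambda>(s, t). monom_pol (single (max (pick R s) (pick C t), min (pick R s) (pick C t)) 1))"
proof -
  have "{i. i < N \<and> i \<in> R} = R" "{i. i < N \<and> i \<in> C} = C" using assms by auto
  then show ?thesis
    using pick_less[OF assms(1)] pick_less[OF assms(2)]
    by (intro eq_matI) (auto simp: submatrix_def sym_var_mat_def var_pol_def)
qed

lemma adiag_submatrix:
  assumes "R \<subseteq> {..<N}" "C \<subseteq> {..<N}" "card R = card C"
  shows "adiag (submatrix (sym_var_mat N) R C) = (monom_pol (adiag_mon R C) :: (nat \<times> nat, 'a::field) mpol)"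
  unfolding submatrix_sym_var_mat[OF assms(1,2)] adiag_def adiag_mon_def monom_pol_sum
  by (rule prod.cong) (auto simp: assms(3))

lemma sum_singles_in_mons:
  assumes "\<And>a. a \<in> A \<Longrightarrow> f a < N" "\<And>a. a \<in> A \<Longrightarrow> g a < N"
  shows "(\<Sum>a\<in>A. single (max (f a) (g a), min (f a) (g a)) 1) \<in> mons N"
proof -
  have "keys (\<Sum>a\<in>A. single (max (f a) (g a), min (f a) (g a)) (1 :: nat)) \<subseteq> sym_vars N"
    by (rule keys_sum_subset) (use assms in \<open>auto simp: sym_vars_def\<close>)
  then show ?thesis by (simp add: mons_def)
qed

lemma minor_positions_cases:
  assumes "(R, C) \<in> minor_positions N v"
  shows "R \<subseteq> {..<N}" "C \<subseteq> {..<N}" "card R = card C" "card R > 0"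
  using assms by (fastforce simp: minor_positions_def)+

lemma finite_minor_positions: "finite (minor_positions N v)"
proof (rule finite_subset)
  show "minor_positions N v \<subseteq> Pow {..<N} \<times> Pow {..<N}"
    using minor_positions_cases by fastforce
qed simp

lemma finite_adiag_gens: "finite (adiag_gens N v)"
  by (simp add: adiag_gens_def finite_minor_positions)

lemma adiag_gens_subset: "adiag_gens N v \<subseteq> mons N"
proof -
  have "adiag_mon R C \<in> mons N" if "(R, C) \<in> minor_positions N v" for R C
    unfolding adiag_mon_def using minor_positions_cases[OF that]
    by (intro sum_singles_in_mons pick_less) auto
  then show ?thesis by (auto simp: adiag_gens_def)
qed

lemma J_sym_alt: "J_sym N v = genideal (coord_alg N :: ('a::field, _) module) (monom_pol ` adiag_gens N (v :: 'a mat))"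
proof -
  have "(\<lambda>(R, C). adiag (submatrix (sym_var_mat N) R C)) ` minor_positions N v =
      (monom_pol ` adiag_gens N v :: (nat \<times> nat, 'a) mpol set)"
    unfolding adiag_gens_def image_image
  proof (rule image_cong)
    fix x assume "x \<in> minor_positions N v"
    moreover obtain R C where "x = (R, C)" by (cases x)
    ultimately show "(case x of (R, C) \<Rightarrow> adiag (submatrix (sym_var_mat N) R C)) =
        (monom_pol (case x of (R, C) \<Rightarrow> adiag_mon R C) :: (nat \<times> nat, 'a) mpol)"
      using minor_positions_cases[of R C N v] adiag_submatrix[of R N C] by simp
  qed simp
  then show ?thesis by (simp add: J_sym_def)
qed

text \<open>Each Leibniz term uses every row of \<open>R\<close> and every column of
  \<open>C\<close> once, and the weight of a variable does not depend on the order of its indices.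
  Terms may coincide or cancel, so only an inclusion of supports is available.\<close>

lemma det_submatrix_sym_var_mat:
  assumes "R \<subseteq> {..<N}" "C \<subseteq> {..<N}" "card R = card C"
    and m: "m \<in> keys (det (submatrix (sym_var_mat N) R C) :: (nat \<times> nat, 'a::field) mpol)"
  shows "m \<in> mons N \<and>
    mon_weight m = (\<Sum>s<card R. single (pick R s) 1) + (\<Sum>s<card R. single (pick C s) 1)"
proof -
  let ?k = "card R"
  let ?mon = "\<lambda>\<sigma>. \<Sum>s\<in>{0..<?k}. single
    (max (pick R s) (pick C (\<sigma> s)), min (pick R s) (pick C (\<sigma> s))) (1::nat)"
  have det: "det (submatrix (sym_var_mat N) R C) =
      (\<Sum>\<sigma> | \<sigma> permutes {0..<?k}. signof \<sigma> * (monom_pol (?mon \<sigma>) :: (nat \<times> nat, 'a) mpol))"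
  proof -
    have A: "submatrix (sym_var_mat N) R C \<in> (carrier_mat ?k ?k :: (nat \<times> nat, 'a) mpol mat set)"
      unfolding submatrix_sym_var_mat[OF assms(1,2)] using assms(3) by simp
    have prod: "(\<Prod>s = 0..<?k. submatrix (sym_var_mat N) R C $$ (s, \<sigma> s)) =
        (monom_pol (?mon \<sigma>) :: (nat \<times> nat, 'a) mpol)" if "\<sigma> permutes {0..<?k}" for \<sigma>
      unfolding submatrix_sym_var_mat[OF assms(1,2)] monom_pol_sum
      using assms(3) permutes_in_image[OF that] by (intro prod.cong) auto
    show ?thesis
      unfolding det_def'[OF A] by (intro sum.cong refl) (simp only: mem_Collect_eq prod)
  qed
  have "keys (det (submatrix (sym_var_mat N) R C) :: (nat \<times> nat, 'a) mpol) \<subseteq>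
      {?mon \<sigma> | \<sigma>. \<sigma> permutes {0..<?k}}"
    unfolding det
  proof (rule keys_sum_subset)
    fix \<sigma> assume "\<sigma> \<in> {\<sigma>. \<sigma> permutes {0..<?k}}"
    moreover have "keys (signof \<sigma> * (monom_pol (?mon \<sigma>) :: (nat \<times> nat, 'a) mpol)) \<subseteq> {?mon \<sigma>}"
      by (cases "sign \<sigma> = 1") (auto simp: monom_pol_def sign_def in_keys_iff lookup_single when_def split: if_splits)
    ultimately show "keys (signof \<sigma> * (monom_pol (?mon \<sigma>) :: (nat \<times> nat, 'a) mpol)) \<subseteq>
      {?mon \<sigma> | \<sigma>. \<sigma> permutes {0..<?k}}" by blast
  qed
  then obtain \<sigma> where \<sigma>: "\<sigma> permutes {0..<?k}" "m = ?mon \<sigma>" using m by auto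
  have lt: "\<sigma> s < ?k" if "s < ?k" for s
    using permutes_in_image[OF \<sigma>(1), of s] that by simp
  have "m \<in> mons N"
    unfolding \<sigma>(2) using assms(1-3) lt by (intro sum_singles_in_mons pick_less) auto
  moreover have "mon_weight m = (\<Sum>s\<in>{0..<?k}. single (pick R s) 1 + single (pick C (\<sigma> s)) 1)"
    unfolding \<sigma>(2) mon_weight_sum by (rule sum.cong) (auto simp: max_def min_def add.commute)
  moreover have "(\<Sum>s\<in>{0..<?k}. single (pick C (\<sigma> s)) (1::nat)) = (\<Sum>s\<in>{0..<?k}. single (pick C s) 1)"
    using sum.permute[OF \<sigma>(1), of "\<lambda>s. single (pick C s) (1::nat)"] by (simp add: comp_def)
  ultimately show ?thesis by (simp add: sum.distrib lessThan_atLeast0)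
qed

section \<open>Homogeneity of the determinantal ideal\<close>

lemma weight_part_add: "weight_part \<chi> (p + q) = weight_part \<chi> p + weight_part \<chi> q"
  by (intro poly_mapping_eqI) (simp add: lookup_add when_def)

lemma weight_part_single_mult:
  fixes p :: "(nat \<times> nat, 'a::field) mpol"
  shows "weight_part (mon_weight m + \<chi>) (single m c * p) = single m c * weight_part \<chi> p"
proof (rule poly_mapping_eqI)
  fix k
  show "lookup (weight_part (mon_weight m + \<chi>) (single m c * p)) k = lookup (single m c * weight_part \<chi> p) k"
  proof (cases "\<exists>l. k = m + l")
    case True
    then show ?thesis by (auto simp: lookup_single_mult when_def)
  next
    case False
    then show ?thesis by (simp add: lookup_single_mult_zero)
  qed
qed

lemma weight_part_single_mult_zero:
  fixes p :: "(nat \<times> nat, 'a::field) mpol"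
  assumes "\<And>\<chi>'. \<chi> \<noteq> mon_weight m + \<chi>'"
  shows "weight_part \<chi> (single m c * p) = 0"
proof (rule poly_mapping_eqI)
  fix k
  show "lookup (weight_part \<chi> (single m c * p)) k = lookup 0 k"
  proof (cases "\<exists>l. k = m + l")
    case True
    then obtain l where "k = m + l" ..
    then show ?thesis using assms[of "mon_weight l"] by simp
  next
    case False
    then show ?thesis by (simp add: lookup_single_mult_zero)
  qed
qed

lemma I_sym_graded:
  fixes v :: "'a::field mat"
  shows "ideal (I_sym N v) (coord_alg N)" "weight_graded (I_sym N v)"
proof -
  interpret R: cring "coord_alg N :: ('a, _) module" by (rule cring_coord_alg)
  let ?D = "(\<lambda>(R, C). det (submatrix (sym_var_mat N) R C)) ` minor_positions N v :: (nat \<times> nat, 'a) mpol set"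
  have sub: "?D \<subseteq> carrier (coord_alg N)"
  proof
    fix p assume "p \<in> ?D"
    then obtain R C where RC: "(R, C) \<in> minor_positions N v" "p = det (submatrix (sym_var_mat N) R C)"
      by auto
    have "m \<in> mons N" if "m \<in> keys p" for m
      using det_submatrix_sym_var_mat[OF minor_positions_cases(1-3)[OF RC(1)]] that RC(2) by blast
    then show "p \<in> carrier (coord_alg N)" by auto
  qed
  show I: "ideal (I_sym N v) (coord_alg N)"
    unfolding I_sym_def by (rule R.genideal_ideal[OF sub])
  \<comment> \<open>The polynomials whose components all lie in \<open>I_sym N v\<close> form an
    ideal; it contains the homogeneous generators, hence all of \<open>I_sym N v\<close>.\<close>
  let ?T = "{p. keys p \<subseteq> mons N \<and> (\<forall>\<chi>. weight_part \<chi> p \<in> I_sym N v)}"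
  have "ideal ?T (coord_alg N)"
  proof (rule idealI_coord_alg)
    have "weight_part \<chi> (0 :: (nat \<times> nat, 'a) mpol) = 0" for \<chi>
      by (intro poly_mapping_eqI) simp
    then show "0 \<in> ?T" by (simp add: ideal_0[OF I])
    show "p + q \<in> ?T" if "p \<in> ?T" "q \<in> ?T" for p q
      using that by (simp add: keys_add_subset weight_part_add ideal_add[OF I])
    show "single m c * p \<in> ?T" if p: "p \<in> ?T" and m: "m \<in> mons N" for p m c
    proof -
      have "weight_part \<chi> (single m c * p) \<in> I_sym N v" for \<chi>
      proof (cases "\<exists>\<chi>'. \<chi> = mon_weight m + \<chi>'")
        case True
        then show ?thesis using p m
          by (auto simp: weight_part_single_mult intro!: ideal_mult[OF I] split: if_splits)
      next
        case False
        then show ?thesis by (simp add: weight_part_single_mult_zero ideal_0[OF I])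
      qed
      moreover have "keys (single m c * p) \<subseteq> mons N"
        using p m by (intro keys_mult_mons) auto
      ultimately show ?thesis by simp
    qed
  qed auto
  moreover have "?D \<subseteq> ?T"
  proof
    fix p assume "p \<in> ?D"
    then obtain R C where RC: "(R, C) \<in> minor_positions N v" "p = det (submatrix (sym_var_mat N) R C)"
      by auto
    have p: "p \<in> I_sym N v"
      unfolding I_sym_def using R.genideal_self[OF sub] \<open>p \<in> ?D\<close> by blast
    define \<omega> where "\<omega> = (\<Sum>s<card R. single (pick R s) (1::nat)) + (\<Sum>s<card R. single (pick C s) 1)"
    have wt: "m \<in> mons N \<and> mon_weight m = \<omega>" if "m \<in> keys p" for m
      unfolding \<omega>_def using det_submatrix_sym_var_mat[OF minor_positions_cases(1-3)[OF RC(1)]] that RC(2) by blast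
    have "weight_part \<chi> p = (if \<chi> = \<omega> then p else 0)" for \<chi>
      using wt by (intro poly_mapping_eqI) (auto simp: when_def in_keys_iff)
    then show "p \<in> ?T" using wt p ideal_0[OF I] by auto
  qed
  ultimately have "I_sym N v \<subseteq> ?T"
    unfolding I_sym_def by (rule R.genideal_minimal)
  then show "weight_graded (I_sym N v)" by (auto simp: weight_graded_def)
qed

section \<open>Consequences of the two ideal equalities\<close>

context
  fixes N :: nat and v :: "'a::field mat"
  assumes I_eq: "I_sym N v = vanishing_ideal N (MSV_sym N v)"
    and J_eq: "J_sym N v = init_ideal N (vanishing_ideal N (MSV_sym N v))"
begin

lemma vanishing_ideal_graded:
  "ideal (vanishing_ideal N (MSV_sym N v)) (coord_alg N)"
  "weight_graded (vanishing_ideal N (MSV_sym N v))"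
  using I_sym_graded[of N v] by (simp_all add: I_eq)

lemma standard_monomials_vanishing:
  "standard_monomials N (vanishing_ideal N (MSV_sym N v)) \<chi> =
     {m \<in> mons_of_weight N \<chi>. \<not> (\<exists>g\<in>adiag_gens N v. mdvd g m)}"
proof -
  have "m \<in> leading_monomials (vanishing_ideal N (MSV_sym N v)) \<longleftrightarrow> (\<exists>g\<in>adiag_gens N v. mdvd g m)"
    if "m \<in> mons N" for m
  proof -
    have "m \<in> leading_monomials (vanishing_ideal N (MSV_sym N v)) \<longleftrightarrow>
        monom_pol m \<in> J_sym N v"
      using monom_pol_in_init_ideal_iff[OF vanishing_ideal_graded(1)] J_eq by simp
    also have "\<dots> \<longleftrightarrow> (\<exists>g\<in>adiag_gens N v. mdvd g m)"
      unfolding J_sym_alt by (rule monom_pol_in_monomial_ideal_iff[OF adiag_gens_subset that])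
    finally show ?thesis .
  qed
  then show ?thesis by (auto simp: standard_monomials_def mons_of_weight_def)
qed

lemma K_class_taylor: "K_class N (MSV_sym N v) = taylor_poly (adiag_gens N v)"
  unfolding K_class_def
  by (rule K_polynomial_taylor[OF finite_adiag_gens adiag_gens_subset])
    (simp add: graded_char_quot[OF vanishing_ideal_graded] standard_monomials_vanishing)

end

subsection \<open>Symmetry in the first variables\<close>

lemma lookup_map_key:
  assumes "inj f"
  shows "lookup (Poly_Mapping.map_key f p) v = lookup p (f v)"
  by (simp add: map_key.rep_eq[OF assms])

lemma map_key_single':
  assumes "inj f" "\<And>x. g (f x) = x" "\<And>x. f (g x) = x"
  shows "Poly_Mapping.map_key f (single k c) = single (g k) c"
  using map_key_single[OF assms(1), of "g k" c] by (simp add: assms(3))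

lemma map_key_sum:
  assumes "inj f"
  shows "Poly_Mapping.map_key f (\<Sum>a\<in>A. h a) = (\<Sum>a\<in>A. Poly_Mapping.map_key f (h a))"
  using assms by (induction A rule: infinite_finite_induct) (auto simp: map_key_plus)

text \<open>Naming the inverse as a parameter makes the situation symmetric: every fact is also
  available for the inverse permutation, under the prefix \<open>inv\<close>.\<close>

locale var_perm =
  fixes \<sigma> \<sigma>' :: "nat \<Rightarrow> nat"
  assumes inv1 [simp]: "\<sigma>' (\<sigma> x) = x" and inv2 [simp]: "\<sigma> (\<sigma>' x) = x"
begin

lemma inverse: "var_perm \<sigma>' \<sigma>"
  by unfold_locales simp_all

lemma inj [simp]: "inj \<sigma>"
  by (rule inj_on_inverseI[of _ \<sigma>']) simp

abbreviation permute :: "nat monomial \<Rightarrow> nat monomial" where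
  "permute \<equiv> Poly_Mapping.map_key \<sigma>"

text \<open>Only the first branch matters; the second one makes this a bijection of all pairs.\<close>
definition permute_pos :: "nat \<times> nat \<Rightarrow> nat \<times> nat" where
  "permute_pos = (\<lambda>(a, b). if b \<le> a then (max (\<sigma> a) (\<sigma> b), min (\<sigma> a) (\<sigma> b))
     else (min (\<sigma> a) (\<sigma> b), max (\<sigma> a) (\<sigma> b)))"

abbreviation permute_mon :: "(nat \<times> nat) monomial \<Rightarrow> (nat \<times> nat) monomial" where
  "permute_mon \<equiv> Poly_Mapping.map_key permute_pos"

abbreviation permute_pol :: "(nat \<times> nat, 'a::zero) mpol \<Rightarrow> (nat \<times> nat, 'a) mpol" where
  "permute_pol \<equiv> Poly_Mapping.map_key permute_mon"

lemma permute_pos_inverse: "var_perm.permute_pos \<sigma>' (permute_pos v) = v"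
proof -
  interpret inv: var_perm \<sigma>' \<sigma> by (rule inverse)
  obtain a b where v: "v = (a, b)" by (cases v)
  have "\<sigma> a = \<sigma> b \<longleftrightarrow> a = b" by (metis inv1)
  then show ?thesis
    unfolding v permute_pos_def inv.permute_pos_def by (auto simp: max_def min_def)
qed

end

context var_perm
begin

sublocale inv: var_perm \<sigma>' \<sigma>
  by (rule inverse)

lemmas permute_pos_inverses [simp] = permute_pos_inverse inv.permute_pos_inverse

lemma inj_permute_pos [simp]: "inj permute_pos"
  by (rule inj_on_inverseI[of _ inv.permute_pos]) simp

end

context var_perm
begin

lemma permute_inverses [simp]:
  "inv.permute (permute \<chi>) = \<chi>" "permute (inv.permute \<chi>) = \<chi>"
  by (intro poly_mapping_eqI, simp add: lookup_map_key)+

lemma permute_mon_inverses [simp]: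
  "inv.permute_mon (permute_mon m) = m" "permute_mon (inv.permute_mon m) = m"
  by (intro poly_mapping_eqI, simp add: lookup_map_key)+

lemma inj_permute_mon [simp]: "inj permute_mon"
  by (rule inj_on_inverseI[of _ inv.permute_mon]) simp

lemma inj_permute [simp]: "inj permute"
  by (rule inj_on_inverseI[of _ inv.permute]) simp

end

context var_perm
begin

lemma permute_pol_inverses [simp]:
  "inv.permute_pol (permute_pol p) = p" "permute_pol (inv.permute_pol p) = p"
  by (intro poly_mapping_eqI, simp add: lookup_map_key)+

text \<open>Additivity reduces this to a single variable. Since \<open>map_key\<close> pulls
  exponents back, that variable is moved by the inverse permutation.\<close>

lemma mon_weight_permute_mon: "mon_weight (permute_mon m) = permute (mon_weight m)"
proof -
  have "mon_weight (permute_mon (single v c)) = permute (mon_weight (single v c))" for v c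
  proof -
    obtain a b where v: "v = (a, b)" by (cases v)
    have "permute_mon (single v c) = single (inv.permute_pos v) c"
      by (rule map_key_single') simp_all
    moreover have "permute (single k c) = single (\<sigma>' k) c" for k
      by (rule map_key_single') simp_all
    ultimately show ?thesis
      by (simp add: v inv.permute_pos_def map_key_plus max_def min_def add.commute)
  qed
  then have "mon_weight (permute_mon (\<Sum>v\<in>keys m. single v (lookup m v))) =
      permute (mon_weight (\<Sum>v\<in>keys m. single v (lookup m v)))"
    by (simp add: map_key_sum mon_weight_sum)
  then show ?thesis by (simp only: sum_singles_keys)
qed

text \<open>The two nested pullbacks amount to a push-forward: \<open>permute_pol\<close> renames
  each variable \<open>v\<close> to \<open>permute_pos v\<close>.\<close>

lemma eval_permute_pol:
  "eval_mpol \<phi> g (permute_pol p) = eval_mpol \<phi> (\<lambda>v. g (permute_pos v)) p"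
proof -
  have keys1: "keys (permute_pol p) = inv.permute_mon ` keys p"
  proof (intro equalityI subsetI)
    fix m assume "m \<in> keys (permute_pol p)"
    then have "m = inv.permute_mon (permute_mon m)" "permute_mon m \<in> keys p"
      by (simp_all add: in_keys_iff lookup_map_key)
    then show "m \<in> inv.permute_mon ` keys p" by (rule image_eqI)
  qed (auto simp: in_keys_iff lookup_map_key)
  have keys2: "keys (inv.permute_mon m) = permute_pos ` keys m" for m
  proof (intro equalityI subsetI)
    fix v assume "v \<in> keys (inv.permute_mon m)"
    then have "v = permute_pos (inv.permute_pos v)" "inv.permute_pos v \<in> keys m"
      by (simp_all add: in_keys_iff lookup_map_key)
    then show "v \<in> permute_pos ` keys m" by (rule image_eqI)
  qed (auto simp: in_keys_iff lookup_map_key)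
  have inj1: "inj_on inv.permute_mon (keys p)"
    by (rule inj_on_subset[OF inv.inj_permute_mon]) simp
  have inj2: "inj_on permute_pos (keys m)" for m
    by (rule inj_on_subset[OF inj_permute_pos]) simp
  show ?thesis
    unfolding eval_mpol_def keys1 sum.reindex[OF inj1] comp_def keys2 prod.reindex[OF inj2]
    by (simp add: lookup_map_key)
qed

lemma permute_pol_diff: "permute_pol (p - q) = permute_pol p - permute_pol (q :: (nat \<times> nat, 'a::ab_group_add) mpol)"
  by (intro poly_mapping_eqI) (simp add: lookup_map_key lookup_minus)

lemma series_mult_permute:
  "series_mult (\<lambda>\<alpha>. P (permute \<alpha>)) (\<lambda>\<beta>. H (permute \<beta>)) \<chi> = series_mult P H (permute \<chi>)"
proof -
  have "(\<Sum>(\<alpha>, \<beta>) | \<alpha> + \<beta> = permute \<chi>. P \<alpha> * H \<beta>) =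
      (\<Sum>(\<alpha>, \<beta>) | \<alpha> + \<beta> = \<chi>. P (permute \<alpha>) * H (permute \<beta>))"
    by (rule sum.reindex_bij_witness[of _ "\<lambda>(\<alpha>, \<beta>). (permute \<alpha>, permute \<beta>)"
          "\<lambda>(\<alpha>, \<beta>). (inv.permute \<alpha>, inv.permute \<beta>)"])
      (auto simp: map_key_plus[symmetric])
  then show ?thesis by (simp add: series_mult_def)
qed

end

locale var_perm_bounded = var_perm +
  fixes N :: nat
  assumes less_iff [simp]: "\<sigma> x < N \<longleftrightarrow> x < N"
begin

lemma inv_less_iff [simp]: "\<sigma>' x < N \<longleftrightarrow> x < N"
  using less_iff[of "\<sigma>' x"] by simp

lemma bounded_inverse: "var_perm_bounded \<sigma>' \<sigma> N"
  by unfold_locales simp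

lemma permute_pos_in_sym_vars: "v \<in> sym_vars N \<Longrightarrow> permute_pos v \<in> sym_vars N"
  by (auto simp: permute_pos_def sym_vars_def)

end

context var_perm_bounded
begin

sublocale inv: var_perm_bounded \<sigma>' \<sigma> N
  by (rule bounded_inverse)

lemma permute_mon_in_mons: "m \<in> mons N \<Longrightarrow> permute_mon m \<in> mons N"
proof -
  assume m: "m \<in> mons N"
  have "v \<in> sym_vars N" if "v \<in> keys (permute_mon m)" for v
  proof -
    have "permute_pos v \<in> sym_vars N" using m that by (auto simp: mons_def in_keys_iff lookup_map_key)
    from inv.permute_pos_in_sym_vars[OF this] show ?thesis by simp
  qed
  then show ?thesis by (auto simp: mons_def)
qed

end

context var_perm_bounded
begin

lemma permute_mon_in_mons_of_weight:
  "m \<in> mons_of_weight N \<chi> \<Longrightarrow> permute_mon m \<in> mons_of_weight N (permute \<chi>)"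
  by (simp add: mons_of_weight_def permute_mon_in_mons mon_weight_permute_mon)

end

context var_perm_bounded
begin

lemma permute_mons_of_weight: "permute_mon ` mons_of_weight N \<chi> = mons_of_weight N (permute \<chi>)"
proof (intro equalityI subsetI)
  fix m assume "m \<in> mons_of_weight N (permute \<chi>)"
  from inv.permute_mon_in_mons_of_weight[OF this]
  have "inv.permute_mon m \<in> mons_of_weight N \<chi>" by simp
  then show "m \<in> permute_mon ` mons_of_weight N \<chi>" by (rule rev_image_eqI) simp
qed (auto intro: permute_mon_in_mons_of_weight)

lemma card_mons_of_weight_permute: "card (mons_of_weight N (permute \<chi>)) = card (mons_of_weight N \<chi>)"
  unfolding permute_mons_of_weight[symmetric]
  by (rule card_image) (rule inj_on_subset[OF inj_permute_mon], simp)

end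

context var_perm_bounded
begin

lemma keys_permute_pol:
  assumes "keys p \<subseteq> S" "\<And>m. m \<in> S \<Longrightarrow> inv.permute_mon m \<in> S'"
  shows "keys (permute_pol p) \<subseteq> S'"
proof
  fix m assume "m \<in> keys (permute_pol p)"
  then have "permute_mon m \<in> S" using assms(1) by (auto simp: in_keys_iff lookup_map_key)
  from assms(2)[OF this] show "m \<in> S'" by simp
qed

end

context var_perm_bounded
begin

text \<open>The images of the standard monomials of weight \<chi> are a basis of the other weight
  space. They are in general not standard, because the term order is not invariant; relations and
  polynomials are pulled back by \<open>permute_pol\<close> instead.\<close>

lemma graded_char_quot_permute:
  fixes I :: "(nat \<times> nat, 'a::field) mpol set"
  assumes I: "ideal I (coord_alg N)" and gr: "weight_graded I"
    and perm: "\<And>p. p \<in> I \<Longrightarrow> permute_pol p \<in> I" "\<And>p. p \<in> I \<Longrightarrow> inv.permute_pol p \<in> I"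
  shows "graded_char (quot_alg N I) (quot_weight_space N I) (permute \<chi>) =
    graded_char (quot_alg N I) (quot_weight_space N I) \<chi>"
proof -
  let ?S = "permute_mon ` standard_monomials N I \<chi>"
  have "vectorspace.dim class_ring ((quot_alg N I)\<lparr>carrier := quot_weight_space N I (permute \<chi>)\<rparr>) = card ?S"
  proof (rule dim_quot_weight_space[OF I])
    show "?S \<subseteq> mons_of_weight N (permute \<chi>)"
      unfolding permute_mons_of_weight[symmetric] by (intro image_mono standard_monomials_subset)
  next
    fix p assume p: "p \<in> I" "keys p \<subseteq> ?S"
    have "keys (permute_pol p) \<subseteq> standard_monomials N I \<chi>"
      by (rule keys_permute_pol[OF p(2)]) auto
    then have "permute_pol p = 0"
      by (rule standard_monomials_independent[OF I perm(1)[OF p(1)]])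
    then have "inv.permute_pol (permute_pol p) = 0" by simp
    then show "p = 0" by simp
  next
    fix p :: "(nat \<times> nat, 'a) mpol" assume p: "keys p \<subseteq> mons_of_weight N (permute \<chi>)"
    have "keys (permute_pol p) \<subseteq> mons_of_weight N \<chi>"
      by (rule keys_permute_pol[OF p]) (metis inv.permute_mon_in_mons_of_weight permute_inverses(1))
    from polynomial_normal_form[OF I gr this]
    obtain Q where Q: "keys Q \<subseteq> standard_monomials N I \<chi>" "permute_pol p - Q \<in> I" by blast
    have "inv.permute_pol (permute_pol p - Q) = p - inv.permute_pol Q"
      by (simp add: inv.permute_pol_diff)
    moreover have "keys (inv.permute_pol Q) \<subseteq> ?S"
      by (rule inv.keys_permute_pol[OF Q(1)]) auto
    ultimately show "\<exists>q. keys q \<subseteq> ?S \<and> p - q \<in> I"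
      using perm(2)[OF Q(2)] by metis
  qed
  also have "card ?S = card (standard_monomials N I \<chi>)"
    by (rule card_image) (rule inj_on_subset[OF inj_permute_mon], simp)
  finally show ?thesis using graded_char_quot[OF I gr, of \<chi>] by (simp only: graded_char_def)
qed

text \<open>Evaluating the permuted polynomial at \<open>M\<close> is evaluating \<open>p\<close> at
  the conjugate of \<open>M\<close>; the exchange of larger and smaller index is absorbed by the
  symmetry of \<open>M\<close>.\<close>

lemma permute_vanishing_ideal:
  fixes V :: "'a::field mat set"
  assumes V: "V \<subseteq> sym_mat N"
    and perm: "\<And>M. M \<in> V \<Longrightarrow> mat N N (\<lambda>(a, b). M $$ (\<sigma> a, \<sigma> b)) \<in> V"
    and p: "p \<in> vanishing_ideal N V"
  shows "permute_pol p \<in> vanishing_ideal N V"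
proof -
  have keys: "keys p \<subseteq> mons N" using p by (simp add: vanishing_ideal_def)
  have "eval_mpol (\<lambda>c. c) (\<lambda>(i, j). M $$ (i, j)) (permute_pol p) = 0" if M: "M \<in> V" for M
  proof -
    let ?M = "mat N N (\<lambda>(a, b). M $$ (\<sigma> a, \<sigma> b))"
    have MT: "M \<in> carrier_mat N N" "M\<^sup>T = M" using M V by (auto simp: sym_mat_def)
    have sym: "M $$ (i, j) = M $$ (j, i)" if "i < N" "j < N" for i j
      using MT that by (metis index_transpose_mat(1) carrier_matD)
    have "(case permute_pos v of (i, j) \<Rightarrow> M $$ (i, j)) = (case v of (i, j) \<Rightarrow> ?M $$ (i, j))"
      if "v \<in> sym_vars N" for v
      using that sym by (auto simp: sym_vars_def permute_pos_def max_def min_def)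
    then have "eval_mpol (\<lambda>c. c) (\<lambda>v. case permute_pos v of (i, j) \<Rightarrow> M $$ (i, j)) p =
        eval_mpol (\<lambda>c. c) (\<lambda>(i, j). ?M $$ (i, j)) p"
      unfolding eval_mpol_def using keys
      by (intro sum.cong prod.cong arg_cong2[of _ _ _ _ "(*)"] arg_cong2[of _ _ _ _ "(^)"])
        (auto simp: mons_def)
    also have "\<dots> = 0" using p perm[OF M] by (simp add: vanishing_ideal_def)
    finally show ?thesis by (simp add: eval_permute_pol)
  qed
  moreover have "keys (permute_pol p) \<subseteq> mons N"
    by (rule keys_permute_pol[OF keys]) (rule inv.permute_mon_in_mons)
  ultimately show ?thesis by (simp add: vanishing_ideal_def)
qed

end

context var_perm_bounded
begin

text \<open>Both characters are invariant, so the permuted polynomial satisfies the same defining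
  equation and must coincide with the original one.\<close>

lemma K_class_permute:
  fixes v :: "'a::field mat"
  assumes I_eq: "I_sym N v = vanishing_ideal N (MSV_sym N v)"
    and J_eq: "J_sym N v = init_ideal N (vanishing_ideal N (MSV_sym N v))"
    and perm: "\<And>M. M \<in> MSV_sym N v \<Longrightarrow> mat N N (\<lambda>(a, b). M $$ (\<sigma> a, \<sigma> b)) \<in> MSV_sym N v"
      "\<And>M. M \<in> MSV_sym N v \<Longrightarrow> mat N N (\<lambda>(a, b). M $$ (\<sigma>' a, \<sigma>' b)) \<in> MSV_sym N v"
  shows "lookup (K_class N (MSV_sym N v)) (permute \<alpha>) = lookup (K_class N (MSV_sym N v)) \<alpha>"
proof -
  let ?I = "vanishing_ideal N (MSV_sym N v)"
  let ?H = "\<lambda>\<chi>. int (card (mons_of_weight N \<chi>))"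
  let ?C = "graded_char (quot_alg N ?I) (quot_weight_space N ?I)"
  let ?P = "K_class N (MSV_sym N v)"
  have sub: "MSV_sym N v \<subseteq> sym_mat N" by (auto simp: MSV_sym_def)
  note gr = vanishing_ideal_graded[OF I_eq J_eq]
  have "series_mult (lookup (taylor_poly (adiag_gens N v))) ?H = ?C"
    by (rule series_mult_taylor_poly[OF finite_adiag_gens adiag_gens_subset])
      (simp add: graded_char_quot[OF gr] standard_monomials_vanishing[OF I_eq J_eq])
  then have P: "series_mult (lookup ?P) ?H = ?C"
    by (simp add: K_class_taylor[OF I_eq J_eq])
  have "series_mult (lookup (Poly_Mapping.map_key permute ?P)) ?H = ?C"
  proof
    fix \<chi>
    have "series_mult (lookup (Poly_Mapping.map_key permute ?P)) ?H \<chi> =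
        series_mult (\<lambda>\<alpha>. lookup ?P (permute \<alpha>)) (\<lambda>\<beta>. ?H (permute \<beta>)) \<chi>"
    proof -
      have "lookup (Poly_Mapping.map_key permute ?P) = (\<lambda>\<alpha>. lookup ?P (permute \<alpha>))"
        by (rule ext) (simp add: lookup_map_key)
      then show ?thesis by (simp add: card_mons_of_weight_permute)
    qed
    also have "\<dots> = ?C (permute \<chi>)"
      using series_mult_permute[of "lookup ?P" ?H \<chi>] by (simp only: P)
    also have "\<dots> = ?C \<chi>"
      by (rule graded_char_quot_permute[OF gr permute_vanishing_ideal[OF sub perm(1)]
            inv.permute_vanishing_ideal[OF sub perm(2)]])
    finally show "series_mult (lookup (Poly_Mapping.map_key permute ?P)) ?H \<chi> = ?C \<chi>" .
  qed
  then have "Poly_Mapping.map_key permute ?P = ?P"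
    unfolding K_class_def by (intro K_polynomial_eqI[symmetric])
  then have "lookup (Poly_Mapping.map_key permute ?P) \<alpha> = lookup ?P \<alpha>" by simp
  then show ?thesis by (simp add: lookup_map_key)
qed

end

lemma MSV_sym_conjugate:
  fixes M :: "'a::field mat"
  assumes w: "\<And>x. w (w x) = x" and \<sigma>: "\<sigma> permutes {..<m}"
    and M: "M \<in> MSV_sym (m + n) (partial_perm_mat (m + n) (shift_perm m w))"
  shows "mat (m + n) (m + n) (\<lambda>(a, b). M $$ (\<sigma> a, \<sigma> b)) \<in>
    MSV_sym (m + n) (partial_perm_mat (m + n) (shift_perm m w))"
proof -
  let ?N = "m + n" and ?v = "partial_perm_mat (m + n) (shift_perm m w) :: 'a mat"
  let ?M = "mat ?N ?N (\<lambda>(a, b). M $$ (\<sigma> a, \<sigma> b))"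
  have MT: "M \<in> carrier_mat ?N ?N" "M\<^sup>T = M" using M by (auto simp: MSV_sym_def sym_mat_def)
  have lt: "\<sigma> a < ?N \<longleftrightarrow> a < ?N" for a
    using permutes_in_image[OF permutes_subset[OF \<sigma>, of "{..<?N}"], of a] by simp
  have "M $$ (i, j) = M $$ (j, i)" if "i < ?N" "j < ?N" for i j
    using MT that by (metis index_transpose_mat(1) carrier_matD)
  then have "?M \<in> sym_mat ?N" using lt by (auto simp: sym_mat_def intro!: eq_matI)
  moreover have "block_rank ?M i j \<le> block_rank ?v i j" if "i \<in> {1..?N}" "j \<in> {1..?N}" for i j
  proof (cases "i \<le> m \<or> j \<le> m")
    case True
    have "block_rank ?M i j \<le> min i j" using that by (intro block_rank_le) auto
    also have "\<dots> = block_rank ?v i j"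
      unfolding perm_rank_shift_small[OF True, of w, symmetric]
      by (rule block_rank_partial_perm_mat[OF shift_perm_involution[of w m, OF w], symmetric]) (use that in auto)
    finally show ?thesis .
  next
    case False
    then have "block_rank ?M i j = block_rank M i j"
      using that by (intro block_rank_conjugate[OF MT(1) \<sigma>]) auto
    then show ?thesis using M that by (simp add: MSV_sym_def)
  qed
  ultimately show ?thesis by (simp add: MSV_sym_def)
qed

subsection \<open>Antidiagonals near the edge\<close>

text \<open>Exactly \<open>s\<close> of the values lie below \<open>x s\<close>. This allows row and
  column sets to be built from increasing sequences.\<close>

lemma pick_image_strict_mono:
  fixes x :: "nat \<Rightarrow> nat"
  assumes "strict_mono_on {..<k} x"
  shows "card (x ` {..<k}) = k" "s < k \<Longrightarrow> pick (x ` {..<k}) s = x s"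
proof -
  have inj: "inj_on x {..<k}" by (rule strict_mono_on_imp_inj_on[OF assms])
  then show "card (x ` {..<k}) = k" by (simp add: card_image)
  assume s: "s < k"
  have "{a \<in> x ` {..<k}. a < x s} = x ` {..<s}"
  proof (intro equalityI subsetI)
    fix a assume "a \<in> {a \<in> x ` {..<k}. a < x s}"
    then obtain t where t: "t < k" "a = x t" "x t < x s" by auto
    have "t < s"
    proof (rule ccontr)
      assume "\<not> t < s"
      then have "s = t \<or> s < t" by auto
      then have "x s \<le> x t" using strict_mono_onD[OF assms, of s t] s t by auto
      with t show False by simp
    qed
    with t show "a \<in> x ` {..<s}" by blast
  next
    fix a assume "a \<in> x ` {..<s}"
    then show "a \<in> {a \<in> x ` {..<k}. a < x s}" using s strict_mono_onD[OF assms, of _ s] by auto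
  qed
  moreover have "card (x ` {..<s}) = s"
    using inj s by (subst card_image) (auto intro: inj_on_subset)
  ultimately show "pick (x ` {..<k}) s = x s"
    using pick_card_in_set[of "x s" "x ` {..<k}"] s by simp
qed

lemma strict_mono_on_pick: "strict_mono_on {..<card R} (pick R)"
  by (intro strict_mono_onI) (auto intro: pick_mono_le)

lemma strict_mono_on_ge:
  fixes x :: "nat \<Rightarrow> nat"
  assumes "strict_mono_on {..<k} x" "s < k"
  shows "s \<le> x s"
  using assms(2)
proof (induction s)
  case (Suc s)
  then show ?case using strict_mono_onD[OF assms(1), of s "Suc s"] by simp
qed simp

text \<open>The exponent of a variable with smaller index \<open>b\<close> below \<open>d\<close>:
  that index is the row of an entry at one end of the antidiagonal (first sum) or the column of an
  entry at the other end (second sum). Both can happen at once.\<close>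

definition edge_count :: "nat \<Rightarrow> nat \<Rightarrow> (nat \<Rightarrow> nat) \<Rightarrow> (nat \<Rightarrow> nat) \<Rightarrow> nat \<Rightarrow> nat \<Rightarrow> nat" where
  "edge_count d k x y a b = (\<Sum>s<d. (1 when x s = b \<and> y (k - 1 - s) = a)) +
     (\<Sum>s<d. (1 when y s = b \<and> x (k - 1 - s) = a))"

text \<open>
  An antidiagonal of length at least \<open>2 d\<close> meets the positions with smaller index below \<open>d\<close> only in its
  first and last \<open>d\<close> entries.
\<close>

lemma lookup_adiag_mon:
  assumes k: "card R = k" "card C = k" and d: "2 * d \<le> k" "b < d"
  shows "lookup (adiag_mon R C) (a, b) = edge_count d k (pick R) (pick C) a b"
proof -
  let ?x = "pick R" and ?y = "pick C"
  have x: "s \<le> ?x s" and y: "s \<le> ?y s" if "s < k" for s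
    using strict_mono_on_ge[OF strict_mono_on_pick, of s R] strict_mono_on_ge[OF strict_mono_on_pick, of s C]
      that k by auto
  let ?f = "\<lambda>s. 1 when (max (?x s) (?y (k - 1 - s)), min (?x s) (?y (k - 1 - s))) = (a, b) :: nat"
  have "lookup (adiag_mon R C) (a, b) = (\<Sum>s<k. ?f s)"
    by (simp add: adiag_mon_def k lookup_sum lookup_single)
  also have "{..<k} = {..<d} \<union> {d..<k - d} \<union> {k - d..<k}" using d by auto
  also have "(\<Sum>s\<in>{..<d} \<union> {d..<k - d} \<union> {k - d..<k}. ?f s) =
      (\<Sum>s<d. ?f s) + (\<Sum>s=d..<k - d. ?f s) + (\<Sum>s=k - d..<k. ?f s)"
    using d by (subst sum.union_disjoint; (subst sum.union_disjoint)?) auto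
  also have "(\<Sum>s<d. ?f s) = (\<Sum>s<d. (1 when ?x s = b \<and> ?y (k - 1 - s) = a))"
  proof (rule sum.cong)
    fix s assume "s \<in> {..<d}"
    then have "b < ?y (k - 1 - s)" using y[of "k - 1 - s"] d by auto
    then show "?f s = (1 when ?x s = b \<and> ?y (k - 1 - s) = a)"
      by (auto simp: max_def min_def when_def)
  qed simp
  also have "(\<Sum>s=d..<k - d. ?f s) = 0"
  proof (rule sum.neutral, rule ballI)
    fix s assume "s \<in> {d..<k - d}"
    then have "s < k" "k - 1 - s < k" "d \<le> s" "d \<le> k - 1 - s" by auto
    then have "d \<le> ?x s" "d \<le> ?y (k - 1 - s)" using x[of s] y[of "k - 1 - s"] by auto
    then show "?f s = 0" using d by (auto simp: when_def)
  qed
  also have "(\<Sum>s=k - d..<k. ?f s) = (\<Sum>s<d. (1 when ?y s = b \<and> ?x (k - 1 - s) = a))"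
  proof (rule sum.reindex_bij_witness[of _ "\<lambda>s. k - 1 - s" "\<lambda>s. k - 1 - s"])
    fix s assume s: "s \<in> {k - d..<k}"
    then have "b < ?x s" using x[of s] d by auto
    moreover have "k - 1 - (k - 1 - s) = s" using s by auto
    ultimately show "(1 when ?y (k - 1 - s) = b \<and> ?x (k - 1 - (k - 1 - s)) = a) = ?f s"
      by (auto simp: max_def min_def when_def)
  qed (use d in auto)
  finally show ?thesis by (simp add: edge_count_def)
qed

text \<open>The partner of one of the first \<open>d\<close> indices stands at position at least k -
  d of its increasing sequence, so its value is at least k - d.\<close>

lemma lookup_adiag_mon_zero:
  assumes k: "card R = k" "card C = k" and d: "2 * d \<le> k" "b < d" and a: "a + d < k"
  shows "lookup (adiag_mon R C) (a, b) = 0"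
proof -
  have "a < pick R (k - 1 - s)" "a < pick C (k - 1 - s)" if "s < d" for s
    using strict_mono_on_ge[OF strict_mono_on_pick, of "k - 1 - s" R]
      strict_mono_on_ge[OF strict_mono_on_pick, of "k - 1 - s" C] that k a by auto
  then have "edge_count d k (pick R) (pick C) a b = 0"
    by (auto simp: edge_count_def when_def)
  then show ?thesis by (simp add: lookup_adiag_mon[OF k d])
qed

text \<open>For antidiagonals longer than \<open>m\<close>, exponents in columns below
  \<open>d\<close> vanish in all rows before \<open>m - d\<close>; counting rows from there removes
  the dependence on \<open>m\<close>.\<close>

definition edge_part :: "nat \<Rightarrow> nat \<Rightarrow> (nat \<times> nat) monomial \<Rightarrow> nat \<times> nat \<Rightarrow> nat" where
  "edge_part d m g = (\<lambda>(c, b). if b < d then lookup g (m - d + c, b) else 0)"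

text \<open>Adds a middle entry: raising everything after index \<open>d\<close> by 1 leaves room
  for the new value \<open>x d + 1\<close> at index \<open>d + 1\<close>.\<close>

definition stretch :: "nat \<Rightarrow> (nat \<Rightarrow> nat) \<Rightarrow> nat \<Rightarrow> nat" where
  "stretch d x s = (if s \<le> d then x s else x (s - 1) + 1)"

text \<open>A left inverse of \<open>stretch d\<close>: the entry at index \<open>d\<close>
  disappears.\<close>

definition shrink :: "nat \<Rightarrow> (nat \<Rightarrow> nat) \<Rightarrow> nat \<Rightarrow> nat" where
  "shrink d x s = (if s < d then x s else x (Suc s) - 1)"

lemma strict_mono_on_stretch:
  assumes "strict_mono_on {..<k} x" "d < k"
  shows "strict_mono_on {..<Suc k} (stretch d x)"
proof (rule strict_mono_onI)
  fix s t assume st: "s \<in> {..<Suc k}" "t \<in> {..<Suc k}" "s < t"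
  note mono = strict_mono_onD[OF assms(1)]
  show "stretch d x s < stretch d x t"
  proof (cases "t \<le> d")
    case True
    then show ?thesis using st mono[of s t] assms(2) by (simp add: stretch_def)
  next
    case False
    then obtain t' where t: "t = Suc t'" by (cases t) auto
    have "x s \<le> x t'" if "s \<le> d"
      using mono[of s t'] st that t False by (cases "s = t'") auto
    moreover have "x (s - 1) < x t'" if "\<not> s \<le> d"
      using mono[of "s - 1" t'] st that t by auto
    ultimately show ?thesis using False t by (auto simp: stretch_def)
  qed
qed

text \<open>Across the removed index, \<open>x s < x t < x (Suc t)\<close> leaves room for lowering
  the last value by 1.\<close>

lemma strict_mono_on_shrink:
  assumes "strict_mono_on {..<Suc k} x"
  shows "strict_mono_on {..<k} (shrink d x)"
proof (rule strict_mono_onI)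
  fix s t assume st: "s \<in> {..<k}" "t \<in> {..<k}" "s < t"
  note mono = strict_mono_onD[OF assms]
  have "x s < x (Suc s)" "x (Suc s) < x (Suc t)" "x s < x t" "x t < x (Suc t)"
    using mono[of s "Suc s"] mono[of "Suc s" "Suc t"] mono[of s t] mono[of t "Suc t"] st by auto
  then show "shrink d x s < shrink d x t" using \<open>s < t\<close> by (auto simp: shrink_def)
qed

lemma edge_count_stretch:
  assumes "2 * d < k"
  shows "edge_count d (Suc k) (stretch d x) (stretch d y) (Suc a) b = edge_count d k x y a b"
proof -
  have "stretch d z (k - s) = Suc (z (k - Suc s))" if "s < d" for z s
    using that assms by (simp add: stretch_def)
  then show ?thesis
    unfolding edge_count_def by (intro arg_cong2[of _ _ _ _ "(+)"] sum.cong) (auto simp: stretch_def)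
qed

text \<open>The subtraction in \<open>shrink\<close> is truncated: a value 0 would stay 0 and
  wrongly match \<open>a = 0\<close>. Hence the positivity assumptions, which hold for
  \<open>pick\<close> because its value at \<open>s\<close> is at least \<open>s\<close>.\<close>

lemma edge_count_shrink:
  assumes "2 * d < k" "\<And>s. d < s \<Longrightarrow> s \<le> k \<Longrightarrow> 0 < x s" "\<And>s. d < s \<Longrightarrow> s \<le> k \<Longrightarrow> 0 < y s"
  shows "edge_count d (Suc k) x y (Suc a) b = edge_count d k (shrink d x) (shrink d y) a b"
proof -
  have "x (k - s) = Suc a \<longleftrightarrow> shrink d x (k - Suc s) = a" "y (k - s) = Suc a \<longleftrightarrow> shrink d y (k - Suc s) = a"
    if "s < d" for s
    using that assms(1) assms(2)[of "k - s"] assms(3)[of "k - s"] by (auto simp: shrink_def Suc_diff_Suc)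
  then show ?thesis
    unfolding edge_count_def by (intro arg_cong2[of _ _ _ _ "(+)"] sum.cong) (auto simp: shrink_def)
qed

lemma edge_part_eqI:
  assumes k: "card R = k" "card C = k" "card R' = Suc k" "card C' = Suc k" "2 * d < k" and m: "d \<le> m"
    and eq: "\<And>a b. edge_count d (Suc k) (pick R') (pick C') (Suc a) b = edge_count d k (pick R) (pick C) a b"
  shows "edge_part d (Suc m) (adiag_mon R' C') = edge_part d m (adiag_mon R C)"
proof (rule ext, clarify)
  fix c b
  have shift: "Suc m - d + c = Suc (m - d + c)" using m by simp
  have d: "2 * d \<le> k" "2 * d \<le> Suc k" using k(5) by auto
  have "lookup (adiag_mon R' C') (Suc m - d + c, b) = lookup (adiag_mon R C) (m - d + c, b)" if "b < d"
    unfolding shift lookup_adiag_mon[OF k(1,2) d(1) that] lookup_adiag_mon[OF k(3,4) d(2) that] by (rule eq)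
  then show "edge_part d (Suc m) (adiag_mon R' C') (c, b) = edge_part d m (adiag_mon R C) (c, b)"
    by (cases "b < d") (simp_all only: edge_part_def prod.case if_True if_False)
qed

lemma edge_count_cong:
  assumes "d \<le> k" "\<And>s. s < k \<Longrightarrow> x s = x' s" "\<And>s. s < k \<Longrightarrow> y s = y' s"
  shows "edge_count d k x y a b = edge_count d k x' y' a b"
  unfolding edge_count_def using assms by (intro arg_cong2[of _ _ _ _ "(+)"] sum.cong) auto

text \<open>The same \<open>i\<close>, \<open>j\<close> serve both sides, since
  \<open>perm_rank w i j\<close> does not involve \<open>m\<close>; the block bounds and the size of
  the minor all grow by 1. This is exactly the effect of \<open>stretch\<close> on rows and columns,
  and \<open>shrink\<close> reverses it.\<close>

lemma edge_parts_stable: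
  assumes m: "2 * d \<le> m"
  shows "edge_part d (Suc m) ` (\<lambda>(R, C). adiag_mon R C) ` shifted_positions (Suc m) n w =
    edge_part d m ` (\<lambda>(R, C). adiag_mon R C) ` shifted_positions m n w"
proof (intro equalityI subsetI)
  fix e assume "e \<in> edge_part d (Suc m) ` (\<lambda>(R, C). adiag_mon R C) ` shifted_positions (Suc m) n w"
  then obtain R' C' i j where ij: "i \<in> {1..n}" "j \<in> {1..n}" and sub: "R' \<subseteq> {..<Suc m + i}" "C' \<subseteq> {..<Suc m + j}"
    and card: "card R' = 1 + Suc m + perm_rank w i j" "card C' = 1 + Suc m + perm_rank w i j"
    and e: "e = edge_part d (Suc m) (adiag_mon R' C')"
    by (auto simp: shifted_positions_def)
  \<comment> \<open>The length of the shorter antidiagonal; it exceeds \<open>m\<close>, whence 2 d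
    < k.\<close>
  define k where "k = 1 + m + perm_rank w i j"
  have k: "card R' = Suc k" "card C' = Suc k" "2 * d < k" using card m by (auto simp: k_def)
  have mono: "strict_mono_on {..<Suc k} (pick R')" "strict_mono_on {..<Suc k} (pick C')"
    using strict_mono_on_pick[of R'] strict_mono_on_pick[of C'] k by simp_all
  note shrink = strict_mono_on_shrink[OF mono(1), of d] strict_mono_on_shrink[OF mono(2), of d]
  define R C where "R = shrink d (pick R') ` {..<k}" "C = shrink d (pick C') ` {..<k}"
  note pick = pick_image_strict_mono[OF shrink(1)] pick_image_strict_mono[OF shrink(2)]
  \<comment> \<open>Entries before index \<open>d\<close> are not lowered, but a further element of
    \<open>A\<close> follows them, which gives the sharper bound.\<close>
  have bound: "shrink d (pick A) s < m + l"
    if "A \<subseteq> {..<Suc m + l}" "card A = Suc k" "s < k" for A l s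
  proof -
    have "pick A s < pick A (Suc s)" "pick A (Suc s) < Suc m + l"
      using pick_mono_le[of "Suc s" A s] pick_less[OF that(1), of "Suc s"] that by auto
    then show ?thesis by (auto simp: shrink_def)
  qed
  have pos: "0 < pick A s" if "card A = Suc k" "d < s" "s \<le> k" for A s
    using strict_mono_on_ge[OF strict_mono_on_pick, of s A] that by simp
  have "edge_part d (Suc m) (adiag_mon R' C') = edge_part d m (adiag_mon R C)"
  proof (rule edge_part_eqI)
    fix a b
    have "edge_count d (Suc k) (pick R') (pick C') (Suc a) b =
        edge_count d k (shrink d (pick R')) (shrink d (pick C')) a b"
      by (rule edge_count_shrink) (use k pos in auto)
    also have "\<dots> = edge_count d k (pick R) (pick C) a b"
      by (rule edge_count_cong) (use k in \<open>auto simp: R_C_def pick\<close>)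
    finally show "edge_count d (Suc k) (pick R') (pick C') (Suc a) b = edge_count d k (pick R) (pick C) a b" .
  qed (use k m in \<open>auto simp: R_C_def pick\<close>)
  moreover have "(R, C) \<in> shifted_positions m n w"
  proof (rule shifted_positionsI[OF ij])
    show "R \<subseteq> {..<m + i}" "C \<subseteq> {..<m + j}"
      unfolding R_C_def using bound[OF sub(1) k(1)] bound[OF sub(2) k(2)] by auto
    show "card R = 1 + m + perm_rank w i j" "card C = 1 + m + perm_rank w i j"
      unfolding R_C_def pick by (simp_all add: k_def)
  qed
  ultimately show "e \<in> edge_part d m ` (\<lambda>(R, C). adiag_mon R C) ` shifted_positions m n w"
    unfolding e by (intro image_eqI[of _ _ "adiag_mon R C"] image_eqI[of _ _ "(R, C)"]) simp_all
next
  fix e assume "e \<in> edge_part d m ` (\<lambda>(R, C). adiag_mon R C) ` shifted_positions m n w"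
  then obtain R C i j where ij: "i \<in> {1..n}" "j \<in> {1..n}" and sub: "R \<subseteq> {..<m + i}" "C \<subseteq> {..<m + j}"
    and card: "card R = 1 + m + perm_rank w i j" "card C = 1 + m + perm_rank w i j"
    and e: "e = edge_part d m (adiag_mon R C)"
    by (auto simp: shifted_positions_def)
  define k where "k = 1 + m + perm_rank w i j"
  have k: "card R = k" "card C = k" "2 * d < k" using card m by (auto simp: k_def)
  have mono: "strict_mono_on {..<k} (pick R)" "strict_mono_on {..<k} (pick C)"
    using strict_mono_on_pick[of R] strict_mono_on_pick[of C] k by simp_all
  have "d < k" using k by simp
  note stretch = strict_mono_on_stretch[OF mono(1) this] strict_mono_on_stretch[OF mono(2) this]
  define R' C' where "R' = stretch d (pick R) ` {..<Suc k}" "C' = stretch d (pick C) ` {..<Suc k}"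
  note pick = pick_image_strict_mono[OF stretch(1)] pick_image_strict_mono[OF stretch(2)]
  have bound: "stretch d (pick A) s < Suc m + l"
    if "A \<subseteq> {..<m + l}" "card A = k" "s < Suc k" for A l s
    using pick_less[OF that(1), of s] pick_less[OF that(1), of "s - 1"] that \<open>d < k\<close>
    by (cases "s = 0") (auto simp: stretch_def)
  have "edge_part d (Suc m) (adiag_mon R' C') = edge_part d m (adiag_mon R C)"
  proof (rule edge_part_eqI)
    fix a b
    have "edge_count d (Suc k) (pick R') (pick C') (Suc a) b =
        edge_count d (Suc k) (stretch d (pick R)) (stretch d (pick C)) (Suc a) b"
      by (rule edge_count_cong) (use k in \<open>auto simp: R'_C'_def pick\<close>)
    also have "\<dots> = edge_count d k (pick R) (pick C) a b"
      by (rule edge_count_stretch[OF k(3)])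
    finally show "edge_count d (Suc k) (pick R') (pick C') (Suc a) b = edge_count d k (pick R) (pick C) a b" .
  qed (use k m in \<open>auto simp: R'_C'_def pick\<close>)
  moreover have "(R', C') \<in> shifted_positions (Suc m) n w"
  proof (rule shifted_positionsI[OF ij])
    show "R' \<subseteq> {..<Suc m + i}" "C' \<subseteq> {..<Suc m + j}"
      unfolding R'_C'_def using bound[OF sub(1) k(1)] bound[OF sub(2) k(2)] by auto
    show "card R' = 1 + Suc m + perm_rank w i j" "card C' = 1 + Suc m + perm_rank w i j"
      unfolding R'_C'_def pick by (simp_all add: k_def)
  qed
  ultimately show "e \<in> edge_part d (Suc m) ` (\<lambda>(R, C). adiag_mon R C) ` shifted_positions (Suc m) n w"
    unfolding e by (intro image_eqI[of _ _ "adiag_mon R' C'"] image_eqI[of _ _ "(R', C')"]) simp_all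
qed

subsection \<open>The stable limit\<close>

lemma eval_mpol_alt:
  assumes "\<phi> 0 = 0" "finite A" "keys p \<subseteq> A"
  shows "eval_mpol \<phi> g p = (\<Sum>m\<in>A. \<phi> (lookup p m) * (\<Prod>v\<in>keys m. g v ^ lookup m v))"
  unfolding eval_mpol_def using assms
  by (intro sum.mono_neutral_left) (auto simp: in_keys_iff)

lemma eval_mpol_add:
  assumes "\<phi> 0 = 0" "\<And>a b. \<phi> (a + b) = \<phi> a + \<phi> b"
  shows "eval_mpol \<phi> g (p + q) = eval_mpol \<phi> g p + eval_mpol \<phi> g q"
proof -
  let ?A = "keys p \<union> keys q"
  have "keys (p + q) \<subseteq> ?A" by (rule keys_add)
  then show ?thesis
    using assms
    by (simp add: eval_mpol_alt[of \<phi> ?A] lookup_add distrib_right sum.distrib)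
qed

lemma eval_mpol_single:
  assumes "\<phi> 0 = 0"
  shows "eval_mpol \<phi> g (single m c) = \<phi> c * (\<Prod>v\<in>keys m. g v ^ lookup m v)"
  using assms by (simp add: eval_mpol_alt[of \<phi> "{m}"])

lemma eval_mpol_sum:
  assumes "\<phi> 0 = 0" "\<And>a b. \<phi> (a + b) = \<phi> a + \<phi> b"
  shows "eval_mpol \<phi> g (\<Sum>a\<in>A. f a) = (\<Sum>a\<in>A. eval_mpol \<phi> g (f a))"
  by (induction A rule: infinite_finite_induct)
    (auto simp: eval_mpol_add[of \<phi>, OF assms], auto simp: eval_mpol_def)

definition one_minus_power :: "nat monomial \<Rightarrow> (nat, 'a::comm_ring_1) mpol" where
  "one_minus_power \<omega> = (\<Prod>v\<in>keys \<omega>. (1 - var_pol v) ^ lookup \<omega> v)"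

lemma eval_taylor_poly:
  "eval_mpol of_int (\<lambda>v. 1 - var_pol v) (taylor_poly G) =
     alt_sum G (\<lambda>S. one_minus_power (mon_weight (mlcm S)) :: (nat, 'a::comm_ring_1) mpol)"
  unfolding taylor_poly_def alt_sum_def
  by (subst eval_mpol_sum) (simp_all add: eval_mpol_single one_minus_power_def)

lemma lookup_neg_one_power_mult:
  "lookup ((- 1) ^ k * (q :: ('v, 'a::comm_ring_1) mpol)) \<mu> = (- 1) ^ k * lookup q \<mu>"
  by (cases "even k") auto

lemma lookup_alt_sum:
  "lookup (alt_sum G (F :: _ \<Rightarrow> ('v, 'a::comm_ring_1) mpol)) \<mu> = alt_sum G (\<lambda>S. lookup (F S) \<mu>)"
  by (simp add: alt_sum_def lookup_sum lookup_neg_one_power_mult)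

text \<open>Only the constant term of the power can contribute to a monomial without the variable
  \<open>v\<close>.\<close>

lemma lookup_mult_one_minus_power:
  fixes q :: "('v, 'a::comm_ring_1) mpol"
  assumes "lookup \<mu> v = 0"
  shows "lookup (q * (1 - var_pol v) ^ e) \<mu> = lookup q \<mu>"
proof (induction e)
  case (Suc e)
  let ?q = "q * (1 - var_pol v) ^ e"
  have "\<mu> \<noteq> single v 1 + k" for k
    using assms by (metis add_eq_0_iff_both_eq_0 lookup_add lookup_single_eq zero_neq_one)
  then have "lookup (single (single v 1) 1 * ?q) \<mu> = 0"
    by (rule lookup_single_mult_zero)
  then have "lookup (?q - single (single v 1) 1 * ?q) \<mu> = lookup ?q \<mu>"
    by (simp add: lookup_minus)
  moreover have "q * (1 - var_pol v) ^ Suc e = ?q - single (single v 1) 1 * ?q"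
    by (simp add: var_pol_def monom_pol_def algebra_simps)
  ultimately show ?case using Suc by simp
qed simp

text \<open>Factors of variables from \<open>d\<close> on are dropped one at a time; those below
  \<open>d\<close> with exponent 0 equal 1, so the product may run over all of them.\<close>

lemma lookup_one_minus_power:
  fixes \<omega> \<mu> :: "nat monomial"
  assumes "keys \<mu> \<subseteq> {..<d}"
  shows "lookup (one_minus_power \<omega> :: (nat, 'a::comm_ring_1) mpol) \<mu> =
    lookup (\<Prod>v<d. (1 - var_pol v) ^ lookup \<omega> v :: (nat, 'a) mpol) \<mu>"
proof -
  let ?f = "\<lambda>v. (1 - var_pol v) ^ lookup \<omega> v :: (nat, 'a) mpol"
  have drop: "lookup (q * prod ?f B) \<mu> = lookup q \<mu>" if "finite B" "B \<inter> {..<d} = {}" for B q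
    using that
  proof (induction B arbitrary: q rule: finite_induct)
    case (insert v B)
    then have "lookup \<mu> v = 0" using assms by (auto simp: in_keys_iff)
    then have "lookup ((q * ?f v) * prod ?f B) \<mu> = lookup q \<mu>"
      using insert.IH[of "q * ?f v"] insert.prems lookup_mult_one_minus_power[of \<mu> v q] by simp
    then show ?case using insert.hyps by (simp add: mult.assoc)
  qed simp
  have "one_minus_power \<omega> = prod ?f ({..<d} \<union> (keys \<omega> - {..<d}))"
    unfolding one_minus_power_def
    by (rule prod.mono_neutral_left) (auto simp: in_keys_iff)
  also have "\<dots> = prod ?f {..<d} * prod ?f (keys \<omega> - {..<d})"
    by (rule prod.union_disjoint) auto
  finally show ?thesis using drop[of "keys \<omega> - {..<d}" "prod ?f {..<d}"] by auto
qed

section \<open>Permutations and the substitution\<close>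

context var_perm
begin

abbreviation permute_series :: "(nat, 'a::zero) mpol \<Rightarrow> (nat, 'a) mpol" where
  "permute_series \<equiv> Poly_Mapping.map_key permute"

lemma permute_series_single: "permute_series (single \<alpha> c) = single (inv.permute \<alpha>) c"
  by (rule map_key_single') simp_all

lemma permute_series_mult:
  "permute_series (p * q) = permute_series p * permute_series (q :: (nat, 'a::comm_ring_1) mpol)"
proof -
  have "permute_series (single \<alpha> a * single \<beta> b) =
      permute_series (single \<alpha> a) * permute_series (single \<beta> (b :: 'a))" for \<alpha> \<beta> a b
    by (simp add: permute_series_single mult_single map_key_plus)
  then have "permute_series ((\<Sum>\<alpha>\<in>keys p. single \<alpha> (lookup p \<alpha>)) * (\<Sum>\<beta>\<in>keys q. single \<beta> (lookup q \<beta>))) =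
      permute_series (\<Sum>\<alpha>\<in>keys p. single \<alpha> (lookup p \<alpha>)) * permute_series (\<Sum>\<beta>\<in>keys q. single \<beta> (lookup q \<beta>))"
    by (simp add: sum_product map_key_sum)
  then show ?thesis by (simp only: sum_singles_keys)
qed

lemma permute_series_1: "permute_series (1 :: (nat, 'a::comm_ring_1) mpol) = 1"
  using permute_series_single[of 0 "1 :: 'a"] by simp

lemma permute_series_prod:
  "permute_series (\<Prod>a\<in>A. f a :: (nat, 'a::comm_ring_1) mpol) = (\<Prod>a\<in>A. permute_series (f a))"
  by (induction A rule: infinite_finite_induct) (simp_all add: permute_series_1 permute_series_mult)

lemma permute_series_power:
  "permute_series ((p :: (nat, 'a::comm_ring_1) mpol) ^ e) = permute_series p ^ e"
  by (induction e) (simp_all add: permute_series_1 permute_series_mult)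

lemma permute_series_diff: "permute_series (p - q) = permute_series p - permute_series (q :: (nat, 'a::comm_ring_1) mpol)"
  by (intro poly_mapping_eqI) (simp add: lookup_map_key lookup_minus)

lemma permute_series_of_int_mult:
  "permute_series (of_int c * p) = of_int c * permute_series (p :: (nat, 'a::comm_ring_1) mpol)"
proof -
  have "permute_series (of_int c :: (nat, 'a) mpol) = of_int c"
    using permute_series_single[of 0 "of_int c :: 'a"] by simp
  then show ?thesis by (simp add: permute_series_mult)
qed

lemma permute_one_minus_power:
  "permute_series (one_minus_power \<omega> :: (nat, 'a::comm_ring_1) mpol) = one_minus_power (inv.permute \<omega>)"
proof -
  have var: "permute_series (1 - var_pol v :: (nat, 'a) mpol) = 1 - var_pol (\<sigma> v)" for v
  proof -
    have "inv.permute (single v (1 :: nat)) = single (\<sigma> v) 1"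
      by (rule map_key_single') simp_all
    then show ?thesis
      by (simp add: permute_series_diff permute_series_1 var_pol_def monom_pol_def permute_series_single)
  qed
  have "keys (inv.permute \<omega>) = \<sigma> ` keys \<omega>"
  proof (intro equalityI subsetI)
    fix v assume "v \<in> keys (inv.permute \<omega>)"
    then have "v = \<sigma> (\<sigma>' v)" "\<sigma>' v \<in> keys \<omega>" by (simp_all add: in_keys_iff lookup_map_key)
    then show "v \<in> \<sigma> ` keys \<omega>" by (rule image_eqI)
  qed (auto simp: in_keys_iff lookup_map_key)
  moreover have "inj_on \<sigma> (keys \<omega>)" by (rule inj_on_subset[OF inj]) simp
  ultimately show ?thesis
    by (simp add: one_minus_power_def permute_series_prod permute_series_power var prod.reindex lookup_map_key)
qed

text \<open>The same substitution is made for every variable, so it commutes with renaming, and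
  symmetry in the \<open>a\<close> variables passes to the \<open>x\<close> variables.\<close>

lemma eval_one_minus_permute:
  fixes P :: "(nat, int) mpol"
  assumes P: "\<And>\<alpha>. lookup P (permute \<alpha>) = lookup P \<alpha>"
  shows "lookup (eval_mpol of_int (\<lambda>v. 1 - var_pol v) P :: (nat, 'a::comm_ring_1) mpol) (permute \<mu>) =
    lookup (eval_mpol of_int (\<lambda>v. 1 - var_pol v) P :: (nat, 'a) mpol) \<mu>"
proof -
  let ?E = "eval_mpol of_int (\<lambda>v. 1 - var_pol v) P :: (nat, 'a) mpol"
  have E: "?E = (\<Sum>\<alpha>\<in>keys P. of_int (lookup P \<alpha>) * one_minus_power \<alpha>)"
    by (simp add: eval_mpol_def one_minus_power_def)
  have P': "lookup P (inv.permute \<alpha>) = lookup P \<alpha>" for \<alpha>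
    using P[of "inv.permute \<alpha>"] by simp
  have "permute_series ?E = (\<Sum>\<alpha>\<in>keys P. of_int (lookup P \<alpha>) * one_minus_power (inv.permute \<alpha>))"
    unfolding E by (simp add: map_key_sum permute_series_of_int_mult permute_one_minus_power)
  also have "\<dots> = ?E"
    unfolding E
    by (rule sum.reindex_bij_witness[of _ permute inv.permute]) (auto simp: in_keys_iff P P')
  finally have "lookup (permute_series ?E) \<mu> = lookup ?E \<mu>" by simp
  then show ?thesis by (simp only: lookup_map_key[OF inj_permute])
qed

end

text \<open>The complements of \<open>K\<close> and of its image have equal size. This reduces an
  arbitrary bijection, as far as one monomial is concerned, to a permutation of the first
  \<open>m\<close> variables.\<close>

lemma extend_to_permutation:
  fixes \<pi> :: "nat \<Rightarrow> nat"
  assumes "K \<subseteq> {..<m}" "inj_on \<pi> K" "\<pi> ` K \<subseteq> {..<m}"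
  obtains \<sigma> where "\<sigma> permutes {..<m}" "\<And>v. v \<in> K \<Longrightarrow> \<sigma> v = \<pi> v"
proof -
  have fin: "finite K" by (rule finite_subset[OF assms(1)]) simp
  have "card ({..<m} - K) = card ({..<m} - \<pi> ` K)"
    using assms fin by (simp add: card_Diff_subset card_image)
  then obtain h where h: "bij_betw h ({..<m} - K) ({..<m} - \<pi> ` K)"
    using finite_same_card_bij[of "{..<m} - K" "{..<m} - \<pi> ` K"] by auto
  define \<sigma> where "\<sigma> v = (if v \<in> K then \<pi> v else if v < m then h v else v)" for v
  have "bij_betw \<sigma> K (\<pi> ` K)"
    using assms(2) by (auto simp: bij_betw_def \<sigma>_def inj_on_def)
  moreover have "bij_betw \<sigma> ({..<m} - K) ({..<m} - \<pi> ` K)"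
    using h by (rule bij_betw_cong[THEN iffD1, rotated]) (simp add: \<sigma>_def)
  ultimately have "bij_betw \<sigma> (K \<union> ({..<m} - K)) (\<pi> ` K \<union> ({..<m} - \<pi> ` K))"
    by (rule bij_betw_combine) auto
  moreover have "K \<union> ({..<m} - K) = {..<m}" "\<pi> ` K \<union> ({..<m} - \<pi> ` K) = {..<m}"
    using assms by auto
  ultimately have "bij_betw \<sigma> {..<m} {..<m}" by simp
  then have "\<sigma> permutes {..<m}"
    by (rule bij_imp_permutes) (use assms(1) in \<open>auto simp: \<sigma>_def\<close>)
  then show ?thesis by (rule that) (simp add: \<sigma>_def)
qed

text \<open>A variable can contribute through either index. With \<open>v\<close> as its larger
  index it would lie in row v < m - d, where exponents vanish; what remains is column
  \<open>v\<close> in the n + d rows from m - d to m + n - 1.\<close>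

lemma lookup_mon_weight_mlcm:
  assumes m: "2 * d \<le> m" and S: "S \<subseteq> (\<lambda>(R, C). adiag_mon R C) ` shifted_positions m n w" "finite S"
    "S \<subseteq> mons (m + n)" and v: "v < d"
  shows "lookup (mon_weight (mlcm S)) v =
    (\<Sum>c<n + d. Max (insert 0 ((\<lambda>h. h (c, v)) ` edge_part d m ` S)))"
proof -
  let ?L = "mlcm S"
  have zero: "lookup ?L (a, b) = 0" if "b < d" "a < m - d" for a b
  proof -
    have "lookup g (a, b) = 0" if g: "g \<in> S" for g
    proof -
      obtain R C i j where RC: "g = adiag_mon R C"
        "card R = 1 + m + perm_rank w i j" "card C = 1 + m + perm_rank w i j"
        using S(1) g by (auto simp: shifted_positions_def)
      show ?thesis
        unfolding RC(1) by (rule lookup_adiag_mon_zero[OF RC(2,3)]) (use m \<open>b < d\<close> \<open>a < m - d\<close> in auto)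
    qed
    then have "(\<lambda>g. lookup g (a, b)) ` S \<subseteq> {0}" by auto
    then have eq: "insert 0 ((\<lambda>g. lookup g (a, b)) ` S) = {0}" by auto
    show ?thesis unfolding lookup_mlcm[OF S(2)] eq by simp
  qed
  have keys: "keys ?L \<subseteq> sym_vars (m + n)"
    using mlcm_in_mons[OF S(2,3)] by (simp add: mons_def)
  let ?I = "(\<lambda>c. (m - d + c, v)) ` {..<n + d}"
  have "lookup (mon_weight ?L) v =
      (\<Sum>(a, b)\<in>sym_vars (m + n). (lookup ?L (a, b) when a = v) + (lookup ?L (a, b) when b = v))"
    by (rule lookup_mon_weight[OF _ keys]) simp
  also have "\<dots> = (\<Sum>(a, b)\<in>?I. (lookup ?L (a, b) when a = v) + (lookup ?L (a, b) when b = v))"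
  proof (rule sum.mono_neutral_right)
    show "?I \<subseteq> sym_vars (m + n)" using m v by (auto simp: sym_vars_def)
    show "\<forall>x\<in>sym_vars (m + n) - ?I. (case x of (a, b) \<Rightarrow>
        (lookup ?L (a, b) when a = v) + (lookup ?L (a, b) when b = v)) = 0"
    proof (rule ballI)
      fix x assume x: "x \<in> sym_vars (m + n) - ?I"
      obtain a b where ab: "x = (a, b)" by (cases x)
      have ba: "b \<le> a" "a < m + n" using x ab by (auto simp: sym_vars_def)
      have "lookup ?L (a, b) = 0" if "a = v \<or> b = v"
      proof (rule zero)
        show "b < d" using that ba v by auto
        show "a < m - d"
        proof (rule ccontr)
          assume "\<not> a < m - d"
          then have c: "a \<noteq> v" "a = m - d + (a - (m - d))" "a - (m - d) < n + d" using m v ba by auto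
          then have "x = (m - d + (a - (m - d)), v)" using that ab by simp
          then have "x \<in> ?I" using c(3) by (intro image_eqI[of _ _ "a - (m - d)"]) auto
          with x show False by simp
        qed
      qed
      then show "(case x of (a, b) \<Rightarrow> (lookup ?L (a, b) when a = v) + (lookup ?L (a, b) when b = v)) = 0"
        by (auto simp: ab when_def)
    qed
  qed simp
  also have "\<dots> = (\<Sum>c<n + d. lookup ?L (m - d + c, v))"
  proof (subst sum.reindex)
    show "inj_on (\<lambda>c. (m - d + c, v)) {..<n + d}" by (auto simp: inj_on_def)
    have "m - d + c \<noteq> v" for c using m v by auto
    then show "sum ((\<lambda>(a, b). (lookup ?L (a, b) when a = v) + (lookup ?L (a, b) when b = v)) \<circ>
        (\<lambda>c. (m - d + c, v))) {..<n + d} = (\<Sum>c<n + d. lookup ?L (m - d + c, v))"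
      by (intro sum.cong) auto
  qed
  also have "\<dots> = (\<Sum>c<n + d. Max (insert 0 ((\<lambda>h. h (c, v)) ` edge_part d m ` S)))"
    by (simp add: lookup_mlcm[OF S(2)] image_image edge_part_def v)
  finally show ?thesis .
qed

section \<open>Coefficients of the classes and their limit\<close>

context
  fixes n :: nat and w :: "nat \<Rightarrow> nat"
  assumes I_eq: "\<And>N (v :: 'a::field mat). N > 0 \<Longrightarrow> v \<in> sym_mat N \<Longrightarrow>
                   I_sym N v = vanishing_ideal N (MSV_sym N v)"
    and J_eq: "\<And>N (v :: 'a mat). N > 0 \<Longrightarrow> v \<in> sym_mat N \<Longrightarrow>
                   J_sym N v = init_ideal N (vanishing_ideal N (MSV_sym N v))"
    and n: "n > 0"
    and w: "\<And>x. w (w x) = x"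
begin

abbreviation (input) shifted_mat :: "nat \<Rightarrow> 'a mat" where
  "shifted_mat m \<equiv> partial_perm_mat (m + n) (shift_perm m w)"

abbreviation (input) shifted_gens :: "nat \<Rightarrow> (nat \<times> nat) monomial set" where
  "shifted_gens m \<equiv> (\<lambda>(R, C). adiag_mon R C) ` shifted_positions m n w"

abbreviation (input) shifted_GO :: "nat \<Rightarrow> (nat, 'a) mpol" where
  "shifted_GO m \<equiv> GO (m + n) (shift_perm m w)"

lemma ideals_eq:
  "I_sym (m + n) (shifted_mat m) = vanishing_ideal (m + n) (MSV_sym (m + n) (shifted_mat m))"
  "J_sym (m + n) (shifted_mat m) = init_ideal (m + n) (vanishing_ideal (m + n) (MSV_sym (m + n) (shifted_mat m)))"
  using n by (auto intro!: I_eq J_eq partial_perm_mat_sym shift_perm_involution w)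

lemma shifted_GO_alt:
  "shifted_GO m = eval_mpol of_int (\<lambda>v. 1 - var_pol v) (K_class (m + n) (MSV_sym (m + n) (shifted_mat m)))"
  by (simp add: GO_def GO_a_def)

lemma shifted_GO_permute:
  assumes \<sigma>: "\<sigma> permutes {..<m}"
  shows "lookup (shifted_GO m) (Poly_Mapping.map_key \<sigma> \<mu>) = lookup (shifted_GO m) \<mu>"
proof -
  have lt: "\<sigma> x < m + n \<longleftrightarrow> x < m + n" for x
    using permutes_in_image[OF permutes_subset[OF \<sigma>, of "{..<m + n}"], of x] by simp
  interpret var_perm_bounded \<sigma> "inv_into UNIV \<sigma>" "m + n"
    by unfold_locales (simp_all add: permutes_inverses[OF \<sigma>] lt)
  show ?thesis
    unfolding shifted_GO_alt
    by (intro eval_one_minus_permute K_class_permute[OF ideals_eq] MSV_sym_conjugate w \<sigma> permutes_inv[OF \<sigma>])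
qed

lemma shifted_gens: "adiag_gens (m + n) (shifted_mat m) = shifted_gens m"
  by (simp add: adiag_gens_def minor_positions_shift[OF w])

text \<open>
  The coefficient of a monomial in the first \<open>d\<close> variables only sees the parts of the generators
  in \<^const>\<open>edge_part\<close>: all other variables may be set to \<open>0\<close>, that is, \<open>a\<^sub>i = 1\<close> for \<open>i \<ge> d\<close>.
\<close>
lemma lookup_shifted_GO:
  assumes m: "2 * d \<le> m" and \<mu>: "keys \<mu> \<subseteq> {..<d}"
  shows "lookup (shifted_GO m) \<mu> = alt_sum (edge_part d m ` shifted_gens m)
    (\<lambda>T. lookup (\<Prod>v<d. (1 - var_pol v) ^ (\<Sum>c<n + d. Max (insert 0 ((\<lambda>h. h (c, v)) ` T)))) \<mu>)"
    (is "_ = alt_sum _ ?F")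
proof -
  have fin: "finite (shifted_gens m)" and sub: "shifted_gens m \<subseteq> mons (m + n)"
    using finite_adiag_gens[of "m + n" "shifted_mat m"] adiag_gens_subset[of "m + n" "shifted_mat m"]
    by (simp_all only: shifted_gens)
  have "lookup (shifted_GO m) \<mu> =
      alt_sum (shifted_gens m) (\<lambda>S. lookup (one_minus_power (mon_weight (mlcm S)) :: (nat, 'a) mpol) \<mu>)"
    by (simp add: shifted_GO_alt K_class_taylor[OF ideals_eq] shifted_gens eval_taylor_poly lookup_alt_sum)
  also have "\<dots> = alt_sum (shifted_gens m) (\<lambda>S. ?F (edge_part d m ` S))"
  proof (rule alt_sum_cong)
    fix S assume S: "S \<subseteq> shifted_gens m"
    then have "finite S" "S \<subseteq> mons (m + n)" using fin sub finite_subset by auto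
    then have "lookup (mon_weight (mlcm S)) v = (\<Sum>c<n + d. Max (insert 0 ((\<lambda>h. h (c, v)) ` edge_part d m ` S)))"
      if "v < d" for v
      using lookup_mon_weight_mlcm[OF m S _ _ that] by simp
    then show "lookup (one_minus_power (mon_weight (mlcm S)) :: (nat, 'a) mpol) \<mu> = ?F (edge_part d m ` S)"
      unfolding lookup_one_minus_power[OF \<mu>] by simp
  qed
  also have "\<dots> = alt_sum (edge_part d m ` shifted_gens m) ?F"
    by (rule alt_sum_image[OF fin])
  finally show ?thesis .
qed

text \<open>In the formula of \<open>lookup_shifted_GO\<close> the number \<open>m\<close> enters
  only through the set of edge parts.\<close>

lemma lookup_shifted_GO_stable:
  assumes "2 * d \<le> m" "keys \<mu> \<subseteq> {..<d}"
  shows "lookup (shifted_GO m) \<mu> = lookup (shifted_GO (2 * d)) \<mu>"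
proof -
  have "edge_part d m ` shifted_gens m = edge_part d (2 * d) ` shifted_gens (2 * d)"
    using assms(1) by (induction m rule: dec_induct) (simp_all only: edge_parts_stable)
  then show ?thesis by (simp only: lookup_shifted_GO[OF assms] lookup_shifted_GO[OF order_refl assms(2)])
qed

lemma stable_limit:
  "\<exists>f :: 'a series. converges_to shifted_GO f \<and> symmetric_series f"
proof -
  \<comment> \<open>Any bound above all variable indices of \<mu> would serve.\<close>
  define D :: "nat monomial \<Rightarrow> nat" where "D \<mu> = (\<Sum>v\<in>keys \<mu>. Suc v)" for \<mu>
  define f where "f \<mu> = lookup (shifted_GO (2 * D \<mu>)) \<mu>" for \<mu>
  have D: "keys \<mu> \<subseteq> {..<D \<mu>}" for \<mu>
  proof
    fix v assume "v \<in> keys \<mu>"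
    then have "Suc v \<le> D \<mu>" unfolding D_def by (intro member_le_sum) auto
    then show "v \<in> {..<D \<mu>}" by simp
  qed
  have f: "lookup (shifted_GO m) \<mu> = f \<mu>" if "2 * D \<mu> \<le> m" for m \<mu>
    unfolding f_def by (rule lookup_shifted_GO_stable[OF that D])
  have "converges_to shifted_GO f"
    unfolding converges_to_def using f by (auto simp: eventually_sequentially)
  moreover have "f (Poly_Mapping.map_key \<pi> \<mu>) = f \<mu>" if \<pi>: "bij \<pi>" for \<pi> \<mu>
  proof -
    let ?\<mu> = "Poly_Mapping.map_key \<pi> \<mu>"
    \<comment> \<open>Large enough that both coefficients have reached their limits and both
      supports lie among the first \<open>m\<close> variables.\<close>
    define m where "m = 2 * D \<mu> + 2 * D ?\<mu>"
    have inj: "inj \<pi>" and surj: "surj \<pi>" using \<pi> by (auto simp: bij_def)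
    have keys: "\<pi> ` keys ?\<mu> = keys \<mu>"
      unfolding keys_map_key[OF inj] using surj by (rule surj_image_vimage_eq)
    have "keys ?\<mu> \<subseteq> {..<m}" "\<pi> ` keys ?\<mu> \<subseteq> {..<m}"
      using D[of \<mu>] D[of ?\<mu>] unfolding keys m_def by fastforce+
    moreover have "inj_on \<pi> (keys ?\<mu>)" using inj by (rule inj_on_subset) simp
    ultimately obtain \<sigma> where \<sigma>: "\<sigma> permutes {..<m}" "\<And>v. v \<in> keys ?\<mu> \<Longrightarrow> \<sigma> v = \<pi> v"
      using extend_to_permutation[of "keys ?\<mu>" m \<pi>] by metis
    have injs: "inj \<sigma>" by (rule permutes_inj[OF \<sigma>(1)])
    have "Poly_Mapping.map_key \<sigma> \<mu> = ?\<mu>"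
    proof (rule poly_mapping_eqI)
      fix v
      show "lookup (Poly_Mapping.map_key \<sigma> \<mu>) v = lookup ?\<mu> v"
      proof (cases "v \<in> keys ?\<mu>")
        case True
        then show ?thesis by (simp add: lookup_map_key inj injs \<sigma>(2))
      next
        case False
        \<comment> \<open>All of the support of \<mu> is already attained on
          \<open>keys ?\<mu>\<close>, where \<sigma> agrees with \<pi>; injectivity excludes further
          preimages.\<close>
        have "\<sigma> v \<notin> keys \<mu>"
        proof
          assume "\<sigma> v \<in> keys \<mu>"
          then obtain u where "u \<in> keys ?\<mu>" "\<sigma> v = \<pi> u" using keys by (metis imageE)
          then have "\<sigma> v = \<sigma> u" using \<sigma>(2) by simp
          then have "v = u" using injs by (simp add: inj_eq)
          with False \<open>u \<in> keys ?\<mu>\<close> show False by simp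
        qed
        then show ?thesis using False by (simp add: lookup_map_key injs in_keys_iff)
      qed
    qed
    then have "lookup (shifted_GO m) ?\<mu> = lookup (shifted_GO m) \<mu>"
      using shifted_GO_permute[OF \<sigma>(1), of \<mu>] by simp
    then show ?thesis using f[of \<mu> m] f[of ?\<mu> m] by (simp add: m_def)
  qed
  ultimately show ?thesis unfolding symmetric_series_def by blast
qed

end

lemma I_inf_involution:
  assumes "w \<in> I_inf n"
  shows "w (w x) = x"
proof -
  have "inj w" "w = inv_into UNIV w" using assms by (auto simp: I_inf_def S_inf_def bij_def)
  then show ?thesis by (metis inv_f_f)
qed

theorem theorem7p13:
  fixes n :: nat and w :: "nat \<Rightarrow> nat"
  assumes I_eq: "\<And>N (v :: 'a::alg_closed_field mat). N > 0 \<Longrightarrow> v \<in> sym_mat N \<Longrightarrow>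
                   I_sym N v = vanishing_ideal N (MSV_sym N v)"
    and J_eq: "\<And>N (v :: 'a mat). N > 0 \<Longrightarrow> v \<in> sym_mat N \<Longrightarrow>
                   J_sym N v = init_ideal N (vanishing_ideal N (MSV_sym N v))"
    and n: "n > 0"
    and w: "w \<in> I_inf n"
  shows "\<exists>f :: 'a series.
           converges_to (\<lambda>m. GO (m + n) (shift_perm m w)) f \<and> symmetric_series f"
  by (rule stable_limit[OF I_eq J_eq n I_inf_involution[OF w]])

end
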